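(* Let $\mathcal{H}$ be a Hilbert space and let $\mathfrak{A}$ be a weak-$*$ closed unital subalgebra of $\mathcal{B}(\mathcal{H})$ which contains a weak-$*$ dense subalgebra consisting of compact operators. Then $\mathfrak{A}$, regarded as a Banach space with the operator norm, has a strongly unique predual.
   Context: The algebra $\mathfrak{A}$ is not assumed self-adjoint; unital means that it contains the identity operator of $\mathcal{H}$. The weak-$*$ topology is the one on $\mathcal{B}(\mathcal{H})$ as the dual of the trace class operators. For a Banach space $X$ with dual $X^*$, a norm-closed subspace $E\subseteq X^*$ is called a predual of $X$, written $X=E^*$, if the canonical map $X\to E^*$, $x\mapsto(\phi\mapsto\phi(x))$, is an isometric isomorphism onto $E^*$. $X$ has a strongly unique predual if there is exactly one norm-closed subspace $E\subseteq X^*$ with $X=E^*$. *)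

theory Defs
  imports "HOL-Analysis.Analysis" "HOL-Library.Function_Algebras"
begin

section \<open>Complex Hilbert spaces\<close>

text \<open>A complex Hilbert space is presented together with its underlying real Hilbert space: the real
  inner product is the real part of the complex one, hence the norm is the one induced by
  \<open>cinner\<close>, which is linear in its first argument. No separability or dimension assumption is
  made.\<close>

class complex_hilbert_space = real_inner + banach +
  fixes scaleC :: "complex \<Rightarrow> 'a \<Rightarrow> 'a"  (infixr "*\<^sub>C" 75)
    and cinner :: "'a \<Rightarrow> 'a \<Rightarrow> complex"
  assumes scaleC_add_right: "a *\<^sub>C (x + y) = a *\<^sub>C x + a *\<^sub>C y"
    and scaleC_add_left: "(a + b) *\<^sub>C x = a *\<^sub>C x + b *\<^sub>C x"
    and scaleC_scaleC: "a *\<^sub>C b *\<^sub>C x = (a * b) *\<^sub>C x"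
    and scaleR_scaleC: "r *\<^sub>R x = complex_of_real r *\<^sub>C x"
    and cinner_commute: "cinner x y = cnj (cinner y x)"
    and cinner_add_left: "cinner (x + y) z = cinner x z + cinner y z"
    and cinner_scaleC_left: "cinner (a *\<^sub>C x) y = a * cinner x y"
    and inner_eq_Re_cinner: "inner x y = Re (cinner x y)"

lemma norm_scaleC: "norm (c *\<^sub>C x) = cmod c * norm (x :: 'a :: complex_hilbert_space)"
proof -
  have r: "cinner y (a *\<^sub>C z) = cnj a * cinner y z" for a and y z :: 'a
    by (metis cinner_commute cinner_scaleC_left complex_cnj_mult)
  have "inner (c *\<^sub>C x) (c *\<^sub>C x) = Re (complex_of_real ((cmod c)\<^sup>2) * cinner x x)"
    by (simp only: inner_eq_Re_cinner cinner_scaleC_left r complex_norm_square ac_simps)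
  also have "\<dots> = (cmod c)\<^sup>2 * inner x x"
    by (simp add: inner_eq_Re_cinner)
  finally show ?thesis
    by (simp add: norm_eq_sqrt_inner real_sqrt_mult)
qed

text \<open>Maximal orthonormal sets.\<close>

definition is_onb :: "'a :: complex_hilbert_space set \<Rightarrow> bool" where
  "is_onb B \<longleftrightarrow>
     (\<forall>e\<in>B. norm e = 1) \<and>
     (\<forall>e\<in>B. \<forall>f\<in>B. e \<noteq> f \<longrightarrow> cinner e f = 0) \<and>
     (\<forall>x. (\<forall>e\<in>B. cinner x e = 0) \<longrightarrow> x = 0)"

definition some_onb :: "'a :: complex_hilbert_space set" where
  "some_onb = (SOME B. is_onb B)"


section \<open>Bounded operators\<close>

text \<open>\<open>\<B>(\<H>)\<close> is the set of those real-linear bounded operators that are complex linear. The norm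
  of the type of real-linear bounded operators restricts to the usual operator norm.\<close>

definition bounded_ops :: "('a :: complex_hilbert_space \<Rightarrow>\<^sub>L 'a) set" where
  "bounded_ops = {T. \<forall>c x. blinfun_apply T (c *\<^sub>C x) = c *\<^sub>C blinfun_apply T x}"

lift_definition scale_op ::
    "complex \<Rightarrow> ('a :: complex_hilbert_space \<Rightarrow>\<^sub>L 'a) \<Rightarrow> ('a \<Rightarrow>\<^sub>L 'a)"
  is "\<lambda>c T x. c *\<^sub>C T x"
proof -
  fix c :: complex and T :: "'a \<Rightarrow> 'a"
  assume T: "bounded_linear T"
  have "bounded_linear (\<lambda>x :: 'a. c *\<^sub>C x)"
    by (rule bounded_linear_intro [where K = "cmod c"])
      (simp_all add: scaleC_add_right scaleR_scaleC scaleC_scaleC norm_scaleC mult.commute)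
  from bounded_linear_compose [OF this T] show "bounded_linear (\<lambda>x. c *\<^sub>C T x)" .
qed

definition compact_op :: "('a :: complex_hilbert_space \<Rightarrow>\<^sub>L 'a) \<Rightarrow> bool" where
  "compact_op T \<longleftrightarrow> T \<in> bounded_ops \<and> compact (closure (blinfun_apply T ` cball 0 1))"

text \<open>A subalgebra need be neither unital nor self-adjoint.\<close>

definition op_subalgebra :: "('a :: complex_hilbert_space \<Rightarrow>\<^sub>L 'a) set \<Rightarrow> bool" where
  "op_subalgebra A \<longleftrightarrow>
     A \<subseteq> bounded_ops \<and> 0 \<in> A \<and>
     (\<forall>S\<in>A. \<forall>T\<in>A. S + T \<in> A) \<and>
     (\<forall>c. \<forall>T\<in>A. scale_op c T \<in> A) \<and>
     (\<forall>S\<in>A. \<forall>T\<in>A. S o\<^sub>L T \<in> A)"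


section \<open>Trace class operators and the weak-* topology\<close>

definition is_adjoint :: "('a :: complex_hilbert_space \<Rightarrow>\<^sub>L 'a) \<Rightarrow> ('a \<Rightarrow>\<^sub>L 'a) \<Rightarrow> bool" where
  "is_adjoint S T \<longleftrightarrow>
     (\<forall>x y. cinner (blinfun_apply T x) y = cinner x (blinfun_apply S y))"

definition positive_op :: "('a :: complex_hilbert_space \<Rightarrow>\<^sub>L 'a) \<Rightarrow> bool" where
  "positive_op P \<longleftrightarrow> P \<in> bounded_ops \<and>
     (\<forall>x. cinner (blinfun_apply P x) x \<in> \<real> \<and> 0 \<le> Re (cinner (blinfun_apply P x) x))"

text \<open>The operator \<open>P\<close> below is \<open>|T|\<close>, the unique positive square root of \<open>T\<^sup>* T\<close>, so that the
  condition says that the trace of \<open>|T|\<close> is finite. Neither this condition nor the value of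
  the trace of a trace class operator depends on the orthonormal basis.\<close>

definition trace_class :: "('a :: complex_hilbert_space \<Rightarrow>\<^sub>L 'a) set" where
  "trace_class = {T \<in> bounded_ops. \<exists>S P.
     is_adjoint S T \<and> positive_op P \<and> P o\<^sub>L P = S o\<^sub>L T \<and>
     (\<lambda>e. cinner (blinfun_apply P e) e) summable_on some_onb}"

definition op_trace :: "('a :: complex_hilbert_space \<Rightarrow>\<^sub>L 'a) \<Rightarrow> complex" where
  "op_trace T = (\<Sum>\<^sub>\<infinity>e\<in>some_onb. cinner (blinfun_apply T e) e)"

text \<open>The coarsest topology on \<open>\<B>(\<H>)\<close> for which all functionals \<open>A \<mapsto> tr (A T)\<close>, with \<open>T\<close> of
  trace class, are continuous.\<close>

definition weak_star :: "('a :: complex_hilbert_space \<Rightarrow>\<^sub>L 'a) topology" where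
  "weak_star = pullback_topology bounded_ops
     (\<lambda>A. \<lambda>T\<in>trace_class. op_trace (A o\<^sub>L T))
     (product_topology (\<lambda>_. euclidean) trace_class)"


section \<open>Preduals\<close>

text \<open>A complex normed space is given by a carrier \<open>X\<close>, a scalar multiplication \<open>scl\<close> and a norm
  \<open>nrm\<close>; the latter two are only relevant on \<open>X\<close>. Elements of the dual are functions which vanish
  outside the carrier, so that they are determined by their values on \<open>X\<close>, and the vector space
  operations of the dual are the pointwise ones.\<close>

definition dual_space ::
    "(complex \<Rightarrow> 'v \<Rightarrow> 'v) \<Rightarrow> ('v \<Rightarrow> real) \<Rightarrow> 'v :: plus set \<Rightarrow> ('v \<Rightarrow> complex) set" where
  "dual_space scl nrm X = {\<phi>.
     (\<forall>x. x \<notin> X \<longrightarrow> \<phi> x = 0) \<and>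
     (\<forall>x\<in>X. \<forall>y\<in>X. \<phi> (x + y) = \<phi> x + \<phi> y) \<and>
     (\<forall>c. \<forall>x\<in>X. \<phi> (scl c x) = c * \<phi> x) \<and>
     (\<exists>K. \<forall>x\<in>X. cmod (\<phi> x) \<le> K * nrm x)}"

definition dual_norm :: "('v \<Rightarrow> real) \<Rightarrow> 'v set \<Rightarrow> ('v \<Rightarrow> complex) \<Rightarrow> real" where
  "dual_norm nrm X \<phi> = (SUP x\<in>{x\<in>X. nrm x \<le> 1}. cmod (\<phi> x))"

definition dual_scale :: "complex \<Rightarrow> ('v \<Rightarrow> complex) \<Rightarrow> ('v \<Rightarrow> complex)" where
  "dual_scale c \<phi> = (\<lambda>x. c * \<phi> x)"

definition closed_subspace_of_dual ::
    "(complex \<Rightarrow> 'v \<Rightarrow> 'v) \<Rightarrow> ('v \<Rightarrow> real) \<Rightarrow> 'v :: plus set \<Rightarrow> ('v \<Rightarrow> complex) set \<Rightarrow> bool" where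
  "closed_subspace_of_dual scl nrm X E \<longleftrightarrow>
     E \<subseteq> dual_space scl nrm X \<and> 0 \<in> E \<and>
     (\<forall>\<phi>\<in>E. \<forall>\<psi>\<in>E. \<phi> + \<psi> \<in> E) \<and>
     (\<forall>c. \<forall>\<phi>\<in>E. dual_scale c \<phi> \<in> E) \<and>
     (\<forall>\<phi>\<in>dual_space scl nrm X.
        (\<forall>\<epsilon>>0. \<exists>\<psi>\<in>E. dual_norm nrm X (\<phi> - \<psi>) < \<epsilon>) \<longrightarrow> \<phi> \<in> E)"

definition canonical_map :: "('v \<Rightarrow> complex) set \<Rightarrow> 'v \<Rightarrow> ('v \<Rightarrow> complex) \<Rightarrow> complex" where
  "canonical_map E x = (\<lambda>\<phi>. if \<phi> \<in> E then \<phi> x else 0)"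

text \<open>The canonical map is linear by construction; linearity is therefore not part of the
  requirement that it be an isometric isomorphism of \<open>X\<close> onto the dual of \<open>E\<close>.\<close>

definition is_predual ::
    "(complex \<Rightarrow> 'v \<Rightarrow> 'v) \<Rightarrow> ('v \<Rightarrow> real) \<Rightarrow> 'v :: plus set \<Rightarrow> ('v \<Rightarrow> complex) set \<Rightarrow> bool" where
  "is_predual scl nrm X E \<longleftrightarrow>
     closed_subspace_of_dual scl nrm X E \<and>
     bij_betw (canonical_map E) X (dual_space dual_scale (dual_norm nrm X) E) \<and>
     (\<forall>x\<in>X. dual_norm (dual_norm nrm X) E (canonical_map E x) = nrm x)"

definition strongly_unique_predual ::
    "(complex \<Rightarrow> 'v \<Rightarrow> 'v) \<Rightarrow> ('v \<Rightarrow> real) \<Rightarrow> 'v :: plus set \<Rightarrow> bool" where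
  "strongly_unique_predual scl nrm X \<longleftrightarrow> (\<exists>!E. is_predual scl nrm X E)"

end

theory Submission
  imports Defs
begin

text \<open>A predual of a Banach space is determined by the topology that it induces on the unit ball, which is
  compact by the theorem of Banach and Alaoglu: a functional lies in the predual if and only if it is
  continuous on the ball. It is therefore enough to compare any given predual \<open>E\<close> with the space
  \<open>weak_predual \<AA>\<close> of the functionals that are continuous on the unit ball for the weak operator topology.

  This space is a predual. On bounded sets trace class functionals are uniform limits of sums of
  finitely many vector functionals \<open>a \<mapsto> \<langle>a x, y\<rangle>\<close> (\<open>trace_class_uniform_tail\<close>), so that a weak-* closed
  subspace has a weakly compact unit ball (\<open>weak_star_closed_cluster\<close>). Given a functional on
  \<open>weak_predual \<AA>\<close>, a least squares argument on this ball finds an element of \<open>\<AA>\<close> that takes finitely many of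
  its values (\<open>finite_interpolation\<close>), and compactness an element that takes all of them.

  For the uniqueness write \<open>\<S>\<close> for the dense subalgebra of compact operators, and let \<open>a\<close> run through a net in
  the ball that converges weakly to \<open>C\<close> and, after passing to a subnet, to \<open>D\<close> in the topology of the predual \<open>E\<close>. What has to be shown is \<open>D = C\<close>. The norm is all
  that relates the two topologies: it is lower semicontinuous for that of \<open>E\<close>. If \<open>K\<close> is compact and \<open>R\<close> runs
  through a bounded weakly null net, then a block matrix computation gives
  \<open>limsup \<parallel>K + s R\<parallel>\<^sup>2 \<le> \<parallel>K\<parallel>\<^sup>2 + 8 s\<^sup>2\<close>, if the norms of \<open>R\<close> are at most \<open>2\<close> (\<open>compact_perturbation_norm\<close>). For
  \<open>R = a - C\<close> this passes to \<open>\<parallel>K + s (D - C)\<parallel>\<close> for all \<open>K\<close> in \<open>\<S>\<close>. But if \<open>D \<noteq> C\<close>, then some \<open>K\<close> in \<open>\<S>\<close> has the norm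
  of \<open>D - C\<close> and almost attains it at the same pair of vectors as \<open>D - C\<close> does, with the same phase, so that
  \<open>\<parallel>K + s (D - C)\<parallel>\<close> is close to \<open>(1 + s) \<parallel>D - C\<parallel>\<close>; for small \<open>s\<close> this is a contradiction
  (\<open>weakly_null_limit_eq_0\<close>). That such a \<open>K\<close> exists is a form of Goldstine's theorem (\<open>compact_Goldstine\<close>): \<open>\<AA>\<close>
  is the bidual of the closure of \<open>\<S>\<close>, because the dual of the compact operators is the trace class. The
  half of this duality that is needed is \<open>trace_class_representation\<close>.\<close>

section \<open>Complex Hilbert spaces and their bounded operators\<close>

lemma cinner_add_right: "cinner x (y + z) = cinner x y + cinner x (z :: 'a :: complex_hilbert_space)"
  by (metis cinner_add_left cinner_commute complex_cnj_add)

lemma cinner_scaleC_right: "cinner x (c *\<^sub>C y) = cnj c * cinner x (y :: 'a :: complex_hilbert_space)"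
  by (metis cinner_commute cinner_scaleC_left complex_cnj_mult)

lemma scaleC_one [simp]: "1 *\<^sub>C x = (x :: 'a :: complex_hilbert_space)"
  using scaleR_scaleC[of 1 x] by simp

lemma scaleC_zero_left [simp]: "0 *\<^sub>C x = (0 :: 'a :: complex_hilbert_space)"
  using scaleR_scaleC[of 0 x] by simp

lemma scaleC_zero_right [simp]: "c *\<^sub>C 0 = (0 :: 'a :: complex_hilbert_space)"
  using scaleC_add_right[of c 0 0] by simp

lemma scaleC_minus_one: "(- 1) *\<^sub>C x = - (x :: 'a :: complex_hilbert_space)"
  using scaleR_scaleC[of "-1" x] by simp

lemma scaleC_minus_right: "c *\<^sub>C (- x) = - (c *\<^sub>C (x :: 'a :: complex_hilbert_space))"
  by (metis add_eq_0_iff scaleC_add_right scaleC_zero_right add.right_inverse)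

lemma scaleC_diff_right: "c *\<^sub>C (x - y) = c *\<^sub>C x - c *\<^sub>C (y :: 'a :: complex_hilbert_space)"
  using scaleC_add_right[of c x "- y"] by (simp add: scaleC_minus_right)

lemma cinner_zero_left [simp]: "cinner 0 (y :: 'a :: complex_hilbert_space) = 0"
  using cinner_add_left[of 0 0 y] by simp

lemma cinner_zero_right [simp]: "cinner (y :: 'a :: complex_hilbert_space) 0 = 0"
  using cinner_add_right[of y 0 0] by simp

lemma cinner_minus_left: "cinner (- x) (y :: 'a :: complex_hilbert_space) = - cinner x y"
  using cinner_add_left[of x "-x" y] by (simp add: eq_neg_iff_add_eq_0 add.commute)

lemma cinner_minus_right: "cinner x (- y :: 'a :: complex_hilbert_space) = - cinner x y"
  using cinner_add_right[of x y "-y"] by (simp add: eq_neg_iff_add_eq_0 add.commute)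

lemma cinner_diff_left: "cinner (x - z) (y :: 'a :: complex_hilbert_space) = cinner x y - cinner z y"
  using cinner_add_left[of x "-z" y] by (simp add: cinner_minus_left)

lemma cinner_diff_right: "cinner x (y - z :: 'a :: complex_hilbert_space) = cinner x y - cinner x z"
  using cinner_add_right[of x y "-z"] by (simp add: cinner_minus_right)

lemma cinner_scaleR_left: "cinner (r *\<^sub>R x) (y :: 'a :: complex_hilbert_space) = of_real r * cinner x y"
  by (simp add: scaleR_scaleC cinner_scaleC_left)

lemma cinner_scaleR_right: "cinner x (r *\<^sub>R y :: 'a :: complex_hilbert_space) = of_real r * cinner x y"
  by (simp add: scaleR_scaleC cinner_scaleC_right)

lemma cinner_sum_left: "cinner (sum f F) (y :: 'a :: complex_hilbert_space) = (\<Sum>i\<in>F. cinner (f i) y)"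
  by (induction F rule: infinite_finite_induct) (auto simp: cinner_add_left)

lemma cinner_sum_right: "cinner y (sum f F :: 'a :: complex_hilbert_space) = (\<Sum>i\<in>F. cinner y (f i))"
  by (induction F rule: infinite_finite_induct) (auto simp: cinner_add_right)

lemma cinner_self: "cinner x (x :: 'a :: complex_hilbert_space) = of_real ((norm x)\<^sup>2)"
proof -
  have "Im (cinner x x) = 0"
    using cinner_commute[of x x] by (metis complex_cnj_cancel_iff complex_In_mult_cnj_zero Reals_cnj_iff complex_is_Real_iff)
  then show ?thesis
    using inner_eq_Re_cinner[of x x] by (simp add: complex_eq_iff power2_norm_eq_inner)
qed

lemma Re_cinner_self: "Re (cinner x (x :: 'a :: complex_hilbert_space)) = (norm x)\<^sup>2"
  by (simp add: cinner_self)

lemma norm_cinner_self: "cmod (cinner x (x :: 'a :: complex_hilbert_space)) = (norm x)\<^sup>2"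
  by (simp add: cinner_self del: of_real_power)

text \<open>The rotation turns bounds on real parts of complex linear expressions into bounds on their absolute values.\<close>

lemma unimodular_rotation: "\<exists>c. cmod c = 1 \<and> c * z = of_real (cmod z)"
proof (cases "z = 0")
  case True
  then show ?thesis by (intro exI[of _ 1]) auto
next
  case False
  then show ?thesis
    by (intro exI[of _ "of_real (cmod z) / z"]) (auto simp: norm_divide)
qed

lemma cinner_Cauchy_Schwarz: "cmod (cinner x (y :: 'a :: complex_hilbert_space)) \<le> norm x * norm y"
proof -
  obtain c where c: "cmod c = 1" "c * cinner x y = of_real (cmod (cinner x y))"
    using unimodular_rotation by blast
  have "cmod (cinner x y) = inner (c *\<^sub>C x) y"
    using c by (simp add: inner_eq_Re_cinner cinner_scaleC_left)
  also have "\<dots> \<le> norm (c *\<^sub>C x) * norm y"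
    by (rule norm_cauchy_schwarz)
  finally show ?thesis
    using c by (simp add: norm_scaleC)
qed

lemma bounded_bilinear_cinner:
  "bounded_bilinear (cinner :: 'a :: complex_hilbert_space \<Rightarrow> 'a \<Rightarrow> complex)"
  by standard (auto simp: cinner_add_left cinner_add_right cinner_scaleR_left cinner_scaleR_right
      scaleR_conv_of_real intro!: exI[of _ 1] cinner_Cauchy_Schwarz)

lemmas tendsto_cinner = bounded_bilinear.tendsto[OF bounded_bilinear_cinner]

lemma eq_if_cinner_eq: "(\<And>y. cinner x y = cinner x' y) \<Longrightarrow> x = (x' :: 'a :: complex_hilbert_space)"
  by (metis cinner_diff_left cinner_self eq_iff_diff_eq_0 norm_eq_zero of_real_eq_0_iff zero_eq_power2)

lemma norm_le_if_cinner_le: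
  assumes "\<And>y. cmod (cinner x y) \<le> c * norm y" "0 \<le> c"
  shows "norm (x :: 'a :: complex_hilbert_space) \<le> c"
proof (cases "x = 0")
  case False
  have "norm x * norm x \<le> c * norm x"
    using assms(1)[of x] by (simp add: norm_cinner_self power2_eq_square)
  then show ?thesis
    using False by simp
qed (use assms in auto)

definition csubspace :: "'a :: complex_hilbert_space set \<Rightarrow> bool" where
  "csubspace V \<longleftrightarrow> 0 \<in> V \<and> (\<forall>x\<in>V. \<forall>y\<in>V. x + y \<in> V) \<and> (\<forall>c. \<forall>x\<in>V. c *\<^sub>C x \<in> V)"

lemma csubspace_imp_subspace: "csubspace V \<Longrightarrow> subspace V"
  unfolding csubspace_def subspace_def by (auto simp: scaleR_scaleC)

text \<open>Riesz representation. The representing vector is the minimizer of \<open>\<parallel>v\<parallel>\<^sup>2 - 2 f v\<close>; a minimizing sequence is Cauchy by the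
  parallelogram law. As \<open>V\<close> need not be closed, the minimizer is only found in its closure.\<close>

lemma Riesz_subspace_real:
  fixes f :: "'a :: {real_inner, banach} \<Rightarrow> real"
  assumes V: "subspace V"
    and add: "\<And>u v. u \<in> V \<Longrightarrow> v \<in> V \<Longrightarrow> f (u + v) = f u + f v"
    and scale: "\<And>r v. v \<in> V \<Longrightarrow> f (r *\<^sub>R v) = r * f v"
    and bound: "\<And>v. v \<in> V \<Longrightarrow> \<bar>f v\<bar> \<le> c * norm v" and c: "0 \<le> c"
  obtains w where "w \<in> closure V" "\<And>v. v \<in> V \<Longrightarrow> f v = inner v w" "norm w \<le> c"
proof -
  define J where "J v = inner v v - 2 * f v" for v
  define m where "m = Inf (J ` V)"
  have ne: "V \<noteq> {}" using V subspace_0 by auto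
  have "- (c\<^sup>2) \<le> J v" if "v \<in> V" for v
  proof -
    have "f v \<le> c * norm v" using bound[OF that] by linarith
    moreover have "0 \<le> (norm v - c)\<^sup>2" by simp
    ultimately show ?thesis
      by (simp add: J_def power2_eq_square algebra_simps flip: power2_norm_eq_inner)
  qed
  then have bdd: "bdd_below (J ` V)" by (auto intro!: bdd_belowI)
  have m: "m \<le> J v" if "v \<in> V" for v
    unfolding m_def using bdd that by (auto intro: cInf_lower)
  have "\<exists>v\<in>V. J v < m + 1 / real (Suc n)" for n
    using cInf_lessD[of "J ` V" "m + 1 / real (Suc n)"] ne unfolding m_def by auto
  then obtain s where s: "\<And>n. s n \<in> V" "\<And>n. J (s n) < m + 1 / real (Suc n)"
    by metis
  have par: "(norm (u - v))\<^sup>2 \<le> 2 * (J u - m) + 2 * (J v - m)" if "u \<in> V" "v \<in> V" for u v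
  proof -
    have uv: "u + v \<in> V" using V that by (rule subspace_add)
    have mid: "(1/2) *\<^sub>R (u + v) \<in> V" using V uv by (rule subspace_scale)
    have "J ((1/2) *\<^sub>R (u + v)) = inner (u + v) (u + v) / 4 - (f u + f v)"
      unfolding J_def scale[OF uv] add[OF that] inner_scaleR_left inner_scaleR_right by argo
    then have "m \<le> inner (u + v) (u + v) / 4 - (f u + f v)" using m[OF mid] by simp
    moreover have "(norm (u - v))\<^sup>2 = 2 * inner u u + 2 * inner v v - inner (u + v) (u + v)"
      by (simp add: power2_norm_eq_inner inner_add inner_diff inner_commute)
    ultimately show ?thesis by (simp add: J_def)
  qed
  have "Cauchy s"
  proof (rule metric_CauchyI)
    fix e :: real assume e: "0 < e"
    then obtain N where N: "1 / real (Suc N) < e\<^sup>2 / 4"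
      by (metis nat_approx_posE zero_less_divide_iff zero_less_numeral zero_less_power)
    show "\<exists>M. \<forall>n\<ge>M. \<forall>k\<ge>M. dist (s n) (s k) < e"
    proof (intro exI allI impI)
      fix n k assume nk: "n \<ge> N" "k \<ge> N"
      have le: "1 / real (Suc i) \<le> 1 / real (Suc N)" if "i \<ge> N" for i
        using that by (intro divide_left_mono) auto
      have "(norm (s n - s k))\<^sup>2 < e\<^sup>2"
        using par[OF s(1)[of n] s(1)[of k]] s(2)[of n] s(2)[of k] le[OF nk(1)] le[OF nk(2)] N by argo
      then show "dist (s n) (s k) < e"
        using e by (simp add: dist_norm power2_less_imp_less)
    qed
  qed
  then obtain w where w: "s \<longlonglongrightarrow> w" using Cauchy_convergent_iff convergent_def by blast
  have wV: "w \<in> closure V" using w s(1) by (auto simp: closure_sequential)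
  have Jm: "(\<lambda>n. J (s n)) \<longlonglongrightarrow> m"
  proof (rule tendsto_sandwich[of "\<lambda>_. m"])
    show "(\<lambda>n. m + 1 / real (Suc n)) \<longlonglongrightarrow> m"
      using tendsto_add[OF tendsto_const LIMSEQ_Suc[OF lim_1_over_n]] by fastforce
    show "\<forall>\<^sub>F n in sequentially. m \<le> J (s n)"
      using m s(1) by simp
    show "\<forall>\<^sub>F n in sequentially. J (s n) \<le> m + 1 / real (Suc n)"
      using s(2) by (intro always_eventually allI less_imp_le)
  qed simp
  have eq: "f v = inner v w" if v: "v \<in> V" for v
  proof -
    have ineq: "0 \<le> t * (2 * (inner w v - f v)) + t\<^sup>2 * inner v v" for t
    proof -
      have "m \<le> J (s n) + t * (2 * (inner (s n) v - f v)) + t\<^sup>2 * inner v v" for n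
      proof -
        have tv: "t *\<^sub>R v \<in> V" using V v by (rule subspace_scale)
        have "m \<le> J (s n + t *\<^sub>R v)" using V s(1) tv by (intro m subspace_add)
        also have "\<dots> = J (s n) + t * (2 * (inner (s n) v - f v)) + t\<^sup>2 * inner v v"
          using s(1) tv v by (simp add: J_def add scale inner_add inner_commute power2_eq_square algebra_simps)
        finally show ?thesis .
      qed
      moreover have "(\<lambda>n. J (s n) + t * (2 * (inner (s n) v - f v)) + t\<^sup>2 * inner v v)
          \<longlonglongrightarrow> m + t * (2 * (inner w v - f v)) + t\<^sup>2 * inner v v"
        by (intro tendsto_intros Jm w)
      ultimately have "m \<le> m + t * (2 * (inner w v - f v)) + t\<^sup>2 * inner v v"
        by (intro Lim_bounded2) auto
      then show ?thesis by simp
    qed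
    define d where "d = inner w v - f v"
    have "d = 0"
    proof (cases "inner v v = 0")
      case True
      then show ?thesis using scale[OF v, of 0] by (simp add: d_def)
    next
      case False
      then have p: "inner v v > 0" by simp
      have "0 \<le> (- d / inner v v) * (2 * d) + (- d / inner v v)\<^sup>2 * inner v v"
        unfolding d_def by (rule ineq)
      also have "\<dots> = - (d\<^sup>2 / inner v v)"
        using p by (simp add: field_simps power2_eq_square)
      finally show ?thesis using p by (simp add: divide_le_0_iff)
    qed
    then show ?thesis by (simp add: d_def inner_commute)
  qed
  have "norm w * norm w \<le> c * norm w"
  proof (rule LIMSEQ_le)
    show "(\<lambda>n. inner (s n) w) \<longlonglongrightarrow> norm w * norm w"
      using tendsto_inner[OF w tendsto_const[of w]] by (simp add: norm_eq_sqrt_inner)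
    show "(\<lambda>n. c * norm (s n)) \<longlonglongrightarrow> c * norm w"
      by (intro tendsto_intros w)
    show "\<exists>N. \<forall>n\<ge>N. inner (s n) w \<le> c * norm (s n)"
      using bound[OF s(1)] eq[OF s(1)] by (metis abs_le_D1)
  qed
  then have "norm w \<le> c" using c by (cases "w = 0") auto
  with wV eq that show thesis by blast
qed

lemma Riesz_csubspace:
  fixes f :: "'a :: complex_hilbert_space \<Rightarrow> complex"
  assumes V: "csubspace V"
    and add: "\<And>u v. u \<in> V \<Longrightarrow> v \<in> V \<Longrightarrow> f (u + v) = f u + f v"
    and scale: "\<And>r v. v \<in> V \<Longrightarrow> f (r *\<^sub>C v) = r * f v"
    and bound: "\<And>v. v \<in> V \<Longrightarrow> cmod (f v) \<le> c * norm v" and c: "0 \<le> c"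
  obtains w where "w \<in> closure V" "\<And>v. v \<in> V \<Longrightarrow> f v = cinner v w" "norm w \<le> c"
proof -
  obtain w where w: "w \<in> closure V" "\<And>v. v \<in> V \<Longrightarrow> Re (f v) = inner v w" "norm w \<le> c"
  proof (rule Riesz_subspace_real[of V "\<lambda>v. Re (f v)" c])
    show "\<bar>Re (f v)\<bar> \<le> c * norm v" if "v \<in> V" for v
      using abs_Re_le_cmod[of "f v"] bound[OF that] by linarith
  qed (use assms csubspace_imp_subspace in \<open>auto simp: scaleR_scaleC\<close>)
  have "f v = cinner v w" if "v \<in> V" for v
  proof (rule complex_eqI)
    show "Re (f v) = Re (cinner v w)" using w(2)[OF that] by (simp add: inner_eq_Re_cinner)
    have "(- \<i>) *\<^sub>C v \<in> V" using V that by (simp add: csubspace_def)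
    from w(2)[OF this] that show "Im (f v) = Im (cinner v w)"
      by (simp add: scale inner_eq_Re_cinner cinner_scaleC_left)
  qed
  with w that show thesis by blast
qed

lemma bounded_ops_scaleC: "T \<in> bounded_ops \<Longrightarrow> T (c *\<^sub>C x) = c *\<^sub>C T x"
  by (simp add: bounded_ops_def)

lemma bounded_ops_exists:
  fixes g :: "'a :: complex_hilbert_space \<Rightarrow> 'a"
  assumes add: "\<And>x y. g (x + y) = g x + g y" and sc: "\<And>c x. g (c *\<^sub>C x) = c *\<^sub>C g x"
    and bd: "\<And>x. norm (g x) \<le> K * norm x" and K: "0 \<le> K"
  obtains T where "T \<in> bounded_ops" "\<And>x. T x = g x" "norm T \<le> K"
proof -
  have bl: "bounded_linear g"
    by (rule bounded_linear_intro[where K = K]) (use assms in \<open>auto simp: scaleR_scaleC mult.commute\<close>)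
  have eq: "blinfun_apply (Blinfun g) x = g x" for x
    using bl by (simp add: bounded_linear_Blinfun_apply)
  show thesis
  proof (rule that[of "Blinfun g"])
    show "norm (Blinfun g) \<le> K"
      by (rule norm_blinfun_bound) (use K bd eq in auto)
  qed (use eq sc in \<open>auto simp: bounded_ops_def\<close>)
qed

text \<open>The Riesz theorem is applied in the second argument of the form.\<close>

lemma bounded_ops_of_form:
  fixes \<beta> :: "'a :: complex_hilbert_space \<Rightarrow> 'a \<Rightarrow> complex"
  assumes addl: "\<And>x x' y. \<beta> (x + x') y = \<beta> x y + \<beta> x' y"
    and addr: "\<And>x y y'. \<beta> x (y + y') = \<beta> x y + \<beta> x y'"
    and scl: "\<And>c x y. \<beta> (c *\<^sub>C x) y = c * \<beta> x y"
    and scr: "\<And>c x y. \<beta> x (c *\<^sub>C y) = cnj c * \<beta> x y"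
    and bd: "\<And>x y. cmod (\<beta> x y) \<le> K * norm x * norm y" and K: "0 \<le> K"
  obtains T where "T \<in> bounded_ops" "\<And>x y. cinner (T x) y = \<beta> x y" "norm T \<le> K"
proof -
  have "\<exists>w. \<forall>y. cinner w y = \<beta> x y" for x
  proof -
    obtain w where w: "\<And>v. v \<in> UNIV \<Longrightarrow> cnj (\<beta> x v) = cinner v w"
      by (rule Riesz_csubspace[of UNIV "\<lambda>y. cnj (\<beta> x y)" "K * norm x"])
        (use bd K in \<open>auto simp: csubspace_def addr scr\<close>)
    then have "\<beta> x y = cinner w y" for y
      by (metis UNIV_I cinner_commute complex_cnj_cnj)
    then show ?thesis by metis
  qed
  then obtain g where g: "\<And>x y. cinner (g x) y = \<beta> x y" by metis
  have gb: "norm (g x) \<le> K * norm x" for x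
    by (rule norm_le_if_cinner_le) (use K bd g in auto)
  obtain T where "T \<in> bounded_ops" "\<And>x. T x = g x" "norm T \<le> K"
  proof (rule bounded_ops_exists[of g K])
    show "g (x + y) = g x + g y" for x y
      by (rule eq_if_cinner_eq) (simp add: g addl cinner_add_left)
    show "g (c *\<^sub>C x) = c *\<^sub>C g x" for c x
      by (rule eq_if_cinner_eq) (simp add: g scl cinner_scaleC_left)
  qed (use K gb in auto)
  then show thesis using that g by simp
qed

lemma cmod_cinner_blinfun_le:
  fixes T :: "'a :: complex_hilbert_space \<Rightarrow>\<^sub>L 'a"
  shows "cmod (cinner (T x) y) \<le> norm T * norm x * norm y"
  by (meson cinner_Cauchy_Schwarz mult_right_mono norm_blinfun norm_ge_zero order_trans)

lemma ex_adjoint: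
  assumes "T \<in> bounded_ops"
  shows "\<exists>S \<in> bounded_ops. is_adjoint S T"
proof -
  obtain S where S: "S \<in> bounded_ops" "\<And>x y. cinner (S x) y = cinner x (T y)"
  proof (rule bounded_ops_of_form[of "\<lambda>x y. cinner x (T y)" "norm T"])
    show "cmod (cinner x (T y)) \<le> norm T * norm x * norm y" for x y
      using cmod_cinner_blinfun_le[of T y x] cinner_commute[of x "T y"]
      by (simp add: mult_ac)
  qed (use assms in \<open>auto simp: cinner_add_left cinner_add_right blinfun.add_right cinner_scaleC_left
         cinner_scaleC_right bounded_ops_scaleC\<close>)
  then have "is_adjoint S T"
    unfolding is_adjoint_def by (metis cinner_commute)
  with S show ?thesis by blast
qed

definition adj :: "('a :: complex_hilbert_space \<Rightarrow>\<^sub>L 'a) \<Rightarrow> ('a \<Rightarrow>\<^sub>L 'a)" where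
  "adj T = (SOME S. S \<in> bounded_ops \<and> is_adjoint S T)"

lemma adj: assumes "T \<in> bounded_ops"
  shows adj_in_bounded_ops: "adj T \<in> bounded_ops"
    and cinner_adj_right: "cinner x (adj T y) = cinner (T x) y"
    and cinner_adj_left: "cinner (adj T x) y = cinner x (T y)"
proof -
  have *: "adj T \<in> bounded_ops \<and> is_adjoint (adj T) T"
    unfolding adj_def by (rule someI_ex) (use ex_adjoint[OF assms] in blast)
  then show "adj T \<in> bounded_ops" "cinner x (adj T y) = cinner (T x) y"
    by (simp_all add: is_adjoint_def)
  show "cinner (adj T x) y = cinner x (T y)"
    using * unfolding is_adjoint_def by (metis cinner_commute)
qed

lemma norm_adj_le: assumes T: "T \<in> bounded_ops" shows "norm (adj T) \<le> norm T"
proof (rule norm_blinfun_bound)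
  fix x
  show "norm (adj T x) \<le> norm T * norm x"
  proof (rule norm_le_if_cinner_le)
    fix y show "cmod (cinner (adj T x) y) \<le> norm T * norm x * norm y"
      using cmod_cinner_blinfun_le[of T y x] cinner_commute[of x "T y"]
      by (simp add: cinner_adj_left[OF T] mult_ac)
  qed simp
qed simp

lemma adj_adj: assumes T: "T \<in> bounded_ops" shows "adj (adj T) = T"
  by (rule blinfun_eqI, rule eq_if_cinner_eq)
    (simp add: cinner_adj_left cinner_adj_right T adj_in_bounded_ops)

lemma norm_adj: "T \<in> bounded_ops \<Longrightarrow> norm (adj T) = norm T"
  by (metis adj_adj adj_in_bounded_ops norm_adj_le order_antisym)

lemma bounded_ops_closed:
  shows zero_in_bounded_ops: "0 \<in> bounded_ops"
    and id_in_bounded_ops: "id_blinfun \<in> bounded_ops"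
    and add_in_bounded_ops: "S \<in> bounded_ops \<Longrightarrow> T \<in> bounded_ops \<Longrightarrow> S + T \<in> bounded_ops"
    and diff_in_bounded_ops: "S \<in> bounded_ops \<Longrightarrow> T \<in> bounded_ops \<Longrightarrow> S - T \<in> bounded_ops"
    and scale_in_bounded_ops: "T \<in> bounded_ops \<Longrightarrow> scale_op c T \<in> bounded_ops"
    and scaleR_in_bounded_ops: "T \<in> bounded_ops \<Longrightarrow> r *\<^sub>R T \<in> bounded_ops"
    and compose_in_bounded_ops: "S \<in> bounded_ops \<Longrightarrow> T \<in> bounded_ops \<Longrightarrow> S o\<^sub>L T \<in> bounded_ops"
  by (auto simp: bounded_ops_def blinfun.bilinear_simps scaleC_add_right scaleC_diff_right
      scale_op.rep_eq scaleC_scaleC mult.commute scaleR_scaleC)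

lemma scale_op_apply: "(scale_op c T) x = c *\<^sub>C T x"
  by (simp add: scale_op.rep_eq)

lemma norm_scale_op: "norm (scale_op c T) = cmod c * norm T"
proof -
  have le: "norm (scale_op c T) \<le> cmod c * norm T" for c and T :: "'a \<Rightarrow>\<^sub>L 'a"
    by (rule norm_blinfun_bound)
      (auto simp: scale_op_apply norm_scaleC mult.assoc intro!: mult_left_mono norm_blinfun)
  show ?thesis
  proof (cases "c = 0")
    case True then show ?thesis using le[of c T] by simp
  next
    case False
    have "scale_op (inverse c) (scale_op c T) = T"
      by (rule blinfun_eqI) (simp add: scale_op_apply scaleC_scaleC False)
    then have "norm T \<le> inverse (cmod c) * norm (scale_op c T)"
      using le[of "inverse c" "scale_op c T"] by (simp add: norm_inverse)
    then have "cmod c * norm T \<le> norm (scale_op c T)"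
      using False by (simp add: field_simps)
    then show ?thesis using le[of c T] by simp
  qed
qed

lemma scale_op_simps:
  "scale_op c (scale_op d T) = scale_op (c * d) T"
  "scale_op (of_real r) T = r *\<^sub>R T" "scale_op (-1) T = - T"
  "scale_op c (S + T) = scale_op c S + scale_op c T"
  by (auto intro!: blinfun_eqI simp: scale_op_apply scaleC_scaleC scaleR_scaleC blinfun.bilinear_simps
      scaleC_minus_one scaleC_add_right)

section \<open>Orthonormal bases\<close>

definition orthonormal :: "'a :: complex_hilbert_space set \<Rightarrow> bool" where
  "orthonormal B \<longleftrightarrow> (\<forall>e\<in>B. norm e = 1) \<and> (\<forall>e\<in>B. \<forall>f\<in>B. e \<noteq> f \<longrightarrow> cinner e f = 0)"

lemma orthonormal_subset: "orthonormal B \<Longrightarrow> A \<subseteq> B \<Longrightarrow> orthonormal A"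
  by (auto simp: orthonormal_def)

lemma cinner_orthonormal:
  "orthonormal B \<Longrightarrow> e \<in> B \<Longrightarrow> f \<in> B \<Longrightarrow> cinner e f = (if e = f then 1 else 0)"
  by (auto simp: orthonormal_def cinner_self)

lemma chain_common_member:
  assumes "subset.chain A C" "x \<in> \<Union>C" "y \<in> \<Union>C"
  shows "\<exists>M\<in>C. x \<in> M \<and> y \<in> M"
proof -
  obtain M N where MN: "M \<in> C" "x \<in> M" "N \<in> C" "y \<in> N" using assms by blast
  then have "M \<subseteq> N \<or> N \<subseteq> M" using assms(1) unfolding subset.chain_def by blast
  then show ?thesis using MN by blast
qed

lemma is_onb_some_onb: "is_onb (some_onb :: 'a :: complex_hilbert_space set)"
proof -
  have "\<exists>M\<in>{B :: 'a set. orthonormal B}. \<forall>X\<in>{B. orthonormal B}. M \<subseteq> X \<longrightarrow> X = M"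
  proof (rule subset_Zorn_nonempty)
    show "{B :: 'a set. orthonormal B} \<noteq> {}" by (auto simp: orthonormal_def intro!: exI[of _ "{}"])
    fix C :: "'a set set" assume C: "C \<noteq> {}" "subset.chain {B. orthonormal B} C"
    have "\<exists>B\<in>C. e \<in> B \<and> f \<in> B" if "e \<in> \<Union>C" "f \<in> \<Union>C" for e f
      using chain_common_member[OF C(2)] that by blast
    moreover have "orthonormal B" if "B \<in> C" for B using C that by (auto simp: subset.chain_def)
    ultimately have "norm e = 1 \<and> (e \<noteq> f \<longrightarrow> cinner e f = 0)" if "e \<in> \<Union>C" "f \<in> \<Union>C" for e f
      using that unfolding orthonormal_def by meson
    then show "\<Union>C \<in> {B. orthonormal B}"
      unfolding orthonormal_def by blast
  qed
  then obtain M :: "'a set" where M: "orthonormal M" "\<And>X. orthonormal X \<Longrightarrow> M \<subseteq> X \<Longrightarrow> X = M"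
    by auto
  have "x = 0" if x: "\<forall>e\<in>M. cinner x e = 0" for x
  proof (rule ccontr)
    assume n: "x \<noteq> 0"
    define u where "u = (1 / norm x) *\<^sub>R x"
    have u: "norm u = 1" "\<forall>e\<in>M. cinner u e = 0"
      using n x by (auto simp: u_def cinner_scaleR_left)
    have u': "\<forall>e\<in>M. cinner e u = 0" using u(2) cinner_commute by (metis complex_cnj_zero)
    have "orthonormal (insert u M)"
      using M(1) u u' unfolding orthonormal_def by auto
    then have "u \<in> M" using M(2)[of "insert u M"] by auto
    then have "cinner u u = 0" using u by blast
    then show False using u by (simp add: cinner_self)
  qed
  then have "is_onb M" using M(1) by (auto simp: is_onb_def orthonormal_def)
  then show ?thesis unfolding some_onb_def by (rule someI)
qed

lemma is_onb_imp_orthonormal: "is_onb B \<Longrightarrow> orthonormal B"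
  unfolding is_onb_def orthonormal_def by (elim conjE) (intro conjI)

lemma orthonormal_some_onb: "orthonormal some_onb"
  by (rule is_onb_imp_orthonormal[OF is_onb_some_onb])

lemma norm_add_sq_orthogonal:
  "cinner u v = 0 \<Longrightarrow> (norm (u + v :: 'a :: complex_hilbert_space))\<^sup>2 = (norm u)\<^sup>2 + (norm v)\<^sup>2"
  using inner_eq_Re_cinner[of u v] by (simp add: power2_norm_eq_inner inner_add inner_commute)

text \<open>For finite orthonormal \<open>F\<close> this is the orthogonal projection onto the span of \<open>F\<close>.\<close>

definition fproj :: "'a :: complex_hilbert_space set \<Rightarrow> 'a \<Rightarrow>\<^sub>L 'a" where
  "fproj F = Blinfun (\<lambda>x. \<Sum>e\<in>F. cinner x e *\<^sub>C e)"

lemma fproj_apply: "fproj F x = (\<Sum>e\<in>F. cinner x e *\<^sub>C e)"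
proof -
  have "bounded_linear (\<lambda>x. cinner x e *\<^sub>C e)" for e :: 'a
  proof (rule bounded_linear_intro[where K = "norm e * norm e"])
    show "norm (cinner x e *\<^sub>C e) \<le> norm x * (norm e * norm e)" for x
      using mult_right_mono[OF cinner_Cauchy_Schwarz[of x e] norm_ge_zero[of e]]
      by (simp add: norm_scaleC mult.assoc)
  qed (simp_all add: cinner_add_left scaleC_add_left cinner_scaleC_left scaleR_scaleC scaleC_scaleC)
  then have "bounded_linear (\<lambda>x. \<Sum>e\<in>F. cinner x e *\<^sub>C e)"
    by (intro bounded_linear_sum)
  then show ?thesis by (simp add: fproj_def bounded_linear_Blinfun_apply)
qed

lemma scaleC_sum_right: "c *\<^sub>C (\<Sum>i\<in>I. f i) = (\<Sum>i\<in>I. c *\<^sub>C (f i :: 'a :: complex_hilbert_space))"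
  by (induction I rule: infinite_finite_induct) (auto simp: scaleC_add_right)

lemma fproj_in_bounded_ops: "fproj F \<in> bounded_ops"
  by (simp add: bounded_ops_def fproj_apply cinner_scaleC_left scaleC_sum_right scaleC_scaleC)

lemma cinner_fproj:
  "cinner (fproj F x) y = (\<Sum>e\<in>F. cinner x e * cinner e y)"
  by (simp add: fproj_apply cinner_sum_left cinner_scaleC_left)

lemma cinner_fproj_basis:
  assumes "orthonormal F" "finite F" "e \<in> F"
  shows "cinner (fproj F x) e = cinner x e"
proof -
  have "cinner (fproj F x) e = (\<Sum>f\<in>F. if f = e then cinner x e else 0)"
    unfolding cinner_fproj by (rule sum.cong) (use assms in \<open>auto simp: cinner_orthonormal\<close>)
  then show ?thesis using assms by simp
qed

lemma fproj_orthogonal: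
  assumes "orthonormal F" "finite F"
  shows "cinner (x - fproj F x) (\<Sum>e\<in>F. c e *\<^sub>C e) = 0"
  using assms by (simp add: cinner_sum_right cinner_scaleC_right cinner_diff_left cinner_fproj_basis)

lemma fproj_Pythagoras:
  assumes "orthonormal F" "finite F"
  shows "(norm x)\<^sup>2 = (norm (x - fproj F x))\<^sup>2 + (norm (fproj F x))\<^sup>2"
  using norm_add_sq_orthogonal[of "x - fproj F x" "fproj F x"]
    fproj_orthogonal[OF assms, of x "cinner x"] by (simp add: fproj_apply)

lemma fproj_best_approximation:
  assumes "orthonormal F" "finite F"
  shows "norm (x - fproj F x) \<le> norm (x - (\<Sum>e\<in>F. c e *\<^sub>C e))"
proof -
  let ?u = "x - fproj F x"
  let ?v = "\<Sum>e\<in>F. (cinner x e - c e) *\<^sub>C e"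
  have "(c' - d') *\<^sub>C e = c' *\<^sub>C e - d' *\<^sub>C e" for c' d' and e :: 'a
    using scaleC_add_left[of "c' - d'" d' e] by (simp add: algebra_simps)
  then have eq: "x - (\<Sum>e\<in>F. c e *\<^sub>C e) = ?u + ?v"
    by (simp add: fproj_apply sum_subtractf)
  have "(norm (?u + ?v))\<^sup>2 = (norm ?u)\<^sup>2 + (norm ?v)\<^sup>2"
    by (rule norm_add_sq_orthogonal) (rule fproj_orthogonal[OF assms])
  then have "(norm ?u)\<^sup>2 \<le> (norm (x - (\<Sum>e\<in>F. c e *\<^sub>C e)))\<^sup>2" unfolding eq by simp
  then show ?thesis by (rule power2_le_imp_le) simp
qed

lemma norm_fproj_sq:
  assumes "orthonormal F" "finite F"
  shows "(norm (fproj F x))\<^sup>2 = (\<Sum>e\<in>F. (cmod (cinner x e))\<^sup>2)"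
proof -
  have "cinner (fproj F x) (fproj F x)
      = (\<Sum>e\<in>F. of_real ((cmod (cinner x e))\<^sup>2))"
    by (subst (2) fproj_apply)
      (simp add: cinner_sum_right cinner_scaleC_right cinner_fproj_basis assms complex_norm_square mult.commute del: of_real_power)
  also have "\<dots> = of_real (\<Sum>e\<in>F. (cmod (cinner x e))\<^sup>2)" by simp
  finally show ?thesis by (simp add: cinner_self del: of_real_power of_real_sum)
qed

lemma norm_fproj_apply_le:
  assumes "orthonormal F" "finite F"
  shows "norm (fproj F x) \<le> norm x"
  using fproj_Pythagoras[OF assms, of x] by (intro power2_le_imp_le[OF _ norm_ge_zero]) auto

lemma norm_fproj_le: "orthonormal F \<Longrightarrow> finite F \<Longrightarrow> norm (fproj F) \<le> 1"
  by (rule norm_blinfun_bound) (auto simp: norm_fproj_apply_le)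

lemma Bessel:
  assumes "orthonormal F" "finite F"
  shows "(\<Sum>e\<in>F. (cmod (cinner x e))\<^sup>2) \<le> (norm x)\<^sup>2"
  using norm_fproj_apply_le[OF assms, of x] by (simp flip: norm_fproj_sq[OF assms])

lemma adj_fproj: "adj (fproj F) = fproj F"
proof (rule blinfun_eqI, rule eq_if_cinner_eq)
  fix x y :: 'a
  have "cinner x (fproj F y) = (\<Sum>e\<in>F. cinner x e * cinner e y)"
    by (simp add: fproj_apply cinner_sum_right cinner_scaleC_right cinner_commute[of y] mult.commute)
  then show "cinner ((adj (fproj F)) x) y = cinner (fproj F x) y"
    by (simp add: cinner_adj_left fproj_in_bounded_ops cinner_fproj)
qed

text \<open>The functional \<open>v \<mapsto> \<langle>v, x\<rangle>\<close> on the span is represented by some \<open>w\<close> in the closure of the span; as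
  \<open>x - w\<close> is orthogonal to the basis, maximality gives \<open>x = w\<close>.\<close>

lemma finite_combinations_dense:
  fixes x :: "'a :: complex_hilbert_space"
  assumes "is_onb B"
  shows "x \<in> closure {v. \<exists>F c. finite F \<and> F \<subseteq> B \<and> v = (\<Sum>e\<in>F. c e *\<^sub>C e)}" (is "x \<in> closure ?V")
proof -
  have ext: "(\<Sum>e\<in>F. c e *\<^sub>C e) = (\<Sum>e\<in>G. (if e \<in> F then c e else 0) *\<^sub>C e)"
    if "finite G" "F \<subseteq> G" for F G and c :: "'a \<Rightarrow> complex"
    by (rule sum.mono_neutral_cong_left) (use that in auto)
  have "csubspace ?V"
    unfolding csubspace_def
  proof (intro conjI ballI allI)
    show "0 \<in> ?V" by (auto intro!: exI[of _ "{}"])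
    fix u assume "u \<in> ?V"
    then obtain F c where F: "finite F" "F \<subseteq> B" "u = (\<Sum>e\<in>F. c e *\<^sub>C e)" by blast
    show "r *\<^sub>C u \<in> ?V" for r
    proof (intro CollectI exI conjI)
      show "r *\<^sub>C u = (\<Sum>e\<in>F. (r * c e) *\<^sub>C e)"
        by (simp add: F(3) scaleC_sum_right scaleC_scaleC)
    qed (use F in auto)
    fix v assume "v \<in> ?V"
    then obtain G d where G: "finite G" "G \<subseteq> B" "v = (\<Sum>e\<in>G. d e *\<^sub>C e)" by blast
    have "u + v = (\<Sum>e\<in>F \<union> G. ((if e \<in> F then c e else 0) + (if e \<in> G then d e else 0)) *\<^sub>C e)"
      unfolding scaleC_add_left sum.distrib F(3) G(3) using F(1) G(1)
      by (subst ext[of "F \<union> G" F], simp, simp, subst ext[of "F \<union> G" G]) auto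
    moreover have "finite (F \<union> G)" "F \<union> G \<subseteq> B" using F(1,2) G(1,2) by auto
    ultimately show "u + v \<in> ?V" by (intro CollectI exI conjI)
  qed
  then obtain w where w: "w \<in> closure ?V" "\<And>v. v \<in> ?V \<Longrightarrow> cinner v x = cinner v w"
  proof (rule Riesz_csubspace[of ?V "\<lambda>v. cinner v x" "norm x"])
    show "cmod (cinner v x) \<le> norm x * norm v" for v
      using cinner_Cauchy_Schwarz[of v x] by (simp add: mult.commute)
  qed (auto simp: cinner_add_left cinner_scaleC_left)
  have "cinner (x - w) e = 0" if e: "e \<in> B" for e
  proof -
    have "e \<in> ?V" using e by (auto intro!: exI[of _ "{e}"] exI[of _ "\<lambda>_. 1"])
    then have "cinner e (x - w) = 0" using w(2) by (simp add: cinner_diff_right)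
    then show ?thesis using cinner_commute by (metis complex_cnj_zero)
  qed
  then have "x - w = 0" using assms unfolding is_onb_def by blast
  then show ?thesis using w(1) by simp
qed

text \<open>The projections give the best approximations from the spans, and the finite combinations are dense.\<close>

lemma fproj_tendsto:
  assumes "is_onb B"
  shows "((\<lambda>F. fproj F x) \<longlongrightarrow> x) (finite_subsets_at_top B)"
proof (rule tendstoI)
  fix \<epsilon> :: real assume "0 < \<epsilon>"
  then obtain F c where F: "finite F" "F \<subseteq> B" and c: "dist (\<Sum>e\<in>F. c e *\<^sub>C e) x < \<epsilon>"
    using finite_combinations_dense[OF assms, of x] unfolding closure_approachable by blast
  have "dist (fproj G x) x < \<epsilon>" if G: "finite G" "F \<subseteq> G" "G \<subseteq> B" for G
  proof -
    have "(\<Sum>e\<in>F. c e *\<^sub>C e) = (\<Sum>e\<in>G. (if e \<in> F then c e else 0) *\<^sub>C e)"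
      by (rule sum.mono_neutral_cong_left) (use G in auto)
    then have "norm (x - fproj G x) \<le> norm (x - (\<Sum>e\<in>F. c e *\<^sub>C e))"
      using fproj_best_approximation[of G x "\<lambda>e. if e \<in> F then c e else 0"] G
        orthonormal_subset[OF is_onb_imp_orthonormal[OF assms]] by simp
    then show ?thesis using c by (simp add: dist_norm norm_minus_commute)
  qed
  then show "\<forall>\<^sub>F G in finite_subsets_at_top B. dist (fproj G x) x < \<epsilon>"
    unfolding eventually_finite_subsets_at_top using F by blast
qed

lemma Parseval_has_sum:
  assumes "is_onb B"
  shows "((\<lambda>e. cinner x e * cinner e y) has_sum cinner x y) B"
  unfolding has_sum_def using tendsto_cinner[OF fproj_tendsto[OF assms, of x] tendsto_const[of y]]
  by (simp add: cinner_fproj)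

lemma Parseval_norm_has_sum:
  assumes "is_onb B"
  shows "((\<lambda>e. (cmod (cinner x e))\<^sup>2) has_sum (norm x)\<^sup>2) B"
proof -
  have "((\<lambda>e. Re (cinner x e * cinner e x)) has_sum Re (cinner x x)) B"
    using Parseval_has_sum[OF assms, of x x] has_sum_Re by blast
  moreover have "Re (cinner x e * cinner e x) = (cmod (cinner x e))\<^sup>2" for e
    by (subst cinner_commute[of e x]) (simp add: cmod_power2 flip: power2_eq_square)
  ultimately show ?thesis by (simp add: Re_cinner_self)
qed

lemma norm_blinfun_le_if_unit_ball:
  fixes T :: "'a :: real_normed_vector \<Rightarrow>\<^sub>L 'b :: real_normed_vector"
  assumes "\<And>z. norm z \<le> 1 \<Longrightarrow> norm (T z) \<le> c" and "0 \<le> c"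
  shows "norm T \<le> c"
proof (rule norm_blinfun_bound)
  fix z show "norm (T z) \<le> c * norm z"
  proof (cases "z = 0")
    case False
    have "norm (T ((1 / norm z) *\<^sub>R z)) \<le> c"
      using False by (intro assms) simp
    then show ?thesis using False by (simp add: blinfun.scaleR_right field_simps)
  qed simp
qed fact

text \<open>The projections converge to the identity pointwise and are contractions, hence they converge
  uniformly on the totally bounded image of the unit ball.\<close>

lemma fproj_compact_tendsto:
  assumes K: "compact_op K" and B: "is_onb B"
  shows "((\<lambda>F. fproj F o\<^sub>L K) \<longlongrightarrow> K) (finite_subsets_at_top B)"
proof (rule tendstoI)
  fix \<epsilon> :: real assume e: "0 < \<epsilon>"
  have oB: "orthonormal B" using B by (rule is_onb_imp_orthonormal)
  have "compact (closure (K ` cball 0 1))" using K by (simp add: compact_op_def)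
  then obtain k where k: "finite k" "closure (K ` cball 0 1) \<subseteq> (\<Union>x\<in>k. ball x (\<epsilon>/4))"
    unfolding compact_eq_totally_bounded using e by (metis zero_less_divide_iff zero_less_numeral)
  have "\<forall>\<^sub>F F in finite_subsets_at_top B. \<forall>c\<in>k. dist (fproj F c) c < \<epsilon>/4"
    using k(1) e by (intro eventually_ball_finite ballI tendstoD[OF fproj_tendsto[OF B]]) auto
  moreover have "\<forall>\<^sub>F F in finite_subsets_at_top B. finite F \<and> F \<subseteq> B"
    by (rule eventually_finite_subsets_at_top_weakI) auto
  ultimately show "\<forall>\<^sub>F F in finite_subsets_at_top B. dist (fproj F o\<^sub>L K) K < \<epsilon>"
  proof eventually_elim
    case (elim F)
    then have F: "orthonormal F" "finite F" using orthonormal_subset oB by auto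
    have "norm ((fproj F o\<^sub>L K) - K) \<le> 3 * \<epsilon> / 4"
    proof (rule norm_blinfun_le_if_unit_ball)
      fix z :: 'a assume "norm z \<le> 1"
      then have "K z \<in> closure (K ` cball 0 1)"
        by (intro subsetD[OF closure_subset]) auto
      then obtain c where c: "c \<in> k" "dist c (K z) < \<epsilon>/4" using k(2) by auto
      let ?P = "(fproj F)" and ?y = "K z"
      have "?P ?y - ?y = ?P (?y - c) + (?P c - c) + (c - ?y)" by (simp add: blinfun.diff_right)
      then have "norm (?P ?y - ?y) \<le> norm (?P (?y - c)) + norm (?P c - c) + norm (c - ?y)"
        using norm_triangle_ineq[of "?P (?y - c) + (?P c - c)" "c - ?y"]
          norm_triangle_ineq[of "?P (?y - c)" "?P c - c"] by simp
      moreover have "norm (?P (?y - c)) \<le> norm (?y - c)" using F by (rule norm_fproj_apply_le)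
      ultimately show "norm (blinfun_apply ((fproj F o\<^sub>L K) - K) z) \<le> 3 * \<epsilon> / 4"
        using bspec[OF elim(1) c(1)] c(2) e by (simp add: dist_norm norm_minus_commute blinfun.diff_left)
    qed (use e in simp)
    then show ?case unfolding dist_norm using e by linarith
  qed
qed

section \<open>Positive square roots and polar decomposition\<close>

text \<open>Polarization: the imaginary part of \<open>\<langle>P z, z\<rangle>\<close> vanishes for \<open>z = x + y\<close> and for \<open>z = \<i> x + y\<close>.\<close>

lemma positive_op_symmetric:
  assumes P: "positive_op P"
  shows "cinner (P x) y = cinner x (P y)"
proof -
  have Pb: "P \<in> bounded_ops" using P by (simp add: positive_op_def)
  have real: "Im (cinner (P z) z) = 0" for z
    using P by (auto simp: positive_op_def complex_is_Real_iff)
  have im: "Im (cinner (P u) v) + Im (cinner (P v) u) = 0" for u v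
    using real[of "u + v"] by (simp add: blinfun.add_right cinner_add_left cinner_add_right real)
  have "Re (cinner (P x) y) = Re (cinner (P y) x)"
    using im[of "\<i> *\<^sub>C x" y]
    by (simp add: bounded_ops_scaleC[OF Pb] cinner_scaleC_left cinner_scaleC_right)
  moreover have "Im (cinner (P x) y) = - Im (cinner (P y) x)"
    using im[of x y] by simp
  ultimately have "cinner (P x) y = cnj (cinner (P y) x)"
    by (simp add: complex_eq_iff)
  then show ?thesis by (simp flip: cinner_commute)
qed

text \<open>For \<open>X = 1 - P\<close> with \<open>0 \<le> P \<le> 1\<close> the iteration \<open>Y \<mapsto> (X + Y\<^sup>2) / 2\<close>, started at \<open>0\<close>, has increments dominated in
  norm by those of the corresponding iteration of numbers, started at \<open>0\<close> and with \<open>X = 1\<close>, which increases and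
  is bounded by \<open>1\<close>. A fixed point \<open>L\<close> satisfies \<open>(1 - L)\<^sup>2 = P\<close>.\<close>

lemma positive_contraction_sqrt:
  fixes P :: "'a :: complex_hilbert_space \<Rightarrow>\<^sub>L 'a"
  assumes P: "positive_op P" and P1: "norm P \<le> 1"
  obtains Q where "positive_op Q" "Q o\<^sub>L Q = P"
proof -
  have Pb: "P \<in> bounded_ops" using P by (simp add: positive_op_def)
  define X where "X = id_blinfun - P"
  have Xa: "X x = x - P x" for x
    by (simp add: X_def blinfun.diff_left)
  have Xb: "X \<in> bounded_ops" unfolding X_def by (intro diff_in_bounded_ops id_in_bounded_ops Pb)
  \<comment> \<open>Positivity of \<open>P\<close> at \<open>x - P x\<close> gives \<open>\<parallel>P x\<parallel>\<^sup>2 \<le> \<langle>P x, x\<rangle>\<close>.\<close>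
  have nX: "norm X \<le> 1"
  proof (rule norm_blinfun_bound)
    fix x
    let ?p = "P x"
    have p_le: "(norm (P x))\<^sup>2 \<le> Re (cinner (P x) x)"
    proof -
      have "0 \<le> Re (cinner (P (x - ?p)) (x - ?p))"
        using P by (simp add: positive_op_def)
      also have "\<dots> = Re (cinner ?p x) - 2 * (norm ?p)\<^sup>2 + Re (cinner (P ?p) ?p)"
        by (simp add: blinfun.diff_right cinner_diff_left cinner_diff_right Re_cinner_self
            positive_op_symmetric[OF P, of ?p x])
      also have "Re (cinner (P ?p) ?p) \<le> (norm ?p)\<^sup>2"
      proof -
        have "Re (cinner (P ?p) ?p) \<le> norm P * norm ?p * norm ?p"
          by (rule order_trans[OF complex_Re_le_cmod cmod_cinner_blinfun_le])
        also have "\<dots> \<le> 1 * norm ?p * norm ?p" using P1 by (intro mult_right_mono) auto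
        finally show ?thesis by (simp add: power2_eq_square)
      qed
      finally show ?thesis by simp
    qed
    have "(norm (x - ?p))\<^sup>2 = (norm x)\<^sup>2 - 2 * Re (cinner ?p x) + (norm ?p)\<^sup>2"
      by (simp add: power2_norm_eq_inner inner_diff inner_commute flip: inner_eq_Re_cinner)
    also have "\<dots> \<le> (norm x)\<^sup>2" using p_le zero_le_power2[of "norm ?p"] by linarith
    finally have "norm (x - ?p) \<le> norm x" by (rule power2_le_imp_le) simp
    then show "norm (X x) \<le> 1 * norm x" by (simp add: Xa)
  qed simp
  have Xsym: "cinner (X x) y = cinner x (X y)" for x y
    by (simp add: Xa cinner_diff_left cinner_diff_right positive_op_symmetric[OF P])
  define y :: "nat \<Rightarrow> real" where "y = rec_nat 0 (\<lambda>_ r. (1 + r\<^sup>2) / 2)"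
  have y0: "y 0 = 0" and yS: "y (Suc n) = (1 + (y n)\<^sup>2) / 2" for n by (simp_all add: y_def)
  define Y where "Y = rec_nat 0 (\<lambda>_ R. (1/2) *\<^sub>R (X + (R o\<^sub>L R)))"
  have Y0: "Y 0 = 0" and YS: "Y (Suc n) = (1/2) *\<^sub>R (X + (Y n o\<^sub>L Y n))" for n
    by (simp_all add: Y_def)
  have y01: "0 \<le> y n \<and> y n \<le> 1" for n
  proof (induction n)
    case (Suc n)
    then have "(y n)\<^sup>2 \<le> 1" by (simp add: power_le_one)
    then show ?case by (simp add: yS)
  qed (simp add: y0)
  have nY: "norm (Y n) \<le> y n" for n
  proof (induction n)
    case (Suc n)
    have "norm (Y n o\<^sub>L Y n) \<le> norm (Y n) * norm (Y n)" by (rule norm_blinfun_compose)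
    also have "\<dots> \<le> y n * y n" by (rule mult_mono[OF Suc Suc conjunct1[OF y01] norm_ge_zero])
    finally have "norm (X + (Y n o\<^sub>L Y n)) \<le> 1 + (y n)\<^sup>2"
      using nX norm_triangle_ineq[of X "Y n o\<^sub>L Y n"] by (simp add: power2_eq_square)
    then show ?case by (simp add: YS yS)
  qed (simp add: Y0 y0)
  \<comment> \<open>The factorization \<open>A\<^sup>2 - B\<^sup>2 = A (A - B) + (A - B) B\<close> holds without commutation.\<close>
  have step: "norm (Y (Suc n) - Y n) \<le> y (Suc n) - y n" for n
  proof (induction n)
    case (Suc n)
    let ?A = "Y (Suc n)" and ?B = "Y n"
    have "Y (Suc (Suc n)) - Y (Suc n) = (1/2) *\<^sub>R ((?A o\<^sub>L (?A - ?B)) + ((?A - ?B) o\<^sub>L ?B))"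
      unfolding YS[of "Suc n"] YS[of n]
      by (rule blinfun_eqI) (simp add: blinfun.bilinear_simps scaleR_diff_right scaleR_add_right)
    then have "norm (Y (Suc (Suc n)) - Y (Suc n))
        \<le> (norm (?A o\<^sub>L (?A - ?B)) + norm ((?A - ?B) o\<^sub>L ?B)) / 2"
      using norm_triangle_ineq[of "?A o\<^sub>L (?A - ?B)" "(?A - ?B) o\<^sub>L ?B"] by simp
    also have "\<dots> \<le> (y (Suc n) * (y (Suc n) - y n) + (y (Suc n) - y n) * y n) / 2"
    proof -
      have d: "0 \<le> y (Suc n) - y n" using Suc norm_ge_zero order_trans by blast
      have "norm (?A o\<^sub>L (?A - ?B)) \<le> y (Suc n) * (y (Suc n) - y n)"
        by (rule order_trans[OF norm_blinfun_compose mult_mono[OF nY Suc conjunct1[OF y01] norm_ge_zero]])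
      moreover have "norm ((?A - ?B) o\<^sub>L ?B) \<le> (y (Suc n) - y n) * y n"
        by (rule order_trans[OF norm_blinfun_compose mult_mono[OF Suc nY d norm_ge_zero]])
      ultimately show ?thesis by (intro divide_right_mono add_mono) auto
    qed
    also have "\<dots> = y (Suc (Suc n)) - y (Suc n)"
      unfolding yS[of "Suc n"] yS[of n] by (simp add: power2_eq_square field_simps)
    finally show ?case .
  qed (use nX in \<open>simp add: Y0 y0 YS yS\<close>)
  have ymono: "incseq y"
    using step by (intro incseq_SucI) (meson diff_ge_0_iff_ge norm_ge_zero order_trans)
  have diff: "norm (Y m - Y n) \<le> y m - y n" if "n \<le> m" for m n
    using that
  proof (induction m rule: dec_induct)
    case (step m)
    have "norm (Y (Suc m) - Y n) \<le> norm (Y (Suc m) - Y m) + norm (Y m - Y n)"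
      using norm_triangle_ineq[of "Y (Suc m) - Y m" "Y m - Y n"] by simp
    then show ?case using step.IH \<open>\<And>n. norm (Y (Suc n) - Y n) \<le> y (Suc n) - y n\<close>[of m] by linarith
  qed simp
  obtain l where "y \<longlonglongrightarrow> l" using ymono incseq_convergent[of y 1] y01 by blast
  then have "Cauchy y" using LIMSEQ_imp_Cauchy by blast
  have "Cauchy Y"
  proof (rule CauchyI)
    fix e :: real assume "0 < e"
    then obtain M where M: "\<And>m n. m \<ge> M \<Longrightarrow> n \<ge> M \<Longrightarrow> norm (y m - y n) < e"
      using CauchyD[OF \<open>Cauchy y\<close>] by blast
    have le: "norm (Y m - Y n) < e" if "n \<ge> M" "m \<ge> n" for m n
      using diff[OF that(2)] M[of m n] that by simp
    have "norm (Y m - Y n) < e" if "m \<ge> M" "n \<ge> M" for m n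
      using le[of n m] le[of m n] that by (cases "m \<le> n") (auto simp: norm_minus_commute)
    then show "\<exists>M. \<forall>m\<ge>M. \<forall>n\<ge>M. norm (Y m - Y n) < e" by blast
  qed
  then obtain L where L: "Y \<longlonglongrightarrow> L" using Cauchy_convergent_iff convergent_def by blast
  have La: "(\<lambda>n. blinfun_apply (Y n) x) \<longlonglongrightarrow> L x" for x
    by (rule blinfun.tendsto[OF L tendsto_const])
  have Lfix: "L = (1/2) *\<^sub>R (X + (L o\<^sub>L L))"
  proof (rule LIMSEQ_unique)
    show "(\<lambda>n. Y (Suc n)) \<longlonglongrightarrow> L" using L by (rule LIMSEQ_Suc)
    show "(\<lambda>n. Y (Suc n)) \<longlonglongrightarrow> (1/2) *\<^sub>R (X + (L o\<^sub>L L))"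
      unfolding YS by (intro tendsto_intros bounded_bilinear.tendsto[OF bounded_bilinear_blinfun_compose] L)
  qed
  have Yb: "Y n \<in> bounded_ops" for n
    by (induction n) (auto simp: Y0 YS zero_in_bounded_ops intro!: scaleR_in_bounded_ops add_in_bounded_ops Xb compose_in_bounded_ops)
  have Ysym: "cinner (blinfun_apply (Y n) x) z = cinner x (blinfun_apply (Y n) z)" for n x z
    by (induction n arbitrary: x z)
      (simp_all add: Y0 YS blinfun.bilinear_simps cinner_scaleR_left cinner_scaleR_right
        cinner_add_left cinner_add_right Xsym)
  have Lb: "L \<in> bounded_ops"
    unfolding bounded_ops_def
  proof (intro CollectI allI)
    fix c x
    have "(\<lambda>n. c *\<^sub>C blinfun_apply (Y n) x) \<longlonglongrightarrow> c *\<^sub>C L x"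
    proof -
      have "(\<lambda>n. (scale_op c id_blinfun) (blinfun_apply (Y n) x))
          \<longlonglongrightarrow> (scale_op c id_blinfun) (L x)"
        by (rule blinfun.tendsto[OF tendsto_const La])
      then show ?thesis by (simp add: scale_op_apply)
    qed
    then show "L (c *\<^sub>C x) = c *\<^sub>C L x"
      using La[of "c *\<^sub>C x"] LIMSEQ_unique by (simp add: bounded_ops_scaleC[OF Yb]) blast
  qed
  have Lsym: "cinner (L x) z = cinner x (L z)" for x z
    using tendsto_cinner[OF La[of x] tendsto_const[of z]] tendsto_cinner[OF tendsto_const[of x] La[of z]]
      LIMSEQ_unique by (simp add: Ysym) blast
  have nL: "norm L \<le> 1"
    using tendsto_norm[OF L] order_trans[OF nY conjunct2[OF y01]] by (intro LIMSEQ_le_const2) auto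
  define Q where "Q = id_blinfun - L"
  have Qa: "Q x = x - L x" for x
    by (simp add: Q_def blinfun.diff_left)
  have "positive_op Q"
    unfolding positive_op_def
  proof (intro conjI allI)
    show "Q \<in> bounded_ops" unfolding Q_def by (intro diff_in_bounded_ops id_in_bounded_ops Lb)
    fix x
    have "cinner (L x) x = cnj (cinner (L x) x)"
      using Lsym[of x x] cinner_commute[of x "L x"] by simp
    then show "cinner (Q x) x \<in> \<real>"
      by (simp add: Qa cinner_diff_left cinner_self Reals_cnj_iff)
    have "Re (cinner (L x) x) \<le> norm L * norm x * norm x"
      by (rule order_trans[OF complex_Re_le_cmod cmod_cinner_blinfun_le])
    also have "\<dots> \<le> 1 * norm x * norm x" using nL by (intro mult_right_mono) auto
    finally show "0 \<le> Re (cinner (Q x) x)"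
      by (simp add: Qa cinner_diff_left Re_cinner_self power2_eq_square)
  qed
  moreover have "Q o\<^sub>L Q = P"
  proof (rule blinfun_eqI)
    fix x
    have "2 *\<^sub>R L x = x - P x + L (L x)"
      by (subst (1) Lfix) (simp add: blinfun.bilinear_simps Xa)
    then show "blinfun_apply (Q o\<^sub>L Q) x = P x"
      by (simp add: Qa blinfun.diff_right scaleR_2 algebra_simps)
  qed
  ultimately show thesis by (rule that)
qed

lemma positive_op_scaleR: "positive_op P \<Longrightarrow> 0 \<le> r \<Longrightarrow> positive_op (r *\<^sub>R P)"
  by (auto simp: positive_op_def scaleR_in_bounded_ops blinfun.scaleR_left cinner_scaleR_left
      intro!: Reals_mult)

lemma positive_op_sqrt:
  assumes P: "positive_op P"
  obtains Q where "positive_op Q" "Q o\<^sub>L Q = P"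
proof (cases "P = 0")
  case True
  with P show thesis by (intro that[of 0]) simp_all
next
  case False
  obtain R where R: "positive_op R" "R o\<^sub>L R = (1 / norm P) *\<^sub>R P"
    by (rule positive_contraction_sqrt[of "(1 / norm P) *\<^sub>R P"])
      (use P False in \<open>auto intro!: positive_op_scaleR\<close>)
  show thesis
  proof (rule that[of "sqrt (norm P) *\<^sub>R R"])
    show "positive_op (sqrt (norm P) *\<^sub>R R)" using R by (intro positive_op_scaleR) auto
    have "(sqrt (norm P) *\<^sub>R R) o\<^sub>L (sqrt (norm P) *\<^sub>R R) = norm P *\<^sub>R (R o\<^sub>L R)"
      by (rule blinfun_eqI) (simp add: blinfun.bilinear_simps)
    then show "(sqrt (norm P) *\<^sub>R R) o\<^sub>L (sqrt (norm P) *\<^sub>R R) = P" using R False by simp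
  qed
qed

lemma csubspace_closure:
  assumes V: "csubspace V"
  shows "csubspace (closure V)"
  unfolding csubspace_def
proof (intro conjI ballI allI)
  show "0 \<in> closure V" using V closure_subset by (auto simp: csubspace_def)
  fix x assume "x \<in> closure V"
  then obtain s where s: "\<And>n. s n \<in> V" "s \<longlonglongrightarrow> x" by (auto simp: closure_sequential)
  show "c *\<^sub>C x \<in> closure V" for c
  proof -
    have "(\<lambda>n. (scale_op c id_blinfun) (s n)) \<longlonglongrightarrow> (scale_op c id_blinfun) x"
      by (rule blinfun.tendsto[OF tendsto_const s(2)])
    then have "(\<lambda>n. c *\<^sub>C s n) \<longlonglongrightarrow> c *\<^sub>C x" by (simp add: scale_op_apply)
    moreover have "\<forall>n. c *\<^sub>C s n \<in> V" using V s by (simp add: csubspace_def)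
    ultimately show ?thesis unfolding closure_sequential by (intro exI conjI)
  qed
  fix y assume "y \<in> closure V"
  then obtain t where t: "\<And>n. t n \<in> V" "t \<longlonglongrightarrow> y" by (auto simp: closure_sequential)
  have "(\<lambda>n. s n + t n) \<longlonglongrightarrow> x + y" by (intro tendsto_intros s t)
  moreover have "\<forall>n. s n + t n \<in> V" using V s t by (simp add: csubspace_def)
  ultimately show "x + y \<in> closure V" unfolding closure_sequential by (intro exI conjI)
qed

lemma eq_in_closure_if_cinner_eq:
  assumes V: "csubspace V" and u: "u \<in> closure V" "u' \<in> closure V"
    and eq: "\<And>v. v \<in> V \<Longrightarrow> cinner v u = cinner v u'"
  shows "u = u'"
proof -
  have "u + (- 1) *\<^sub>C u' \<in> closure V" using csubspace_closure[OF V] u unfolding csubspace_def by blast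
  then obtain s where s: "\<And>n. s n \<in> V" "s \<longlonglongrightarrow> u - u'"
    by (auto simp: closure_sequential scaleC_minus_one)
  have "(\<lambda>n. cinner (s n) (u - u')) \<longlonglongrightarrow> cinner (u - u') (u - u')"
    by (intro tendsto_cinner s tendsto_const)
  moreover have "cinner (s n) (u - u') = 0" for n using eq s(1) by (simp add: cinner_diff_right)
  ultimately have "cinner (u - u') (u - u') = 0" using LIMSEQ_unique[OF _ tendsto_const] by simp
  then show ?thesis by (simp add: cinner_self)
qed

text \<open>\<open>W\<close> is the adjoint of the partial isometry in the polar decomposition \<open>T = W\<^sup>* P\<close>: the vector \<open>W y\<close>
  represents the functional \<open>P x \<mapsto> \<langle>T x, y\<rangle>\<close> on the range of \<open>P\<close>.\<close>

lemma polar_decomposition: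
  fixes T P :: "'a :: complex_hilbert_space \<Rightarrow>\<^sub>L 'a"
  assumes T: "T \<in> bounded_ops" and P: "P \<in> bounded_ops"
    and eq: "\<And>x z. cinner (T x) (T z) = cinner (P x) (P z)"
  obtains W where "W \<in> bounded_ops" "norm W \<le> 1" "W o\<^sub>L T = P"
    "\<And>x y. cinner (T x) y = cinner (P x) (W y)"
proof -
  let ?V = "range (P)"
  have V: "csubspace ?V"
    unfolding csubspace_def
  proof (intro conjI ballI allI)
    show "0 \<in> ?V" by (rule range_eqI[of _ _ 0]) simp
    fix u assume "u \<in> ?V"
    then obtain x where x: "u = P x" by blast
    show "c *\<^sub>C u \<in> ?V" for c
      by (rule range_eqI[of _ _ "c *\<^sub>C x"]) (simp add: x bounded_ops_scaleC[OF P])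
    fix v assume "v \<in> ?V"
    then obtain z where z: "v = P z" by blast
    show "u + v \<in> ?V"
      by (rule range_eqI[of _ _ "x + z"]) (simp add: x z blinfun.add_right)
  qed
  have nrm: "norm (T x) = norm (P x)" for x
    using eq[of x x] by (simp add: cinner_self del: of_real_power)
  have wd: "T x = T x'" if "P x = P x'" for x x'
    using nrm[of "x - x'"] that by (simp add: blinfun.diff_right)
  have "\<exists>w. w \<in> closure ?V \<and> (\<forall>x. cinner (T x) y = cinner (P x) w) \<and> norm w \<le> norm y" for y
  proof -
    define pre where "pre v = (SOME x. P x = v)" for v
    have pre: "T (pre (P x)) = T x" for x
      by (rule wd) (unfold pre_def, rule someI_ex, blast)
    define f where "f v = cinner (T (pre v)) y" for v
    have f: "f (P x) = cinner (T x) y" for x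
      by (simp add: f_def pre)
    obtain w where "w \<in> closure ?V" "\<And>v. v \<in> ?V \<Longrightarrow> f v = cinner v w" "norm w \<le> norm y"
    proof (rule Riesz_csubspace[OF V, of f "norm y"])
      fix u v assume "u \<in> ?V" "v \<in> ?V"
      then obtain x z where "u = P x" "v = P z" by blast
      then show "f (u + v) = f u + f v"
        using f[of "x + z"] by (simp add: f blinfun.add_right cinner_add_left)
    next
      fix r v assume "v \<in> ?V"
      then obtain x where "v = P x" by blast
      then show "f (r *\<^sub>C v) = r * f v"
        using f[of "r *\<^sub>C x"] by (simp add: f bounded_ops_scaleC[OF T] bounded_ops_scaleC[OF P] cinner_scaleC_left)
    next
      fix v assume "v \<in> ?V"
      then obtain x where "v = P x" by blast
      then show "cmod (f v) \<le> norm y * norm v"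
        using cinner_Cauchy_Schwarz[of "T x" y] by (simp add: f nrm mult.commute)
    qed auto
    then show ?thesis using f by (intro exI[of _ w]) auto
  qed
  then obtain g where g: "\<And>y. g y \<in> closure ?V"
    "\<And>x y. cinner (T x) y = cinner (P x) (g y)" "\<And>y. norm (g y) \<le> norm y"
    by metis
  have cl: "csubspace (closure ?V)" using V by (rule csubspace_closure)
  obtain W where W: "W \<in> bounded_ops" "\<And>y. W y = g y" "norm W \<le> 1"
  proof (rule bounded_ops_exists[of g 1])
    show "g (x + y) = g x + g y" for x y
      by (rule eq_in_closure_if_cinner_eq[OF V g(1)])
        (use cl g(1) in \<open>auto simp: csubspace_def cinner_add_right simp flip: g(2)\<close>)
    show "g (c *\<^sub>C x) = c *\<^sub>C g x" for c x
      by (rule eq_in_closure_if_cinner_eq[OF V g(1)])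
        (use cl g(1) in \<open>auto simp: csubspace_def cinner_scaleC_right simp flip: g(2)\<close>)
  qed (use g(3) in auto)
  have "g (T x) = P x" for x
    by (rule eq_in_closure_if_cinner_eq[OF V g(1)])
      (auto simp: eq intro: subsetD[OF closure_subset] simp flip: g(2))
  then have "W o\<^sub>L T = P" by (intro blinfun_eqI) (simp add: W(2))
  with W g(2) show thesis by (intro that[of W]) auto
qed

section \<open>Trace class operators as functionals\<close>

lemma sum_norm_mult_le:
  fixes G :: "'a :: complex_hilbert_space set"
  shows "(\<Sum>e\<in>G. norm (f e :: 'a) * norm (g e :: 'a)) \<le> sqrt (\<Sum>e\<in>G. (norm (f e))\<^sup>2) * sqrt (\<Sum>e\<in>G. (norm (g e))\<^sup>2)"
  using L2_set_mult_ineq[of "\<lambda>e. norm (f e)" "\<lambda>e. norm (g e)" G] by (simp add: L2_set_def)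

lemma has_sum_sum:
  fixes f :: "'i \<Rightarrow> 'b \<Rightarrow> 'c :: topological_comm_monoid_add"
  assumes "\<And>i. i \<in> I \<Longrightarrow> (f i has_sum s i) A"
  shows "((\<lambda>x. \<Sum>i\<in>I. f i x) has_sum (\<Sum>i\<in>I. s i)) A"
  using assms by (induction I rule: infinite_finite_induct) (auto intro!: has_sum_add has_sum_0)

text \<open>The sum of all \<open>\<bar>\<langle>R f, e\<rangle>\<bar>\<^sup>2\<close> is the square of the Hilbert--Schmidt norm of \<open>R\<close> as well as of \<open>R\<^sup>*\<close>, by
  Parseval's identity in the first case for \<open>R f\<close> and in the second for \<open>R\<^sup>* e\<close>.\<close>

lemma Hilbert_Schmidt_adj:
  assumes B: "is_onb B" and R: "R \<in> bounded_ops"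
    and le: "\<And>f. f \<in> B \<Longrightarrow> (norm (R f))\<^sup>2 \<le> q f" and q: "(q has_sum h) B"
    and G: "finite G" "G \<subseteq> B"
  shows "(\<Sum>e\<in>G. (norm (adj R e))\<^sup>2) \<le> h"
proof -
  have "((\<lambda>f. \<Sum>e\<in>G. (cmod (cinner (adj R e) f))\<^sup>2) has_sum
      (\<Sum>e\<in>G. (norm (adj R e))\<^sup>2)) B"
    by (intro has_sum_sum Parseval_norm_has_sum B)
  moreover have "(\<Sum>e\<in>G. (cmod (cinner (adj R e) f))\<^sup>2) \<le> q f" if "f \<in> B" for f
  proof -
    have "cmod (cinner (adj R e) f) = cmod (cinner (R f) e)" for e
      by (subst cinner_commute) (simp add: cinner_adj_right[OF R])
    then have "(\<Sum>e\<in>G. (cmod (cinner (adj R e) f))\<^sup>2) \<le> (norm (R f))\<^sup>2"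
      using Bessel[OF orthonormal_subset[OF is_onb_imp_orthonormal[OF B] G(2)] G(1), of "R f"]
      by simp
    then show ?thesis using le[OF that] by simp
  qed
  ultimately show ?thesis by (rule has_sum_mono[OF _ q])
qed

lemma trace_classE:
  assumes "T \<in> trace_class"
  obtains P W where "T \<in> bounded_ops" "positive_op P" "W \<in> bounded_ops" "norm W \<le> 1"
    "\<And>x y. cinner (T x) y = cinner (P x) (W y)"
    "(\<lambda>e. cinner (P e) e) summable_on some_onb"
proof -
  obtain S P where T: "T \<in> bounded_ops" "is_adjoint S T" and P: "positive_op P" "P o\<^sub>L P = S o\<^sub>L T"
    "(\<lambda>e. cinner (P e) e) summable_on some_onb"
    using assms by (auto simp: trace_class_def)
  have Pb: "P \<in> bounded_ops" using P by (simp add: positive_op_def)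
  have eq: "cinner (T x) (T z) = cinner (P x) (P z)" for x z
  proof -
    have "S (T z) = P (P z)"
      using arg_cong[OF P(2), of "\<lambda>R. R z"] by simp
    then show ?thesis using T(2) by (simp add: is_adjoint_def positive_op_symmetric[OF P(1)])
  qed
  obtain W where W: "W \<in> bounded_ops" "norm W \<le> 1" "W o\<^sub>L T = P"
    "\<And>x y. cinner (T x) y = cinner (P x) (W y)"
    by (rule polar_decomposition[OF T(1) Pb eq], rule that)
  show thesis by (rule that[OF T(1) P(1) W(1,2,4) P(3)])
qed

text \<open>The polar decomposition and the square root \<open>Q\<close> of \<open>P = \<bar>T\<bar>\<close> give \<open>T = W\<^sup>* Q Q\<close>, hence
  \<open>\<langle>A T e, e\<rangle> = \<langle>Q e, R\<^sup>* e\<rangle>\<close> with \<open>R = A W\<^sup>* Q\<close>. Both \<open>Q\<close> and \<open>R\<close> are Hilbert--Schmidt, with norms controlled by the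
  trace of \<open>P\<close> and by \<open>\<parallel>A\<parallel>\<close>. The Cauchy--Schwarz inequality bounds the tails of the trace by \<open>\<parallel>A\<parallel>\<close> times a tail
  of the sum of all \<open>\<parallel>Q e\<parallel>\<^sup>2\<close>, which does not depend on \<open>A\<close>.\<close>

lemma trace_class_uniform_tail:
  assumes T: "T \<in> trace_class" and eps: "0 < \<epsilon>"
  obtains F where "finite F"
    "\<And>A. A \<in> bounded_ops \<Longrightarrow> cmod (op_trace (A o\<^sub>L T) - (\<Sum>e\<in>F. cinner (A (T e)) e)) \<le> \<epsilon> * norm A"
proof -
  obtain P W where Tb: "T \<in> bounded_ops" and P: "positive_op P" and W: "W \<in> bounded_ops" "norm W \<le> 1"
    and TPW: "\<And>x y. cinner (T x) y = cinner (P x) (W y)"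
    and Psum: "(\<lambda>e. cinner (P e) e) summable_on some_onb"
    by (rule trace_classE[OF T], rule that)
  obtain Q where Q: "positive_op Q" "Q o\<^sub>L Q = P" using positive_op_sqrt[OF P] by blast
  have Qb: "Q \<in> bounded_ops" using Q by (simp add: positive_op_def)
  have PQ: "P x = Q (Q x)" for x
    using Q(2) by (metis blinfun_apply_blinfun_compose)
  define q where "q e = (norm (Q e))\<^sup>2" for e
  have "Re (cinner (P e) e) = q e" for e
    by (simp add: PQ q_def Re_cinner_self positive_op_symmetric[OF Q(1), of "Q e" e])
  then have "q summable_on some_onb" using summable_on_Re[OF Psum] by simp
  then obtain h where h: "(q has_sum h) some_onb" by (auto simp: summable_on_def)
  have h0: "0 \<le> h" by (rule has_sum_nonneg[OF h]) (simp add: q_def)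
  have bound: "(\<Sum>e\<in>G. cmod (cinner (A (T e)) e))
      \<le> sqrt (\<Sum>e\<in>G. q e) * (norm A * sqrt h)"
    if A: "A \<in> bounded_ops" and G: "finite G" "G \<subseteq> some_onb" for A G
  proof -
    define R where "R = (A o\<^sub>L (adj W o\<^sub>L Q))"
    have Rb: "R \<in> bounded_ops"
      unfolding R_def by (intro compose_in_bounded_ops A Qb adj_in_bounded_ops W)
    have adjR: "(adj R) y = Q (W (adj A y))" for y
    proof (rule eq_if_cinner_eq)
      fix z
      have "cinner (adj R y) z = cinner y (A (adj W (Q z)))"
        unfolding cinner_adj_left[OF Rb] by (simp add: R_def)
      also have "\<dots> = cinner (adj A y) (adj W (Q z))"
        by (rule cinner_adj_left[OF A, symmetric])
      also have "\<dots> = cinner (W (adj A y)) (Q z)"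
        by (rule cinner_adj_right[OF W(1)])
      also have "\<dots> = cinner (Q (W (adj A y))) z"
        by (rule positive_op_symmetric[OF Q(1), symmetric])
      finally show "cinner (adj R y) z
        = cinner (Q (W (adj A y))) z" .
    qed
    have "norm (R f) \<le> norm A * norm (Q f)" for f
    proof -
      have "norm (R f) \<le> norm A * (norm (adj W) * norm (Q f))"
        unfolding R_def blinfun_apply_blinfun_compose o_apply
        by (intro order_trans[OF norm_blinfun] mult_left_mono norm_blinfun norm_ge_zero)
      also have "\<dots> \<le> norm A * (1 * norm (Q f))"
        using norm_adj[OF W(1)] W(2) by (intro mult_left_mono mult_right_mono) auto
      finally show ?thesis by simp
    qed
    then have "(norm (R f))\<^sup>2 \<le> (norm A)\<^sup>2 * q f" for f
      using power_mono[of "norm (R f)" "norm A * norm (Q f)" 2]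
      by (simp add: q_def power_mult_distrib)
    then have HS: "(\<Sum>e\<in>G. (norm (adj R e))\<^sup>2) \<le> (norm A)\<^sup>2 * h"
      by (intro Hilbert_Schmidt_adj[OF is_onb_some_onb Rb _ has_sum_cmult_right[OF h] G])
    have "cinner (A (T e)) e = cinner (Q e) (adj R e)" for e
      unfolding cinner_adj_right[OF A, symmetric] TPW PQ adjR by (rule positive_op_symmetric[OF Q(1)])
    then have "(\<Sum>e\<in>G. cmod (cinner (A (T e)) e))
        \<le> (\<Sum>e\<in>G. norm (Q e) * norm (adj R e))"
      by (auto intro!: sum_mono cinner_Cauchy_Schwarz)
    also have "\<dots> \<le> sqrt (\<Sum>e\<in>G. q e) * sqrt (\<Sum>e\<in>G. (norm (adj R e))\<^sup>2)"
      unfolding q_def by (rule sum_norm_mult_le)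
    also have "\<dots> \<le> sqrt (\<Sum>e\<in>G. q e) * sqrt ((norm A)\<^sup>2 * h)"
      by (intro mult_left_mono real_sqrt_le_mono HS real_sqrt_ge_zero sum_nonneg) (simp add: q_def)
    finally show ?thesis by (simp add: real_sqrt_mult)
  qed
  \<comment> \<open>Chosen such that \<open>2 \<delta> h \<le> \<epsilon>\<^sup>2\<close>; tails of \<open>q\<close> are differences of two partial sums, each within \<open>\<delta>\<close> of \<open>h\<close>.\<close>
  define \<delta> where "\<delta> = \<epsilon>\<^sup>2 / (2 * (h + 1))"
  have \<delta>: "0 < \<delta>" using eps h0 by (simp add: \<delta>_def)
  have "\<forall>\<^sub>F F in finite_subsets_at_top some_onb. dist (sum q F) h < \<delta>"
    using h \<delta> unfolding has_sum_def by (rule tendstoD)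
  then obtain F where F: "finite F" "F \<subseteq> some_onb"
    "\<And>Y. finite Y \<Longrightarrow> F \<subseteq> Y \<Longrightarrow> Y \<subseteq> some_onb \<Longrightarrow> dist (sum q Y) h < \<delta>"
    unfolding eventually_finite_subsets_at_top by (elim exE conjE) (rule that, assumption, assumption, blast)
  have tail: "sqrt (sum q G) * sqrt h \<le> \<epsilon>" if G: "finite G" "G \<subseteq> some_onb" "G \<inter> F = {}" for G
  proof -
    have "sum q (F \<union> G) = sum q F + sum q G" using F G by (intro sum.union_disjoint) auto
    then have "sum q G \<le> 2 * \<delta>"
      using F(3)[of F] F(3)[of "F \<union> G"] F(1,2) G by (simp add: dist_real_def)
    then have "sum q G * h \<le> 2 * \<delta> * h" using h0 by (rule mult_right_mono)
    also have "\<dots> \<le> \<epsilon>\<^sup>2" using h0 by (simp add: \<delta>_def field_simps)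
    finally have "sqrt (sum q G * h) \<le> \<epsilon>" using eps by (simp add: real_le_lsqrt)
    then show ?thesis by (simp add: real_sqrt_mult)
  qed
  show thesis
  proof (rule that[OF F(1)])
    fix A :: "'a \<Rightarrow>\<^sub>L 'a" assume A: "A \<in> bounded_ops"
    let ?c = "\<lambda>e. cinner (A (T e)) e"
    have "(\<lambda>e. norm (?c e)) summable_on some_onb"
    proof (rule nonneg_bounded_partial_sums_imp_summable_on)
      show "\<forall>\<^sub>F X in finite_subsets_at_top some_onb. (\<Sum>e\<in>X. norm (?c e)) \<le> sqrt h * (norm A * sqrt h)"
      proof (rule eventually_finite_subsets_at_top_weakI)
        fix X :: "'a set" assume X: "finite X" "X \<subseteq> some_onb"
        have "sum q X \<le> h" by (rule finite_sum_le_has_sum[OF h X]) (simp add: q_def)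
        then have "sqrt (sum q X) * (norm A * sqrt h) \<le> sqrt h * (norm A * sqrt h)"
          using h0 by (intro mult_right_mono) auto
        then show "(\<Sum>e\<in>X. norm (?c e)) \<le> sqrt h * (norm A * sqrt h)" using bound[OF A X] by simp
      qed
    qed simp
    then have "?c summable_on some_onb" by (rule abs_summable_summable)
    then have lim: "(sum ?c \<longlongrightarrow> op_trace (A o\<^sub>L T)) (finite_subsets_at_top some_onb)"
      unfolding op_trace_def by (simp add: has_sum_infsum flip: has_sum_def)
    have le: "norm (sum ?c Y - sum ?c F) \<le> \<epsilon> * norm A" if Y: "finite Y" "F \<subseteq> Y" "Y \<subseteq> some_onb" for Y
    proof -
      have "norm (sum ?c Y - sum ?c F) = norm (sum ?c (Y - F))" using Y by (simp add: sum_diff)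
      also have "\<dots> \<le> (\<Sum>e\<in>Y - F. norm (?c e))" by (rule norm_sum)
      also have "\<dots> \<le> sqrt (sum q (Y - F)) * (norm A * sqrt h)"
        by (rule bound[OF A]) (use Y in auto)
      also have "\<dots> = sqrt (sum q (Y - F)) * sqrt h * norm A" by simp
      also have "\<dots> \<le> \<epsilon> * norm A"
        by (intro mult_right_mono tail) (use Y in auto)
      finally show ?thesis .
    qed
    show "cmod (op_trace (A o\<^sub>L T) - sum ?c F) \<le> \<epsilon> * norm A"
    proof (rule tendsto_upperbound)
      show "((\<lambda>Y. norm (sum ?c Y - sum ?c F)) \<longlongrightarrow> norm (op_trace (A o\<^sub>L T) - sum ?c F))
          (finite_subsets_at_top some_onb)"
        by (intro tendsto_intros lim)
      show "\<forall>\<^sub>F Y in finite_subsets_at_top some_onb. norm (sum ?c Y - sum ?c F) \<le> \<epsilon> * norm A"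
        unfolding eventually_finite_subsets_at_top using F(1,2) le by blast
    qed simp
  qed
qed

definition rank1 :: "'a :: complex_hilbert_space \<Rightarrow> 'a \<Rightarrow> 'a \<Rightarrow>\<^sub>L 'a" where
  "rank1 u v = Blinfun (\<lambda>z. cinner z v *\<^sub>C u)"

lemma rank1:
  shows rank1_apply: "(rank1 u v) z = cinner z v *\<^sub>C u"
    and rank1_in_bounded_ops: "rank1 u v \<in> bounded_ops"
    and norm_rank1_le: "norm (rank1 u v) \<le> norm u * norm v"
proof -
  have bd: "norm (cinner z v *\<^sub>C u) \<le> norm z * (norm u * norm v)" for z
    using mult_right_mono[OF cinner_Cauchy_Schwarz[of z v] norm_ge_zero[of u]]
    by (simp add: norm_scaleC mult_ac)
  have "bounded_linear (\<lambda>z. cinner z v *\<^sub>C u)"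
    by (rule bounded_linear_intro[OF _ _ bd])
      (simp_all add: cinner_add_left scaleC_add_left cinner_scaleC_left scaleR_scaleC scaleC_scaleC)
  then show app: "(rank1 u v) z = cinner z v *\<^sub>C u" for z
    by (simp add: rank1_def bounded_linear_Blinfun_apply)
  show "rank1 u v \<in> bounded_ops"
    by (simp add: bounded_ops_def app cinner_scaleC_left scaleC_scaleC)
  show "norm (rank1 u v) \<le> norm u * norm v"
    by (rule norm_blinfun_bound) (use bd in \<open>auto simp: app mult.commute\<close>)
qed

lemma adj_compose_self_positive:
  assumes T: "T \<in> bounded_ops"
  shows "positive_op (adj T o\<^sub>L T)"
  by (auto simp: positive_op_def cinner_adj_left[OF T] cinner_self
      intro!: compose_in_bounded_ops adj_in_bounded_ops T simp del: of_real_power)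

text \<open>For the contraction \<open>W\<close> of the polar decomposition, with \<open>W T = \<bar>T\<bar>\<close>, the bounded sums are the partial sums
  of the trace of \<open>\<bar>T\<bar>\<close>.\<close>

lemma trace_classI:
  assumes T: "T \<in> bounded_ops"
    and bd: "\<And>W F. W \<in> bounded_ops \<Longrightarrow> norm W \<le> 1 \<Longrightarrow> finite F \<Longrightarrow> F \<subseteq> some_onb \<Longrightarrow>
      cmod (\<Sum>e\<in>F. cinner (W (T e)) e) \<le> c"
  shows "T \<in> trace_class"
proof -
  obtain P where P: "positive_op P" "P o\<^sub>L P = (adj T o\<^sub>L T)"
    using positive_op_sqrt[OF adj_compose_self_positive[OF T]] by blast
  have Pb: "P \<in> bounded_ops" using P by (simp add: positive_op_def)
  have PP: "P (P z) = (adj T) (T z)" for z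
    using arg_cong[OF P(2), of "\<lambda>R. R z"] by simp
  have eq: "cinner (T x) (T z) = cinner (P x) (P z)" for x z
    by (simp add: positive_op_symmetric[OF P(1)] PP cinner_adj_right[OF T])
  obtain W where W: "W \<in> bounded_ops" "norm W \<le> 1" "W o\<^sub>L T = P"
    "\<And>x y. cinner (T x) y = cinner (P x) (W y)"
    by (rule polar_decomposition[OF T Pb eq], rule that)
  have WT: "W (T e) = P e" for e
    using arg_cong[OF W(3), of "\<lambda>R. R e"] by simp
  have nrm: "complex_of_real (norm (cinner (P e) e)) = cinner (P e) e" for e
  proof -
    have "cinner (P e) e \<in> \<real>" "0 \<le> Re (cinner (P e) e)"
      using P(1) by (auto simp: positive_op_def)
    then show ?thesis by (simp add: complex_eq_iff complex_is_Real_iff cmod_def)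
  qed
  have "(\<lambda>e. norm (cinner (P e) e)) summable_on some_onb"
  proof (rule nonneg_bounded_partial_sums_imp_summable_on)
    show "\<forall>\<^sub>F X in finite_subsets_at_top some_onb. (\<Sum>e\<in>X. norm (cinner (P e) e)) \<le> c"
    proof (rule eventually_finite_subsets_at_top_weakI)
      fix X :: "'a set" assume X: "finite X" "X \<subseteq> some_onb"
      have eq: "(\<Sum>e\<in>X. cinner (P e) e) = complex_of_real (\<Sum>e\<in>X. norm (cinner (P e) e))"
        by (simp add: nrm)
      have "(\<Sum>e\<in>X. norm (cinner (P e) e)) \<le> cmod (\<Sum>e\<in>X. cinner (P e) e)"
        unfolding eq norm_of_real by (rule abs_ge_self)
      then show "(\<Sum>e\<in>X. norm (cinner (P e) e)) \<le> c"
        using bd[OF W(1,2) X] by (simp add: WT)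
    qed
  qed simp
  then have "(\<lambda>e. cinner (P e) e) summable_on some_onb" by (rule abs_summable_summable)
  moreover have "is_adjoint (adj T) T" by (simp add: is_adjoint_def cinner_adj_right[OF T])
  ultimately show ?thesis using T P unfolding trace_class_def by blast
qed

section \<open>The Hahn--Banach theorem\<close>

text \<open>In one-dimensional extensions of functionals, \<open>t\<close> is the value at the new vector.\<close>

lemma ex_between:
  fixes f :: "'i \<Rightarrow> real" and g :: "'j \<Rightarrow> real"
  assumes "\<And>a b. a \<in> A \<Longrightarrow> b \<in> B \<Longrightarrow> f a \<le> g b" and "A \<noteq> {}" "B \<noteq> {}"
  obtains t where "\<And>a. a \<in> A \<Longrightarrow> f a \<le> t" "\<And>b. b \<in> B \<Longrightarrow> t \<le> g b"
proof (rule that[of "Sup (f ` A)"])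
  obtain b where "b \<in> B" using assms by blast
  then have "bdd_above (f ` A)" using assms(1) by (intro bdd_aboveI[of _ "g b"]) auto
  then show "f a \<le> Sup (f ` A)" if "a \<in> A" for a using that by (intro cSup_upper) auto
  show "Sup (f ` A) \<le> g b" if "b \<in> B" for b using assms that by (intro cSup_least) auto
qed

text \<open>Functionals are represented by their graphs, subspaces of \<open>X \<times> \<real>\<close>. The domination by the norm
  makes such a subspace single-valued, and makes a maximal one total.\<close>

lemma Hahn_Banach_norm:
  fixes u :: "'a :: real_normed_vector \<Rightarrow> real"
  assumes S: "subspace S" and add: "\<And>x y. x \<in> S \<Longrightarrow> y \<in> S \<Longrightarrow> u (x + y) = u x + u y"
    and scale: "\<And>r x. x \<in> S \<Longrightarrow> u (r *\<^sub>R x) = r * u x"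
    and bound: "\<And>x. x \<in> S \<Longrightarrow> u x \<le> c * norm x" and c: "0 \<le> c"
  obtains g where "linear g" "\<And>x. x \<in> S \<Longrightarrow> g x = u x" "\<And>x. g x \<le> c * norm x"
proof -
  define G0 where "G0 = (\<lambda>x. (x, u x)) ` S"
  define \<G> where "\<G> = {G. subspace G \<and> G0 \<subseteq> G \<and> (\<forall>(x, r)\<in>G. r \<le> c * norm x)}"
  have "subspace G0"
  proof (unfold subspace_def, intro conjI ballI allI)
    show "0 \<in> G0" unfolding G0_def
      by (rule image_eqI[of _ _ 0]) (use scale[of 0 0] subspace_0[OF S] in \<open>auto simp: zero_prod_def\<close>)
    fix p assume "p \<in> G0"
    then obtain x where x: "x \<in> S" "p = (x, u x)" by (auto simp: G0_def)
    show "r *\<^sub>R p \<in> G0" for r unfolding G0_def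
      by (rule image_eqI[of _ _ "r *\<^sub>R x"]) (use x S in \<open>auto simp: scale subspace_scale\<close>)
    fix q assume "q \<in> G0"
    then obtain y where y: "y \<in> S" "q = (y, u y)" by (auto simp: G0_def)
    show "p + q \<in> G0" unfolding G0_def
      by (rule image_eqI[of _ _ "x + y"]) (use x y S in \<open>auto simp: add subspace_add\<close>)
  qed
  then have G0: "G0 \<in> \<G>" using bound by (auto simp: \<G>_def G0_def)
  have "\<exists>M\<in>\<G>. \<forall>X\<in>\<G>. M \<subseteq> X \<longrightarrow> X = M"
  proof (rule subset_Zorn_nonempty)
    show "\<G> \<noteq> {}" using G0 by blast
    fix C assume C: "C \<noteq> {}" "subset.chain \<G> C"
    have mem: "subspace G" "G0 \<subseteq> G" "\<And>x r. (x, r) \<in> G \<Longrightarrow> r \<le> c * norm x" if "G \<in> C" for G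
      using C(2) that by (auto simp: subset.chain_def \<G>_def)
    have "subspace (\<Union>C)"
      unfolding subspace_def
    proof (intro conjI ballI allI)
      show "0 \<in> \<Union>C" using C(1) mem(1) subspace_0 by blast
      fix p assume p: "p \<in> \<Union>C"
      then show "r *\<^sub>R p \<in> \<Union>C" for r using mem(1) subspace_scale by blast
      fix q assume q: "q \<in> \<Union>C"
      obtain M where "M \<in> C" "p \<in> M" "q \<in> M" using chain_common_member[OF C(2) p q] by blast
      then show "p + q \<in> \<Union>C" using mem(1) subspace_add by blast
    qed
    then show "\<Union>C \<in> \<G>" using C(1) mem(2,3) unfolding \<G>_def by blast
  qed
  then obtain M where M: "M \<in> \<G>" and max: "\<And>X. X \<in> \<G> \<Longrightarrow> M \<subseteq> X \<Longrightarrow> X = M" by blast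
  have Ms: "subspace M" and MG0: "G0 \<subseteq> M" and Mle: "\<And>x r. (x, r) \<in> M \<Longrightarrow> r \<le> c * norm x"
    using M by (auto simp: \<G>_def)
  have total: "\<exists>t. (x0, t) \<in> M" for x0
  proof -
    obtain t where t: "\<And>p. p \<in> M \<Longrightarrow> snd p - c * norm (fst p - x0) \<le> t"
      "\<And>p. p \<in> M \<Longrightarrow> t \<le> c * norm (fst p + x0) - snd p"
    proof (rule ex_between[of M M "\<lambda>p. snd p - c * norm (fst p - x0)" "\<lambda>p. c * norm (fst p + x0) - snd p"])
      fix p q assume "p \<in> M" "q \<in> M"
      then have "p + q \<in> M" using Ms subspace_add by blast
      then have "snd p + snd q \<le> c * norm (fst p + fst q)"
        using Mle[of "fst p + fst q" "snd p + snd q"] by (simp add: plus_prod_def)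
      also have "\<dots> \<le> c * (norm (fst p - x0) + norm (fst q + x0))"
        using norm_triangle_ineq[of "fst p - x0" "fst q + x0"] c by (intro mult_left_mono) (auto simp: algebra_simps)
      finally show "snd p - c * norm (fst p - x0) \<le> c * norm (fst q + x0) - snd q"
        by (simp add: algebra_simps)
    qed (use MG0 subspace_0[OF Ms] in auto)
    \<comment> \<open>The extension of the graph by the value \<open>t\<close> at \<open>x0\<close>\<close>
    define M' where "M' = {p + q |p q. p \<in> M \<and> q \<in> span {(x0, t)}}"
    have "subspace M'" unfolding M'_def by (intro subspace_sums Ms subspace_span)
    moreover have MM': "M \<subseteq> M'"
    proof
      fix p assume "p \<in> M"
      then have "p = p + 0 \<and> p \<in> M \<and> 0 \<in> span {(x0, t)}" by (simp add: span_0)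
      then show "p \<in> M'" unfolding M'_def by blast
    qed
    moreover have "r \<le> c * norm x" if mem: "(x, r) \<in> M'" for x r
    proof -
      obtain p q where p: "p \<in> M" "(x, r) = p + q" and "q \<in> span {(x0, t)}"
        using mem unfolding M'_def by blast
      then obtain s where "q = s *\<^sub>R (x0, t)" unfolding span_singleton by blast
      with p have p: "p \<in> M" "(x, r) = p + s *\<^sub>R (x0, t)" by simp_all
      then have xr: "x = fst p + s *\<^sub>R x0" "r = snd p + s * t"
        by (auto simp: plus_prod_def prod_eq_iff)
      consider "s = 0" | "s > 0" | "s < 0" by linarith
      then show ?thesis
      proof cases
        case 1
        then show ?thesis using Mle[of "fst p" "snd p"] p xr by simp
      next
        case 2
        have "(1/s) *\<^sub>R p \<in> M" using Ms p by (simp add: subspace_scale)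
        from t(2)[OF this] have "s * t \<le> s * (c * norm ((1/s) *\<^sub>R fst p + x0) - snd p / s)"
          using 2 by (simp add: mult_left_mono)
        also have "\<dots> = c * norm (s *\<^sub>R ((1/s) *\<^sub>R fst p + x0)) - snd p"
          using 2 by (simp add: right_diff_distrib del: scaleR_add_right)
        also have "s *\<^sub>R ((1/s) *\<^sub>R fst p + x0) = x"
          using 2 by (simp add: xr scaleR_add_right)
        finally show ?thesis by (simp add: xr)
      next
        case 3
        define s' where "s' = - s"
        have s': "s' > 0" using 3 by (simp add: s'_def)
        have "(1/s') *\<^sub>R p \<in> M" using Ms p by (simp add: subspace_scale)
        from t(1)[OF this] have "s' * (snd p / s' - c * norm ((1/s') *\<^sub>R fst p - x0)) \<le> s' * t"
          using s' by (simp add: mult_left_mono)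
        moreover have "s' * (snd p / s' - c * norm ((1/s') *\<^sub>R fst p - x0))
            = snd p - c * norm (s' *\<^sub>R ((1/s') *\<^sub>R fst p - x0))"
          using s' by (simp add: right_diff_distrib del: scaleR_diff_right)
        moreover have "s' *\<^sub>R ((1/s') *\<^sub>R fst p - x0) = x"
          using s' by (simp add: xr scaleR_diff_right s'_def)
        ultimately have "snd p - c * norm x \<le> s' * t" by (simp only:)
        then show ?thesis unfolding xr(2) s'_def by simp
      qed
    qed
    ultimately have "M' \<in> \<G>" using MG0 by (auto simp: \<G>_def)
    then have "M' = M" using max MM' by blast
    moreover have "(x0, t) \<in> M'"
    proof -
      have "(x0, t) = 0 + (x0, t) \<and> 0 \<in> M \<and> (x0, t) \<in> span {(x0, t)}"
        by (simp add: subspace_0[OF Ms] span_base)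
      then show ?thesis unfolding M'_def by blast
    qed
    ultimately show ?thesis by blast
  qed
  have unique: "r = q" if "(x, r) \<in> M" "(x, q) \<in> M" for x r q
    using subspace_diff[OF Ms that] subspace_diff[OF Ms that(2,1)] Mle[of 0 "r - q"] Mle[of 0 "q - r"] by simp
  define g where "g x = (SOME r. (x, r) \<in> M)" for x
  have g: "(x, g x) \<in> M" for x unfolding g_def by (rule someI_ex) (rule total)
  show thesis
  proof (rule that)
    show "linear g"
    proof (rule linearI)
      show "g (x + y) = g x + g y" for x y
        using subspace_add[OF Ms g g, of x y] by (intro unique[OF g]) simp
      show "g (r *\<^sub>R x) = r *\<^sub>R g x" for r x
        using subspace_scale[OF Ms g, of r x] by (intro unique[OF g]) simp
    qed
    show "g x = u x" if "x \<in> S" for x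
      using that MG0 by (intro unique[OF g]) (auto simp: G0_def)
    show "g x \<le> c * norm x" for x by (rule Mle) (rule g)
  qed
qed

definition op_csubspace :: "('a :: complex_hilbert_space \<Rightarrow>\<^sub>L 'a) set \<Rightarrow> bool" where
  "op_csubspace S \<longleftrightarrow> S \<subseteq> bounded_ops \<and> 0 \<in> S \<and> (\<forall>A\<in>S. \<forall>B\<in>S. A + B \<in> S) \<and> (\<forall>c. \<forall>A\<in>S. scale_op c A \<in> S)"

lemma op_csubspaceD:
  assumes "op_csubspace S"
  shows "A \<in> S \<Longrightarrow> A \<in> bounded_ops" "0 \<in> S" "A \<in> S \<Longrightarrow> B \<in> S \<Longrightarrow> A + B \<in> S"
    "A \<in> S \<Longrightarrow> scale_op c A \<in> S" "A \<in> S \<Longrightarrow> r *\<^sub>R A \<in> S" "A \<in> S \<Longrightarrow> B \<in> S \<Longrightarrow> A - B \<in> S" "A \<in> S \<Longrightarrow> - A \<in> S"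
proof -
  have neg: "A \<in> S \<Longrightarrow> - A \<in> S" for A
    using assms by (metis op_csubspace_def scale_op_simps(3))
  show "A \<in> S \<Longrightarrow> A \<in> bounded_ops" "0 \<in> S" "A \<in> S \<Longrightarrow> B \<in> S \<Longrightarrow> A + B \<in> S"
    "A \<in> S \<Longrightarrow> scale_op c A \<in> S" "A \<in> S \<Longrightarrow> - A \<in> S"
    using assms neg by (auto simp: op_csubspace_def)
  show "A \<in> S \<Longrightarrow> r *\<^sub>R A \<in> S"
    using assms by (metis op_csubspace_def scale_op_simps(2))
  show "A \<in> S \<Longrightarrow> B \<in> S \<Longrightarrow> A - B \<in> S"
    using assms neg[of B] by (metis op_csubspace_def add_uminus_conv_diff)
qed

lemma op_csubspace_bounded_ops: "op_csubspace bounded_ops"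
  by (auto simp: op_csubspace_def zero_in_bounded_ops add_in_bounded_ops scale_in_bounded_ops)

lemma op_subalgebra_imp_op_csubspace: "op_subalgebra A \<Longrightarrow> op_csubspace A"
  by (auto simp: op_subalgebra_def op_csubspace_def)

definition op_linear_on :: "('a :: complex_hilbert_space \<Rightarrow>\<^sub>L 'a) set \<Rightarrow> (('a \<Rightarrow>\<^sub>L 'a) \<Rightarrow> complex) \<Rightarrow> bool" where
  "op_linear_on S f \<longleftrightarrow> (\<forall>A\<in>S. \<forall>B\<in>S. f (A + B) = f A + f B) \<and> (\<forall>c. \<forall>A\<in>S. f (scale_op c A) = c * f A)"

text \<open>A complex linear functional is determined by its real part \<open>g\<close> through \<open>\<phi> A = g A - \<i> g (\<i> A)\<close>, and a rotation
  shows that \<open>\<phi>\<close> inherits the bound of \<open>g\<close>.\<close>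

lemma Hahn_Banach_ops:
  assumes S: "op_csubspace S" and f: "op_linear_on S f"
    and bound: "\<And>A. A \<in> S \<Longrightarrow> cmod (f A) \<le> c * norm A" and c: "0 \<le> c"
  obtains \<phi> where "op_linear_on bounded_ops \<phi>" "\<And>A. A \<in> S \<Longrightarrow> \<phi> A = f A"
    "\<And>A. A \<in> bounded_ops \<Longrightarrow> cmod (\<phi> A) \<le> c * norm A"
proof -
  obtain g where g: "linear g" "\<And>A. A \<in> S \<Longrightarrow> g A = Re (f A)" "\<And>A. g A \<le> c * norm A"
  proof (rule Hahn_Banach_norm[of S "\<lambda>A. Re (f A)" c])
    show "subspace S" by (auto simp: subspace_def op_csubspaceD[OF S])
    show "Re (f (A + B)) = Re (f A) + Re (f B)" if "A \<in> S" "B \<in> S" for A B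
      using f that by (simp add: op_linear_on_def)
    show "Re (f (r *\<^sub>R A)) = r * Re (f A)" if "A \<in> S" for A r
      using f that unfolding op_linear_on_def scale_op_simps(2)[symmetric] by simp
    show "Re (f A) \<le> c * norm A" if "A \<in> S" for A
      using bound[OF that] complex_Re_le_cmod[of "f A"] by linarith
  qed (use c in auto)
  define \<phi> where "\<phi> A = Complex (g A) (- g (scale_op \<i> A))" for A
  have gs: "g (scale_op z A) = Re z * g A + Im z * g (scale_op \<i> A)" for z A
  proof -
    have "scale_op z A = Re z *\<^sub>R A + Im z *\<^sub>R scale_op \<i> A"
    proof (rule blinfun_eqI)
      fix x
      have "z *\<^sub>C A x = (of_real (Re z) + of_real (Im z) * \<i>) *\<^sub>C A x"
        using complex_eq[of z] by (simp add: mult.commute)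
      then show "(scale_op z A) x = blinfun_apply (Re z *\<^sub>R A + Im z *\<^sub>R scale_op \<i> A) x"
        by (simp add: blinfun.add_left blinfun.scaleR_left scale_op_apply scaleR_scaleC scaleC_scaleC scaleC_add_left)
    qed
    then show ?thesis using g(1) by (simp add: linear_add linear_scale)
  qed
  have lin: "op_linear_on bounded_ops \<phi>"
  proof -
    have "\<phi> (scale_op z A) = z * \<phi> A" for z A
      by (rule complex_eqI) (simp_all add: \<phi>_def scale_op_simps(1) gs[of z A] gs[of "\<i> * z" A])
    moreover have "\<phi> (A + B) = \<phi> A + \<phi> B" for A B
      by (rule complex_eqI) (simp_all add: \<phi>_def scale_op_simps(4) linear_add[OF g(1)])
    ultimately show ?thesis by (simp add: op_linear_on_def)
  qed
  show thesis
  proof (rule that[OF lin])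
    show "\<phi> A = f A" if "A \<in> S" for A
      by (rule complex_eqI)
        (use that f in \<open>simp_all add: \<phi>_def g(2) op_csubspaceD[OF S] op_linear_on_def\<close>)
    show "cmod (\<phi> A) \<le> c * norm A" if A: "A \<in> bounded_ops" for A
    proof -
      obtain z where z: "cmod z = 1" "z * \<phi> A = of_real (cmod (\<phi> A))" using unimodular_rotation by blast
      have "\<phi> (scale_op z A) = of_real (cmod (\<phi> A))"
        using lin A z(2) by (simp add: op_linear_on_def)
      then have "cmod (\<phi> A) = g (scale_op z A)" by (simp add: \<phi>_def complex_eq_iff)
      also have "\<dots> \<le> c * norm (scale_op z A)" by (rule g(3))
      finally show ?thesis using z(1) by (simp add: norm_scale_op)
    qed
  qed
qed

lemma op_linear_on_sum:
  assumes S: "op_csubspace S" and f: "op_linear_on S f" and "\<And>i. i \<in> I \<Longrightarrow> A i \<in> S" "finite I"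
  shows "(\<Sum>i\<in>I. A i) \<in> S \<and> f (\<Sum>i\<in>I. A i) = (\<Sum>i\<in>I. f (A i))"
  using assms(4,3)
proof (induction I rule: finite_induct)
  case empty
  have "f (scale_op 0 0) = 0 * f 0" using f op_csubspaceD(2)[OF S] by (simp add: op_linear_on_def)
  moreover have "scale_op 0 0 = (0 :: 'a \<Rightarrow>\<^sub>L 'a)" by (rule blinfun_eqI) (simp add: scale_op_apply)
  ultimately show ?case using op_csubspaceD(2)[OF S] by simp
next
  case (insert i I)
  then show ?case using f op_csubspaceD(3)[OF S] by (auto simp: op_linear_on_def)
qed

section \<open>Weak-* approximation by bounded sets of compact operators\<close>

text \<open>The values of \<open>\<phi>\<close> at the operators of rank one define \<open>T\<close>, and then the partial sums of the trace of
  \<open>A T\<close> are the numbers \<open>\<phi> (P A)\<close>, where \<open>P\<close> is the projection onto the span of finitely many basis vectors. They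
  are bounded by \<open>c \<parallel>A\<parallel>\<close>, and converge to \<open>\<phi> A\<close> if \<open>A\<close> is compact. On other operators \<open>\<phi>\<close> may differ from the
  functional given by \<open>T\<close>, but both obey the same bound.\<close>

lemma trace_class_representation:
  assumes \<phi>: "op_linear_on bounded_ops \<phi>" and bd: "\<And>A. A \<in> bounded_ops \<Longrightarrow> cmod (\<phi> A) \<le> c * norm A" and c: "0 \<le> c"
  obtains T where "T \<in> trace_class" "\<And>K. compact_op K \<Longrightarrow> op_trace (K o\<^sub>L T) = \<phi> K"
    "\<And>A. A \<in> bounded_ops \<Longrightarrow> cmod (op_trace (A o\<^sub>L T)) \<le> c * norm A"
proof -
  note add = \<phi>[unfolded op_linear_on_def, THEN conjunct1, rule_format]
  note scl = \<phi>[unfolded op_linear_on_def, THEN conjunct2, rule_format]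
  obtain T where T: "T \<in> bounded_ops" "\<And>u v. cinner (T u) v = \<phi> (rank1 u v)"
  proof (rule bounded_ops_of_form[of "\<lambda>u v. \<phi> (rank1 u v)" c])
    fix u u' v v' :: 'a and r :: complex
    have "rank1 (u + u') v = rank1 u v + rank1 u' v"
      by (rule blinfun_eqI) (simp add: rank1_apply blinfun.add_left scaleC_add_right)
    then show "\<phi> (rank1 (u + u') v) = \<phi> (rank1 u v) + \<phi> (rank1 u' v)"
      by (simp add: add rank1_in_bounded_ops)
    have "rank1 u (v + v') = rank1 u v + rank1 u v'"
      by (rule blinfun_eqI) (simp add: rank1_apply blinfun.add_left cinner_add_right scaleC_add_left)
    then show "\<phi> (rank1 u (v + v')) = \<phi> (rank1 u v) + \<phi> (rank1 u v')"
      by (simp add: add rank1_in_bounded_ops)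
    have "rank1 (r *\<^sub>C u) v = scale_op r (rank1 u v)"
      by (rule blinfun_eqI) (simp add: rank1_apply scale_op_apply scaleC_scaleC mult.commute)
    then show "\<phi> (rank1 (r *\<^sub>C u) v) = r * \<phi> (rank1 u v)"
      by (simp add: scl rank1_in_bounded_ops)
    have "rank1 u (r *\<^sub>C v) = scale_op (cnj r) (rank1 u v)"
      by (rule blinfun_eqI) (simp add: rank1_apply scale_op_apply scaleC_scaleC cinner_scaleC_right)
    then show "\<phi> (rank1 u (r *\<^sub>C v)) = cnj r * \<phi> (rank1 u v)"
      by (simp add: scl rank1_in_bounded_ops)
    show "cmod (\<phi> (rank1 u v)) \<le> c * norm u * norm v"
      using bd[OF rank1_in_bounded_ops[of u v]] mult_left_mono[OF norm_rank1_le[of u v] c] by (simp add: mult.assoc)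
  qed (use c that in auto)
  have sums: "(\<Sum>e\<in>F. cinner (A (T e)) e) = \<phi> (fproj F o\<^sub>L A)"
    if A: "A \<in> bounded_ops" and F: "finite F" for A F
  proof -
    have "fproj F o\<^sub>L A = (\<Sum>e\<in>F. rank1 e (adj A e))"
      by (rule blinfun_eqI) (simp add: blinfun.sum_left fproj_apply rank1_apply cinner_adj_right[OF A])
    moreover have "cinner (A (T e)) e = \<phi> (rank1 e (adj A e))" for e
      by (simp add: cinner_adj_right[OF A] flip: T(2))
    moreover have "\<phi> (\<Sum>e\<in>F. rank1 e (adj A e)) = (\<Sum>e\<in>F. \<phi> (rank1 e (adj A e)))"
      by (rule op_linear_on_sum[OF op_csubspace_bounded_ops \<phi> _ F, THEN conjunct2]) (rule rank1_in_bounded_ops)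
    ultimately show ?thesis by simp
  qed
  have le: "cmod (\<Sum>e\<in>F. cinner (A (T e)) e) \<le> c * norm A"
    if A: "A \<in> bounded_ops" and F: "finite F" "F \<subseteq> some_onb" for A F
  proof -
    have "cmod (\<phi> (fproj F o\<^sub>L A)) \<le> c * norm (fproj F o\<^sub>L A)"
      by (intro bd compose_in_bounded_ops fproj_in_bounded_ops A)
    also have "\<dots> \<le> c * (norm (fproj F) * norm A)" by (intro mult_left_mono norm_blinfun_compose c)
    also have "\<dots> \<le> c * (1 * norm A)"
      by (intro mult_left_mono mult_right_mono norm_fproj_le c orthonormal_subset[OF orthonormal_some_onb] F norm_ge_zero)
    finally show ?thesis by (simp add: sums A F)
  qed
  show thesis
  proof (rule that)
    show "T \<in> trace_class"
    proof (rule trace_classI[OF T(1)])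
      fix W :: "'a \<Rightarrow>\<^sub>L 'a" and F :: "'a set"
      assume W: "W \<in> bounded_ops" "norm W \<le> 1" and F: "finite F" "F \<subseteq> some_onb"
      show "cmod (\<Sum>e\<in>F. cinner (W (T e)) e) \<le> c"
        using le[OF W(1) F] mult_left_mono[OF W(2) c] by simp
    qed
    show "op_trace (K o\<^sub>L T) = \<phi> K" if K: "compact_op K" for K
    proof -
      have Kb: "K \<in> bounded_ops" using K by (simp add: compact_op_def)
      have "((\<lambda>F. \<phi> (fproj F o\<^sub>L K)) \<longlongrightarrow> \<phi> K) (finite_subsets_at_top some_onb)"
      proof (rule tendsto_norm_zero_cancel[THEN LIM_zero_cancel], rule tendsto_sandwich[of "\<lambda>_. 0"])
        show "\<forall>\<^sub>F F in finite_subsets_at_top some_onb. norm (\<phi> (fproj F o\<^sub>L K) - \<phi> K) \<le> c * norm ((fproj F o\<^sub>L K) - K)"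
        proof (rule always_eventually, rule allI)
          fix F :: "'a set"
          have b: "(fproj F o\<^sub>L K) \<in> bounded_ops" by (intro compose_in_bounded_ops fproj_in_bounded_ops Kb)
          have "\<phi> (fproj F o\<^sub>L K) = \<phi> (((fproj F o\<^sub>L K) - K) + K)" by simp
          also have "\<dots> = \<phi> ((fproj F o\<^sub>L K) - K) + \<phi> K" by (intro add diff_in_bounded_ops b Kb)
          finally show "norm (\<phi> (fproj F o\<^sub>L K) - \<phi> K) \<le> c * norm ((fproj F o\<^sub>L K) - K)"
            using bd[OF diff_in_bounded_ops[OF b Kb]] by simp
        qed
        show "((\<lambda>F. c * norm ((fproj F o\<^sub>L K) - K)) \<longlongrightarrow> 0) (finite_subsets_at_top some_onb)"
          using tendsto_mult_right_zero[OF tendsto_norm_zero[OF LIM_zero[OF fproj_compact_tendsto[OF K is_onb_some_onb]]]] .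
      qed (auto intro: tendsto_const)
      moreover have "\<forall>\<^sub>F F in finite_subsets_at_top some_onb.
          \<phi> (fproj F o\<^sub>L K) = (\<Sum>e\<in>F. cinner (blinfun_apply (K o\<^sub>L T) e) e)"
        by (rule eventually_finite_subsets_at_top_weakI) (simp add: sums[OF Kb])
      ultimately have "((\<lambda>e. cinner (blinfun_apply (K o\<^sub>L T) e) e) has_sum \<phi> K) some_onb"
        unfolding has_sum_def by (rule Lim_transform_eventually)
      then show ?thesis unfolding op_trace_def by (rule infsumI)
    qed
    show "cmod (op_trace (A o\<^sub>L T)) \<le> c * norm A" if A: "A \<in> bounded_ops" for A
    proof (cases "(\<lambda>e. cinner (blinfun_apply (A o\<^sub>L T) e) e) summable_on some_onb")
      case True
      then have lim: "((\<lambda>F. cmod (\<Sum>e\<in>F. cinner (blinfun_apply (A o\<^sub>L T) e) e)) \<longlongrightarrow> cmod (op_trace (A o\<^sub>L T)))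
          (finite_subsets_at_top some_onb)"
        unfolding op_trace_def by (intro tendsto_norm) (simp only: has_sum_infsum flip: has_sum_def)
      show ?thesis
      proof (rule tendsto_upperbound[OF lim])
        show "\<forall>\<^sub>F F in finite_subsets_at_top some_onb.
            cmod (\<Sum>e\<in>F. cinner (blinfun_apply (A o\<^sub>L T) e) e) \<le> c * norm A"
          by (rule eventually_finite_subsets_at_top_weakI) (use le[OF A] in simp)
      qed simp
    next
      \<comment> \<open>Then the trace is zero by convention.\<close>
      case False
      then show ?thesis using c by (simp add: op_trace_def infsum_not_exists)
    qed
  qed
qed

lemma rank1_trace_class: "rank1 x y \<in> trace_class"
proof (rule trace_classI[OF rank1_in_bounded_ops])
  fix W :: "'a \<Rightarrow>\<^sub>L 'a" and F :: "'a set"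
  assume W: "W \<in> bounded_ops" "norm W \<le> 1" and F: "finite F" "F \<subseteq> some_onb"
  have "(\<Sum>e\<in>F. cinner (W ((rank1 x y) e)) e)
      = cinner (fproj F (W x)) y"
    by (simp add: rank1_apply bounded_ops_scaleC[OF W(1)] cinner_scaleC_left cinner_fproj mult.commute)
  moreover have "cmod \<dots> \<le> norm (W x) * norm y"
    by (rule order_trans[OF cinner_Cauchy_Schwarz])
      (intro mult_right_mono norm_fproj_apply_le orthonormal_subset[OF orthonormal_some_onb] F norm_ge_zero)
  moreover have "norm (W x) \<le> 1 * norm x"
    using norm_blinfun[of W x] mult_right_mono[OF W(2) norm_ge_zero[of x]] by linarith
  ultimately show "cmod (\<Sum>e\<in>F. cinner (W ((rank1 x y) e)) e) \<le> norm x * norm y"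
    using mult_right_mono[of "norm (W x)" "norm x" "norm y"] by simp
qed

lemma op_trace_rank1: "A \<in> bounded_ops \<Longrightarrow> op_trace (A o\<^sub>L rank1 x y) = cinner (A x) y"
  unfolding op_trace_def
  by (rule infsumI)
    (use Parseval_has_sum[OF is_onb_some_onb, of "A x" y] in
      \<open>simp add: rank1_apply bounded_ops_scaleC cinner_scaleC_left mult.commute\<close>)

lemma topspace_weak_star: "topspace weak_star = bounded_ops"
  by (simp add: weak_star_def topspace_pullback_topology PiE_def extensional_def)

lemma continuous_map_weak_star_op_trace:
  assumes "T \<in> trace_class"
  shows "continuous_map weak_star euclidean (\<lambda>A. op_trace (A o\<^sub>L T))"
proof -
  have "continuous_map weak_star euclidean ((\<lambda>f. f T) \<circ> (\<lambda>A. \<lambda>T\<in>trace_class. op_trace (A o\<^sub>L T)))"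
    unfolding weak_star_def
    by (rule continuous_map_pullback) (rule continuous_map_product_projection[OF assms])
  then show ?thesis using assms by (simp add: o_def)
qed

text \<open>The vector functional is extended from \<open>S\<close> without increasing its norm, and the trace class operator
  representing the extension agrees with the vector functional on the weak-* closure of \<open>S\<close>. This is a form of
  Goldstine's theorem: \<open>D\<close> cannot be separated from the operators of norm at most \<open>\<parallel>D\<parallel>\<close> in \<open>S\<close> by vector
  functionals.\<close>

lemma compact_Goldstine:
  assumes S: "op_csubspace S" and comp: "\<And>K. K \<in> S \<Longrightarrow> compact_op K"
    and D: "D \<in> weak_star closure_of S" and c: "0 \<le> c"
    and bd: "\<And>K. K \<in> S \<Longrightarrow> cmod (cinner (K x) y) \<le> c * norm K"
  shows "cmod (cinner (D x) y) \<le> c * norm D"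
proof -
  have Db: "D \<in> bounded_ops"
    using D closure_of_subset_topspace[of weak_star S] by (auto simp: topspace_weak_star)
  have "op_linear_on S (\<lambda>K. cinner (blinfun_apply K x) y)"
    by (simp add: op_linear_on_def blinfun.add_left cinner_add_left scale_op_apply cinner_scaleC_left)
  then obtain \<phi> where \<phi>: "op_linear_on bounded_ops \<phi>" "\<And>K. K \<in> S \<Longrightarrow> \<phi> K = cinner (K x) y"
    "\<And>A. A \<in> bounded_ops \<Longrightarrow> cmod (\<phi> A) \<le> c * norm A"
    using Hahn_Banach_ops[OF S _ bd c] by blast
  obtain T where T: "T \<in> trace_class" "\<And>K. compact_op K \<Longrightarrow> op_trace (K o\<^sub>L T) = \<phi> K"
    "\<And>A. A \<in> bounded_ops \<Longrightarrow> cmod (op_trace (A o\<^sub>L T)) \<le> c * norm A"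
    using trace_class_representation[OF \<phi>(1,3) c] by blast
  have "op_trace (D o\<^sub>L rank1 x y) = op_trace (D o\<^sub>L T)"
    by (rule forall_in_closure_of_eq[OF D Hausdorff_space_euclidean
          continuous_map_weak_star_op_trace[OF rank1_trace_class] continuous_map_weak_star_op_trace[OF T(1)]])
      (simp add: op_trace_rank1 T(2) comp \<phi>(2) op_csubspaceD(1)[OF S])
  then show ?thesis using T(3)[OF Db] by (simp add: op_trace_rank1 Db)
qed

section \<open>The norm of a compact operator plus a weakly null net\<close>

text \<open>Here \<open>p\<close> and \<open>q\<close> are the norms of the components of a unit vector inside and outside the finite
  dimensional range of the compact operator, and \<open>z\<close> is the contribution that tends to zero.\<close>

lemma quadratic_estimate:
  fixes k p q s z :: real
  assumes "p\<^sup>2 + q\<^sup>2 \<le> 1" "0 \<le> p" "0 \<le> q" "0 \<le> k" "0 \<le> s"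
  shows "(k * p)\<^sup>2 + 2 * s * (z + k * p * (2 * q)) + s\<^sup>2 * 4 \<le> k\<^sup>2 + 8 * s\<^sup>2 + 2 * s * z"
proof -
  have "p\<^sup>2 \<le> 1\<^sup>2" unfolding one_power2 using assms(1) zero_le_power2[of q] by linarith
  then have p1: "p \<le> 1" by (rule power2_le_imp_le) simp
  have "k * p * (2 * q) \<le> k * 1 * (2 * q)" using assms p1 by (intro mult_right_mono mult_left_mono) auto
  then have "2 * s * (k * p * (2 * q)) \<le> 2 * s * (k * 1 * (2 * q))" using assms by (intro mult_left_mono) auto
  moreover have "k\<^sup>2 * (p\<^sup>2 + q\<^sup>2) \<le> k\<^sup>2 * 1" using assms by (intro mult_left_mono) auto
  moreover have "0 \<le> (k * q - 2 * s)\<^sup>2" by simp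
  ultimately show ?thesis by (simp add: power2_eq_square algebra_simps)
qed

lemma adj_add: "S \<in> bounded_ops \<Longrightarrow> T \<in> bounded_ops \<Longrightarrow> adj (S + T) = adj S + adj T"
  by (rule blinfun_eqI, rule eq_if_cinner_eq)
    (simp add: cinner_adj_left add_in_bounded_ops blinfun.add_left cinner_add_left cinner_add_right)

lemma adj_scaleR: "T \<in> bounded_ops \<Longrightarrow> adj (r *\<^sub>R T) = r *\<^sub>R adj T"
  by (rule blinfun_eqI, rule eq_if_cinner_eq)
    (simp add: cinner_adj_left scaleR_in_bounded_ops blinfun.scaleR_left cinner_scaleR_left cinner_scaleR_right)

lemma adj_compose: "S \<in> bounded_ops \<Longrightarrow> T \<in> bounded_ops \<Longrightarrow> adj (S o\<^sub>L T) = (adj T o\<^sub>L adj S)"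
  by (rule blinfun_eqI, rule eq_if_cinner_eq) (simp add: cinner_adj_left compose_in_bounded_ops)

text \<open>The norm of the adjoint is estimated, as the adjoint of \<open>P K\<close>, with \<open>P\<close> the projection onto the span of \<open>G\<close>,
  depends only on the component \<open>p\<close> of a vector in this span. For weakly null \<open>C\<close> the only inner products that
  are not controlled by norms, those of \<open>K\<^sup>* p\<close> and \<open>C\<^sup>* p\<close>, are finite combinations of matrix entries
  that tend to zero.\<close>

lemma finite_rank_perturbation_norm:
  assumes K: "K \<in> bounded_ops" "norm K \<le> k" and C: "C \<in> bounded_ops" "norm C \<le> 2"
    and G: "orthonormal G" "finite G" and s: "0 \<le> s"
  shows "norm ((fproj G o\<^sub>L K) + s *\<^sub>R C)
    \<le> sqrt (k\<^sup>2 + 8 * s\<^sup>2 + 2 * s * (\<Sum>e\<in>G. \<Sum>f\<in>G. cmod (cinner (blinfun_apply C (adj K e)) f)))"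
proof -
  let ?z = "\<Sum>e\<in>G. \<Sum>f\<in>G. cmod (cinner (blinfun_apply C (adj K e)) f)"
  let ?b = "k\<^sup>2 + 8 * s\<^sup>2 + 2 * s * ?z"
  let ?R = "(fproj G o\<^sub>L K) + s *\<^sub>R C"
  let ?L = "adj K"
  have k0: "0 \<le> k" using K(2) norm_ge_zero order_trans by blast
  have Lb: "?L \<in> bounded_ops" using K by (simp add: adj_in_bounded_ops)
  have z0: "0 \<le> ?z" by (intro sum_nonneg norm_ge_zero)
  have Rb: "?R \<in> bounded_ops"
    by (intro add_in_bounded_ops compose_in_bounded_ops fproj_in_bounded_ops scaleR_in_bounded_ops K C)
  have adjR: "(adj ?R) w = blinfun_apply ?L (fproj G w) + s *\<^sub>R (adj C) w" for w
    using K C by (simp add: adj_add adj_scaleR adj_compose compose_in_bounded_ops fproj_in_bounded_ops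
        scaleR_in_bounded_ops adj_fproj blinfun.add_left blinfun.scaleR_left)
  have "norm (adj ?R) \<le> sqrt ?b"
  proof (rule norm_blinfun_le_if_unit_ball)
    fix w :: 'a assume w: "norm w \<le> 1"
    define p where "p = fproj G w"
    define q where "q = w - p"
    have wpq: "w = p + q" by (simp add: q_def)
    have "(norm w)\<^sup>2 \<le> 1" using w by (simp add: power_le_one)
    then have pq: "(norm p)\<^sup>2 + (norm q)\<^sup>2 \<le> 1"
      using fproj_Pythagoras[OF G, of w] by (simp add: p_def q_def)
    have nL: "norm (blinfun_apply ?L p) \<le> k * norm p"
      using norm_blinfun[of ?L p] mult_right_mono[of "norm ?L" k "norm p"] K by (simp add: norm_adj)
    have nC: "norm (adj C v) \<le> 2 * norm v" for v
      using norm_blinfun[of "adj C" v] mult_right_mono[of "norm (adj C)" 2 "norm v"] C by (simp add: norm_adj)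
    have pp: "Re (cinner (blinfun_apply ?L p) (adj C p)) \<le> ?z"
    proof -
      have c1: "cmod (cinner w e) \<le> 1" if "e \<in> G" for e
        using cinner_Cauchy_Schwarz[of w e] w G that by (simp add: orthonormal_def)
      have "C (blinfun_apply ?L p)
          = (\<Sum>e\<in>G. cinner w e *\<^sub>C C (blinfun_apply ?L e))"
        by (simp add: p_def fproj_apply blinfun.sum_right bounded_ops_scaleC[OF Lb] bounded_ops_scaleC[OF C(1)])
      then have "cinner (C (blinfun_apply ?L p)) p
          = (\<Sum>e\<in>G. \<Sum>f\<in>G. cinner w e * cnj (cinner w f) * cinner (C (blinfun_apply ?L e)) f)"
        by (simp add: p_def fproj_apply cinner_sum_left cinner_sum_right cinner_scaleC_left cinner_scaleC_right
            sum_distrib_left mult.assoc, subst sum.swap, simp add: mult_ac)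
      also have "cmod \<dots> \<le> ?z"
      proof (intro sum_norm_le)
        fix e f assume ef: "e \<in> G" "f \<in> G"
        have "cmod (cinner w e) * cmod (cinner w f) \<le> 1 * 1"
          by (intro mult_mono c1 ef) auto
        then have "(cmod (cinner w e) * cmod (cinner w f)) * cmod (cinner (C (blinfun_apply ?L e)) f)
            \<le> 1 * cmod (cinner (C (blinfun_apply ?L e)) f)"
          by (intro mult_right_mono) auto
        then show "cmod (cinner w e * cnj (cinner w f) * cinner (C (blinfun_apply ?L e)) f)
            \<le> cmod (cinner (C (blinfun_apply ?L e)) f)"
          by (simp add: norm_mult)
      qed
      finally show ?thesis
        unfolding cinner_adj_right[OF C(1)] using complex_Re_le_cmod order_trans by blast
    qed
    have pq': "Re (cinner (blinfun_apply ?L p) (adj C q)) \<le> k * norm p * (2 * norm q)"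
      by (rule order_trans[OF complex_Re_le_cmod], rule order_trans[OF cinner_Cauchy_Schwarz])
        (intro mult_mono nL nC mult_nonneg_nonneg k0 norm_ge_zero)
    have "(norm ((adj ?R) w))\<^sup>2
        = (norm (blinfun_apply ?L p))\<^sup>2 + 2 * s * Re (cinner (blinfun_apply ?L p) (adj C w))
          + s\<^sup>2 * (norm (adj C w))\<^sup>2"
      unfolding adjR p_def[symmetric]
      by (simp add: power2_norm_eq_inner inner_add inner_commute power2_eq_square[of s] flip: inner_eq_Re_cinner)
    also have "\<dots> \<le> (k * norm p)\<^sup>2 + 2 * s * (?z + k * norm p * (2 * norm q)) + s\<^sup>2 * 4"
    proof (intro add_mono mult_left_mono power_mono nL)
      show "Re (cinner (blinfun_apply ?L p) (adj C w)) \<le> ?z + k * norm p * (2 * norm q)"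
        using pp pq' by (simp add: wpq blinfun.add_right cinner_add_right)
      have "norm (adj C w) \<le> 2" using nC[of w] w by simp
      from power_mono[OF this norm_ge_zero, of 2] show "(norm (adj C w))\<^sup>2 \<le> 4" by simp
    qed (use s in auto)
    also have "\<dots> \<le> ?b" by (rule quadratic_estimate[OF pq norm_ge_zero norm_ge_zero k0 s])
    finally show "norm ((adj ?R) w) \<le> sqrt ?b" by (rule real_le_rsqrt)
  next
    show "0 \<le> sqrt ?b" by (intro real_sqrt_ge_zero add_nonneg_nonneg mult_nonneg_nonneg z0) (use s in auto)
  qed
  then show ?thesis by (simp add: norm_adj[OF Rb])
qed

text \<open>This is the estimate for \<open>K\<close> of finite rank, as \<open>K\<close> is within \<open>\<eta>\<close> of such an operator. What matters is
  that the error term is quadratic in \<open>s\<close>.\<close>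

lemma compact_perturbation_norm:
  assumes K: "compact_op K" "norm K \<le> k" and s: "0 \<le> s" and eta: "0 < \<eta>"
    and bd: "\<forall>\<^sub>F C in F. C \<in> bounded_ops \<and> norm C \<le> 2"
    and weak: "\<And>x y. ((\<lambda>C. cinner (blinfun_apply C x) y) \<longlongrightarrow> 0) F"
  shows "\<forall>\<^sub>F C in F. norm (K + s *\<^sub>R C) \<le> sqrt (k\<^sup>2 + 8 * s\<^sup>2 + \<eta>) + \<eta>"
proof -
  have Kb: "K \<in> bounded_ops" using K by (simp add: compact_op_def)
  have "\<forall>\<^sub>F G in finite_subsets_at_top some_onb. dist (fproj G o\<^sub>L K) K < \<eta>"
    by (rule tendstoD[OF fproj_compact_tendsto[OF K(1) is_onb_some_onb] eta])
  then obtain G where G: "finite G" "G \<subseteq> some_onb" "dist (fproj G o\<^sub>L K) K < \<eta>"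
    unfolding eventually_finite_subsets_at_top by blast
  have oG: "orthonormal G" by (rule orthonormal_subset[OF orthonormal_some_onb G(2)])
  let ?z = "\<lambda>C. \<Sum>e\<in>G. \<Sum>f\<in>G. cmod (cinner (blinfun_apply C (adj K e)) f)"
  have "((\<lambda>C. 2 * s * ?z C) \<longlongrightarrow> 2 * s * (\<Sum>e\<in>G. \<Sum>f\<in>G. cmod 0)) F"
    by (intro tendsto_intros weak)
  then have "\<forall>\<^sub>F C in F. 2 * s * ?z C < \<eta>" using eta by (intro order_tendstoD(2)[of _ 0]) simp_all
  with bd show ?thesis
  proof eventually_elim
    case (elim C)
    have "K + s *\<^sub>R C = (K - (fproj G o\<^sub>L K)) + ((fproj G o\<^sub>L K) + s *\<^sub>R C)" by simp
    then have "norm (K + s *\<^sub>R C) \<le> norm (K - (fproj G o\<^sub>L K)) + norm ((fproj G o\<^sub>L K) + s *\<^sub>R C)"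
      by (metis norm_triangle_ineq)
    also have "norm (K - (fproj G o\<^sub>L K)) \<le> \<eta>" using G(3) by (simp add: dist_norm norm_minus_commute)
    also have "norm ((fproj G o\<^sub>L K) + s *\<^sub>R C) \<le> sqrt (k\<^sup>2 + 8 * s\<^sup>2 + 2 * s * ?z C)"
      using elim(1) by (intro finite_rank_perturbation_norm Kb K oG G s) auto
    also have "\<dots> \<le> sqrt (k\<^sup>2 + 8 * s\<^sup>2 + \<eta>)" using elim(2) by simp
    finally show ?case by simp
  qed
qed

lemma almost_norming_vectors:
  fixes D :: "'a :: complex_hilbert_space \<Rightarrow>\<^sub>L 'a"
  assumes "c < norm D" "0 \<le> c"
  obtains x y where "norm x \<le> 1" "norm y \<le> 1" "c < cmod (cinner (D x) y)"
proof -
  obtain x where x: "norm x \<le> 1" "c < norm (D x)"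
    using norm_blinfun_le_if_unit_ball[of D c] assms by fastforce
  define y where "y = (1 / norm (D x)) *\<^sub>R D x"
  have n0: "norm (D x) \<noteq> 0" using x(2) assms(2) by auto
  have "cinner (D x) y = of_real (norm (D x))"
    using n0 by (simp add: y_def cinner_scaleR_right cinner_self power2_eq_square)
  then show thesis
    using x n0 by (intro that[of x y]) (auto simp: y_def)
qed

text \<open>Let \<open>C\<close> run through a bounded weakly null net which also converges to \<open>D\<close> in some topology for which
  the norm of \<open>K + s D\<close> is at most every eventual bound of the norms of \<open>K + s C\<close>. If \<open>D \<noteq> 0\<close>, then choose \<open>K\<close> in \<open>S\<close>
  of the same norm as \<open>D\<close> and almost attaining this norm at the same pair of vectors, with the same
  phase. The norm of \<open>K + s D\<close> is then close to \<open>(1 + s) \<parallel>D\<parallel>\<close>, whereas the previous estimate bounds it by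
  \<open>\<parallel>D\<parallel> + O(s\<^sup>2)\<close>.\<close>

lemma weakly_null_limit_eq_0:
  assumes S: "op_csubspace S" and comp: "\<And>K. K \<in> S \<Longrightarrow> compact_op K"
    and D: "D \<in> weak_star closure_of S"
    and bd: "\<forall>\<^sub>F C in F. C \<in> bounded_ops \<and> norm C \<le> 2"
    and weak: "\<And>x y. ((\<lambda>C. cinner (blinfun_apply C x) y) \<longlongrightarrow> 0) F"
    and lim: "\<And>K s M. K \<in> S \<Longrightarrow> \<forall>\<^sub>F C in F. norm (K + s *\<^sub>R C) \<le> M \<Longrightarrow> norm (K + s *\<^sub>R D) \<le> M"
  shows "D = 0"
proof (rule ccontr)
  assume "D \<noteq> 0"
  define d where "d = norm D"
  have d: "0 < d" using \<open>D \<noteq> 0\<close> by (simp add: d_def)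
  \<comment> \<open>Small enough that \<open>(1 + s)\<^sup>2 d\<^sup>2 > d\<^sup>2 + 8 s\<^sup>2\<close>, that is \<open>2 d\<^sup>2 + s d\<^sup>2 > 8 s\<close>\<close>
  define s where "s = d\<^sup>2 / 8"
  have s: "0 < s" using d by (simp add: s_def)
  have est: "(d - \<delta>) * (1 + s) \<le> sqrt (d\<^sup>2 + 8 * s\<^sup>2 + \<delta>) + \<delta>" if \<delta>: "0 < \<delta>" "\<delta> < d" for \<delta>
  proof -
    obtain x y where xy: "norm x \<le> 1" "norm y \<le> 1" "d - \<delta> < cmod (cinner (D x) y)"
      using almost_norming_vectors[of "d - \<delta>" D] \<delta> unfolding d_def by auto
    have "\<exists>K\<in>S. (d - \<delta>) / d * norm K < cmod (cinner (blinfun_apply K x) y)"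
    proof (rule ccontr)
      assume "\<not> ?thesis"
      then have "cmod (cinner (D x) y) \<le> (d - \<delta>) / d * norm D"
        using \<delta> d by (intro compact_Goldstine[OF S comp D]) (auto simp: not_less)
      then show False using xy(3) d by (simp add: d_def)
    qed
    then obtain K where K: "K \<in> S" "(d - \<delta>) / d * norm K < cmod (cinner (K x) y)" by blast
    have K0: "norm K \<noteq> 0" using K(2) by auto
    obtain u where u: "cmod u = 1" "u * cinner (K x) y = of_real (cmod (cinner (K x) y))"
      using unimodular_rotation by blast
    obtain v where v: "cmod v = 1" "v * cinner (D x) y = of_real (cmod (cinner (D x) y))"
      using unimodular_rotation by blast
    have vv: "v * cnj v = 1" using v(1) complex_norm_square[of v] by simp
    \<comment> \<open>\<open>K\<close> rescaled to the norm \<open>d\<close> and rotated such that \<open>\<langle>K1 x, y\<rangle>\<close> has the phase of \<open>\<langle>D x, y\<rangle>\<close>\<close>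
    define K1 where "K1 = scale_op (cnj v * u * of_real (d / norm K)) K"
    have K1: "K1 \<in> S" "norm K1 = d"
      using K(1) K0 u v d by (auto simp: K1_def op_csubspaceD[OF S] norm_scale_op norm_mult norm_divide)
    have "v * cinner (blinfun_apply K1 x) y = (v * cnj v) * of_real (d / norm K) * (u * cinner (K x) y)"
      by (simp add: K1_def scale_op_apply cinner_scaleC_left mult_ac)
    also have "\<dots> = of_real (d / norm K * cmod (cinner (K x) y))"
      unfolding vv u(2) by simp
    finally have vK: "v * cinner (blinfun_apply K1 x) y = of_real (d / norm K * cmod (cinner (K x) y))" .
    have Kge: "d - \<delta> \<le> d / norm K * cmod (cinner (K x) y)"
      using K(2) K0 d by (simp add: field_simps)
    have "\<forall>\<^sub>F C in F. norm (K1 + s *\<^sub>R C) \<le> sqrt (d\<^sup>2 + 8 * s\<^sup>2 + \<delta>) + \<delta>"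
      using K1 s \<delta> by (intro compact_perturbation_norm comp bd weak) auto
    then have upper: "norm (K1 + s *\<^sub>R D) \<le> sqrt (d\<^sup>2 + 8 * s\<^sup>2 + \<delta>) + \<delta>"
      by (rule lim[OF K1(1)])
    have "(d - \<delta>) * (1 + s) \<le> d / norm K * cmod (cinner (K x) y) + s * cmod (cinner (D x) y)"
      using Kge mult_left_mono[OF less_imp_le[OF xy(3)] less_imp_le[OF s]] by (simp add: algebra_simps)
    also have "\<dots> = Re (v * cinner (blinfun_apply (K1 + s *\<^sub>R D) x) y)"
    proof -
      have "v * cinner (blinfun_apply (K1 + s *\<^sub>R D) x) y
          = v * cinner (blinfun_apply K1 x) y + of_real s * (v * cinner (D x) y)"
        by (simp add: blinfun.add_left blinfun.scaleR_left cinner_add_left cinner_scaleR_left algebra_simps)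
      then show ?thesis unfolding vK v(2) by simp
    qed
    also have "\<dots> \<le> cmod (cinner (blinfun_apply (K1 + s *\<^sub>R D) x) y)"
      by (rule order_trans[OF complex_Re_le_cmod]) (simp add: norm_mult v(1))
    also have "\<dots> \<le> norm (K1 + s *\<^sub>R D) * norm x * norm y" by (rule cmod_cinner_blinfun_le)
    also have "\<dots> \<le> norm (K1 + s *\<^sub>R D) * 1 * 1" by (intro mult_mono xy) auto
    finally show ?thesis using upper by simp
  qed
  have "(d - 0) * (1 + s) \<le> sqrt (d\<^sup>2 + 8 * s\<^sup>2 + 0) + 0"
  proof (rule tendsto_le[of "at_right (0::real)"])
    show "((\<lambda>\<delta>. sqrt (d\<^sup>2 + 8 * s\<^sup>2 + \<delta>) + \<delta>) \<longlongrightarrow> sqrt (d\<^sup>2 + 8 * s\<^sup>2 + 0) + 0) (at_right 0)"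
      by (intro tendsto_intros)
    show "((\<lambda>\<delta>. (d - \<delta>) * (1 + s)) \<longlongrightarrow> (d - 0) * (1 + s)) (at_right 0)"
      by (intro tendsto_intros)
    show "\<forall>\<^sub>F \<delta> in at_right 0. (d - \<delta>) * (1 + s) \<le> sqrt (d\<^sup>2 + 8 * s\<^sup>2 + \<delta>) + \<delta>"
      using d est unfolding eventually_at_right_field by (intro exI[of _ d]) auto
  qed simp
  then have "(d * (1 + s))\<^sup>2 \<le> (sqrt (d\<^sup>2 + 8 * s\<^sup>2))\<^sup>2"
    using d s by (intro power_mono) auto
  then have "(d * (1 + s))\<^sup>2 \<le> d\<^sup>2 + 8 * s\<^sup>2" by simp
  moreover have "(d * (1 + s))\<^sup>2 = d\<^sup>2 + 2 * s * d\<^sup>2 + s\<^sup>2 * d\<^sup>2"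
    by (simp add: power2_eq_square algebra_simps)
  moreover have "2 * s * d\<^sup>2 = 16 * s\<^sup>2" by (simp add: s_def power2_eq_square)
  moreover have "0 < s\<^sup>2 * d\<^sup>2" "0 < s\<^sup>2" using s d by simp_all
  ultimately show False by linarith
qed

section \<open>Norms and limits in dual spaces\<close>

lemma dual_space_memD:
  assumes "\<phi> \<in> dual_space scl nrm X"
  shows "x \<notin> X \<Longrightarrow> \<phi> x = 0" "x \<in> X \<Longrightarrow> y \<in> X \<Longrightarrow> \<phi> (x + y) = \<phi> x + \<phi> y"
    "x \<in> X \<Longrightarrow> \<phi> (scl c x) = c * \<phi> x"
  using assms by (auto simp: dual_space_def)

lemma dual_norm_le:
  assumes "x0 \<in> X" "nrm x0 \<le> 1" and "\<And>x. x \<in> X \<Longrightarrow> nrm x \<le> 1 \<Longrightarrow> cmod (\<phi> x) \<le> K"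
  shows "dual_norm nrm X \<phi> \<le> K"
  unfolding dual_norm_def by (rule cSUP_least) (use assms in auto)

lemma dual_norm_upper:
  assumes \<phi>: "\<phi> \<in> dual_space scl nrm X" and nn: "\<And>x. x \<in> X \<Longrightarrow> 0 \<le> nrm x" and x: "x \<in> X" "nrm x \<le> 1"
  shows "cmod (\<phi> x) \<le> dual_norm nrm X \<phi>"
proof -
  obtain K where K: "\<And>x. x \<in> X \<Longrightarrow> cmod (\<phi> x) \<le> K * nrm x" using \<phi> unfolding dual_space_def by blast
  have "cmod (\<phi> z) \<le> \<bar>K\<bar>" if z: "z \<in> X" "nrm z \<le> 1" for z
  proof -
    have "K * nrm z \<le> \<bar>K\<bar> * nrm z" by (intro mult_right_mono nn z) simp
    also have "\<dots> \<le> \<bar>K\<bar> * 1" by (intro mult_left_mono z) simp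
    finally show ?thesis using K[OF z(1)] by simp
  qed
  then have "bdd_above ((\<lambda>x. cmod (\<phi> x)) ` {x \<in> X. nrm x \<le> 1})"
    by (intro bdd_aboveI[of _ "\<bar>K\<bar>"]) auto
  then show ?thesis unfolding dual_norm_def using x by (intro cSUP_upper) auto
qed

lemma op_dual_norm_bound:
  fixes A :: "('a :: complex_hilbert_space \<Rightarrow>\<^sub>L 'a) set"
  assumes A: "op_csubspace A" and \<phi>: "\<phi> \<in> dual_space scale_op norm A" and a: "a \<in> A"
  shows "cmod (\<phi> a) \<le> dual_norm norm A \<phi> * norm a"
proof (cases "a = 0")
  case True
  have "\<phi> (scale_op 0 a) = 0 * \<phi> a" using dual_space_memD(3)[OF \<phi> a] .
  moreover have "scale_op 0 a = a" using True by (intro blinfun_eqI) (simp add: scale_op_apply)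
  ultimately show ?thesis using True by simp
next
  case False
  let ?b = "scale_op (of_real (1 / norm a)) a"
  have "norm ?b = 1" using False by (simp add: norm_scale_op norm_divide)
  then have "cmod (\<phi> ?b) \<le> dual_norm norm A \<phi>"
    by (intro dual_norm_upper[OF \<phi>]) (auto intro: op_csubspaceD(4)[OF A a])
  moreover have "cmod (\<phi> ?b) = cmod (\<phi> a) / norm a"
    by (simp add: dual_space_memD(3)[OF \<phi> a] norm_mult norm_divide)
  ultimately have "cmod (\<phi> a) / norm a \<le> dual_norm norm A \<phi>" by (simp only:)
  then show ?thesis using False by (simp add: pos_divide_le_eq)
qed

lemma op_dual_norm_nonneg:
  assumes A: "op_csubspace A" and \<phi>: "\<phi> \<in> dual_space scale_op norm A"
  shows "0 \<le> dual_norm norm A \<phi>"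
  by (rule order_trans[OF norm_ge_zero dual_norm_upper[OF \<phi> _ op_csubspaceD(2)[OF A]]]) simp_all

lemma op_dual_norm_le:
  assumes A: "op_csubspace A" and "\<And>a. a \<in> A \<Longrightarrow> norm a \<le> 1 \<Longrightarrow> cmod (\<phi> a) \<le> K"
  shows "dual_norm norm A \<phi> \<le> K"
  by (rule dual_norm_le[of 0]) (use assms op_csubspaceD(2)[OF A] in auto)

lemma closed_subspace_of_dual_sum:
  assumes E: "closed_subspace_of_dual scl nrm X E" and F: "finite \<Psi>" "\<Psi> \<subseteq> E"
  shows "(\<lambda>a. \<Sum>\<psi>\<in>\<Psi>. c \<psi> * \<psi> a) \<in> E"
  using F
proof (induction \<Psi> rule: finite_induct)
  case empty
  have "(\<lambda>a. 0) = (0 :: 'a \<Rightarrow> complex)" by (simp add: fun_eq_iff)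
  then show ?case using E by (simp add: closed_subspace_of_dual_def)
next
  case (insert \<psi> \<Psi>)
  have "(\<lambda>a. \<Sum>\<psi>\<in>insert \<psi> \<Psi>. c \<psi> * \<psi> a) = dual_scale (c \<psi>) \<psi> + (\<lambda>a. \<Sum>\<psi>\<in>\<Psi>. c \<psi> * \<psi> a)"
    using insert by (simp add: fun_eq_iff dual_scale_def)
  then show ?case using E insert by (simp add: closed_subspace_of_dual_def)
qed

lemma dual_space_apply_sum:
  assumes E: "closed_subspace_of_dual scl nrm X E" and \<Phi>: "\<Phi> \<in> dual_space dual_scale nrm' E"
    and F: "finite \<Psi>" "\<Psi> \<subseteq> E"
  shows "\<Phi> (\<lambda>a. \<Sum>\<psi>\<in>\<Psi>. c \<psi> * \<psi> a) = (\<Sum>\<psi>\<in>\<Psi>. c \<psi> * \<Phi> \<psi>)"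
  using F
proof (induction \<Psi> rule: finite_induct)
  case empty
  have "0 \<in> E" using E by (simp add: closed_subspace_of_dual_def)
  then have "\<Phi> (dual_scale 0 0) = 0 * \<Phi> 0" using \<Phi> by (rule dual_space_memD(3)[rotated])
  moreover have "dual_scale 0 0 = (\<lambda>a :: 'a. 0 :: complex)" by (simp add: fun_eq_iff dual_scale_def)
  ultimately show ?case by simp
next
  case (insert \<psi> \<Psi>)
  have eq: "(\<lambda>a. \<Sum>\<psi>\<in>insert \<psi> \<Psi>. c \<psi> * \<psi> a) = dual_scale (c \<psi>) \<psi> + (\<lambda>a. \<Sum>\<psi>\<in>\<Psi>. c \<psi> * \<psi> a)"
    using insert by (simp add: fun_eq_iff dual_scale_def)
  have "dual_scale (c \<psi>) \<psi> \<in> E" using E insert by (simp add: closed_subspace_of_dual_def)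
  moreover have "(\<lambda>a. \<Sum>\<psi>\<in>\<Psi>. c \<psi> * \<psi> a) \<in> E"
    by (rule closed_subspace_of_dual_sum[OF E]) (use insert in auto)
  ultimately show ?case
    unfolding eq using insert dual_space_memD(2,3)[OF \<Phi>] by simp
qed

section \<open>Functionals that are small on a common kernel\<close>

definition real_linear_on :: "'b :: real_vector set \<Rightarrow> ('b \<Rightarrow> real) \<Rightarrow> bool" where
  "real_linear_on Y u \<longleftrightarrow> (\<forall>x\<in>Y. \<forall>y\<in>Y. u (x + y) = u x + u y) \<and> (\<forall>r. \<forall>x\<in>Y. u (r *\<^sub>R x) = r * u x)"

lemma real_linear_on_subset: "real_linear_on Y u \<Longrightarrow> Y' \<subseteq> Y \<Longrightarrow> real_linear_on Y' u"
  unfolding real_linear_on_def by blast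

text \<open>The functional \<open>u - t v\<close> is an extension, by one dimension and with the same bound, of the restriction of \<open>u\<close>
  to the kernel of \<open>v\<close>.\<close>

lemma one_step_correction:
  fixes u v :: "'b :: real_normed_vector \<Rightarrow> real"
  assumes Y: "subspace Y" and u: "real_linear_on Y u" and v: "real_linear_on Y v" and eps: "0 \<le> \<epsilon>"
    and le: "\<And>a. a \<in> Y \<Longrightarrow> v a = 0 \<Longrightarrow> u a \<le> \<epsilon> * norm a"
  obtains t where "\<And>a. a \<in> Y \<Longrightarrow> u a - t * v a \<le> \<epsilon> * norm a"
proof (cases "\<forall>a\<in>Y. v a = 0")
  case True
  then show thesis using le by (intro that[of 0]) simp
next
  case False
  then obtain a0 where a0: "a0 \<in> Y" "v a0 \<noteq> 0" by blast
  note us = u[unfolded real_linear_on_def, THEN conjunct2, rule_format]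
  note vs = v[unfolded real_linear_on_def, THEN conjunct2, rule_format]
  have Ys: "r *\<^sub>R a \<in> Y" if "a \<in> Y" for r a using Y that by (rule subspace_scale)
  obtain t where t: "\<And>a. a \<in> {a \<in> Y. v a = 1} \<Longrightarrow> u a - \<epsilon> * norm a \<le> t"
    "\<And>b. b \<in> {b \<in> Y. v b = -1} \<Longrightarrow> t \<le> \<epsilon> * norm b - u b"
  proof (rule ex_between[of "{a \<in> Y. v a = 1}" "{b \<in> Y. v b = -1}" "\<lambda>a. u a - \<epsilon> * norm a" "\<lambda>b. \<epsilon> * norm b - u b"])
    fix a b assume "a \<in> {a \<in> Y. v a = 1}" "b \<in> {b \<in> Y. v b = -1}"
    then have ab: "a \<in> Y" "b \<in> Y" "v a = 1" "v b = -1" by auto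
    then have "u (a + b) \<le> \<epsilon> * norm (a + b)"
      using v by (intro le subspace_add[OF Y]) (auto simp: real_linear_on_def)
    also have "\<dots> \<le> \<epsilon> * (norm a + norm b)" by (intro mult_left_mono norm_triangle_ineq eps)
    finally show "u a - \<epsilon> * norm a \<le> \<epsilon> * norm b - u b"
      using u ab by (simp add: real_linear_on_def algebra_simps)
  next
    have "(1 / v a0) *\<^sub>R a0 \<in> {a \<in> Y. v a = 1}" using a0 by (auto simp: vs Ys)
    then show "{a \<in> Y. v a = 1} \<noteq> {}" by blast
    have "(- 1 / v a0) *\<^sub>R a0 \<in> {a \<in> Y. v a = - 1}" using a0 by (simp add: vs Ys del: scaleR_minus_left)
    then show "{a \<in> Y. v a = - 1} \<noteq> {}" by blast
  qed (rule that)
  show thesis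
  proof (rule that)
    fix a assume a: "a \<in> Y"
    consider "v a = 0" | "v a > 0" | "v a < 0" by linarith
    then show "u a - t * v a \<le> \<epsilon> * norm a"
    proof cases
      case 1
      then show ?thesis using le[OF a] by simp
    next
      case 2
      have "u ((1 / v a) *\<^sub>R a) - \<epsilon> * norm ((1 / v a) *\<^sub>R a) \<le> t"
        using a 2 by (intro t(1)) (auto simp: vs Ys)
      then show ?thesis using 2 a by (simp add: us field_simps)
    next
      case 3
      have "t \<le> \<epsilon> * norm ((- 1 / v a) *\<^sub>R a) - u ((- 1 / v a) *\<^sub>R a)"
        using a 3 by (intro t(2)) (simp add: vs Ys del: scaleR_minus_left)
      also have "\<dots> = (\<epsilon> * norm a - u a) / (- v a)"
        using 3 a unfolding us[OF a] norm_scaleR by (simp add: field_simps)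
      finally have "t * (- v a) \<le> \<epsilon> * norm a - u a" using 3 by (subst (asm) pos_le_divide_eq) auto
      then show ?thesis by simp
    qed
  qed
qed

lemma finite_correction:
  fixes u :: "'b :: real_normed_vector \<Rightarrow> real" and v :: "'i \<Rightarrow> 'b \<Rightarrow> real"
  assumes "finite I" and "subspace Y" and "real_linear_on Y u" and "\<And>i. i \<in> I \<Longrightarrow> real_linear_on Y (v i)"
    and "0 \<le> \<epsilon>" and "\<And>a. a \<in> Y \<Longrightarrow> (\<And>i. i \<in> I \<Longrightarrow> v i a = 0) \<Longrightarrow> u a \<le> \<epsilon> * norm a"
  shows "\<exists>c. \<forall>a\<in>Y. u a - (\<Sum>i\<in>I. c i * v i a) \<le> \<epsilon> * norm a"
  using assms(1,2,3,4,6)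
proof (induction I arbitrary: Y rule: finite_induct)
  case empty
  then show ?case by simp
next
  case (insert i I)
  note vi = insert.prems(3)[OF insertI1]
  let ?Y = "{a \<in> Y. v i a = 0}"
  have "v i 0 = 0" using vi subspace_0[OF insert.prems(1)] unfolding real_linear_on_def by (metis mult_zero_left scaleR_zero_left)
  then have "subspace ?Y"
    using insert.prems(1) vi unfolding subspace_def real_linear_on_def by simp
  then have "\<exists>c. \<forall>a\<in>?Y. u a - (\<Sum>j\<in>I. c j * v j a) \<le> \<epsilon> * norm a"
  proof (rule insert.IH)
    show "real_linear_on ?Y u" by (rule real_linear_on_subset[OF insert.prems(2)]) auto
    show "real_linear_on ?Y (v j)" if "j \<in> I" for j
      by (rule real_linear_on_subset[OF insert.prems(3)]) (use that in auto)
    show "u a \<le> \<epsilon> * norm a" if "a \<in> ?Y" "\<And>j. j \<in> I \<Longrightarrow> v j a = 0" for a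
      using that by (intro insert.prems(4)) auto
  qed
  then obtain c where c: "\<And>a. a \<in> Y \<Longrightarrow> v i a = 0 \<Longrightarrow> u a - (\<Sum>j\<in>I. c j * v j a) \<le> \<epsilon> * norm a" by blast
  have lin: "real_linear_on Y (\<lambda>a. u a - (\<Sum>j\<in>I. c j * v j a))"
  proof -
    have "(\<Sum>j\<in>I. c j * v j (x + y)) = (\<Sum>j\<in>I. c j * v j x) + (\<Sum>j\<in>I. c j * v j y)" if "x \<in> Y" "y \<in> Y" for x y
      using insert.prems(3) that by (simp add: real_linear_on_def algebra_simps flip: sum.distrib)
    moreover have "(\<Sum>j\<in>I. c j * v j (r *\<^sub>R x)) = r * (\<Sum>j\<in>I. c j * v j x)" if "x \<in> Y" for x r
      using insert.prems(3) that by (simp add: real_linear_on_def sum_distrib_left mult.left_commute)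
    ultimately show ?thesis using insert.prems(2) by (simp add: real_linear_on_def algebra_simps)
  qed
  obtain t where t: "\<And>a. a \<in> Y \<Longrightarrow> u a - (\<Sum>j\<in>I. c j * v j a) - t * v i a \<le> \<epsilon> * norm a"
    by (rule one_step_correction[OF insert.prems(1) lin vi assms(5) c], assumption, assumption, rule that)
  have "(\<Sum>j\<in>insert i I. (c(i := t)) j * v j a) = t * v i a + (\<Sum>j\<in>I. c j * v j a)" for a
    using insert.hyps by (auto intro!: sum.cong)
  then have "\<forall>a\<in>Y. u a - (\<Sum>j\<in>insert i I. (c(i := t)) j * v j a) \<le> \<epsilon> * norm a"
    using t by (simp add: algebra_simps)
  then show ?case by blast
qed

text \<open>This instance of the Hahn--Banach theorem follows from the real case: the common kernel of \<open>\<Psi>\<close> is that of the real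
  and imaginary parts of its elements, a real combination of these is the real part of a complex combination of
  the elements themselves, and a rotation turns the bound for \<open>Re \<xi>\<close> into one for \<open>\<bar>\<xi>\<bar>\<close>.\<close>

lemma finite_correction_complex:
  assumes A: "op_csubspace A" and \<phi>: "\<phi> \<in> dual_space scale_op norm A"
    and \<Psi>: "finite \<Psi>" "\<Psi> \<subseteq> dual_space scale_op norm A" and eps: "0 \<le> \<epsilon>"
    and small: "\<And>a. a \<in> A \<Longrightarrow> norm a \<le> 1 \<Longrightarrow> (\<And>\<psi>. \<psi> \<in> \<Psi> \<Longrightarrow> \<psi> a = 0) \<Longrightarrow> cmod (\<phi> a) \<le> \<epsilon>"
  obtains c where "\<And>a. a \<in> A \<Longrightarrow> cmod (\<phi> a - (\<Sum>\<psi>\<in>\<Psi>. c \<psi> * \<psi> a)) \<le> \<epsilon> * norm a"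
proof -
  define v :: "(('a \<Rightarrow>\<^sub>L 'a) \<Rightarrow> complex) \<times> bool \<Rightarrow> ('a \<Rightarrow>\<^sub>L 'a) \<Rightarrow> real"
    where "v = (\<lambda>i a. if snd i then Re (fst i a) else Im (fst i a))"
  have scaleR: "\<xi> (r *\<^sub>R a) = of_real r * \<xi> a" if "\<xi> \<in> dual_space scale_op norm A" "a \<in> A" for \<xi> r a
    using dual_space_memD(3)[OF that, of "of_real r"] by (simp add: scale_op_simps)
  have lin: "real_linear_on A (\<lambda>a. Re (\<xi> a))" "real_linear_on A (\<lambda>a. Im (\<xi> a))"
    if "\<xi> \<in> dual_space scale_op norm A" for \<xi>
    using that by (simp_all add: real_linear_on_def scaleR dual_space_memD(2)[OF that])
  have "\<exists>c. \<forall>a\<in>A. Re (\<phi> a) - (\<Sum>i\<in>\<Psi> \<times> UNIV. c i * v i a) \<le> \<epsilon> * norm a"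
  proof (rule finite_correction)
    show "finite (\<Psi> \<times> (UNIV :: bool set))" using \<Psi>(1) by simp
    show "subspace A" by (auto simp: subspace_def op_csubspaceD[OF A])
    show "real_linear_on A (v i)" if "i \<in> \<Psi> \<times> UNIV" for i
      using that lin \<Psi>(2) by (cases "snd i") (auto simp: v_def)
    fix a assume a: "a \<in> A" and z: "\<And>i. i \<in> \<Psi> \<times> UNIV \<Longrightarrow> v i a = 0"
    have za: "\<psi> a = 0" if "\<psi> \<in> \<Psi>" for \<psi>
      using z[of "(\<psi>, True)"] z[of "(\<psi>, False)"] that by (simp add: v_def complex_eq_iff)
    show "Re (\<phi> a) \<le> \<epsilon> * norm a"
    proof (cases "a = 0")
      case True
      then show ?thesis using op_dual_norm_bound[OF A \<phi> a] by simp
    next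
      case False
      have "cmod (\<phi> ((1 / norm a) *\<^sub>R a)) \<le> \<epsilon>"
        using False a za \<Psi>(2) by (intro small) (auto simp: scaleR op_csubspaceD(5)[OF A] subset_eq)
      then have "cmod (\<phi> a) \<le> \<epsilon> * norm a"
        using False a by (simp add: scaleR[OF \<phi>] norm_mult norm_divide field_simps)
      then show ?thesis using complex_Re_le_cmod order_trans by blast
    qed
  qed (use eps lin[OF \<phi>] in auto)
  then obtain c where c: "\<And>a. a \<in> A \<Longrightarrow> Re (\<phi> a) - (\<Sum>i\<in>\<Psi> \<times> UNIV. c i * v i a) \<le> \<epsilon> * norm a" by blast
  define d where "d \<psi> = Complex (c (\<psi>, True)) (- c (\<psi>, False))" for \<psi>
  define \<xi> where "\<xi> a = \<phi> a - (\<Sum>\<psi>\<in>\<Psi>. d \<psi> * \<psi> a)" for a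
  have "(\<Sum>i\<in>\<Psi> \<times> UNIV. c i * v i a) = Re (\<Sum>\<psi>\<in>\<Psi>. d \<psi> * \<psi> a)" for a
  proof -
    have "(\<Sum>i\<in>\<Psi> \<times> UNIV. c i * v i a) = (\<Sum>\<psi>\<in>\<Psi>. \<Sum>b\<in>UNIV. c (\<psi>, b) * v (\<psi>, b) a)"
      unfolding sum.cartesian_product by (rule sum.cong) auto
    then show ?thesis by (simp add: UNIV_bool d_def v_def add.commute)
  qed
  then have re: "Re (\<xi> a) \<le> \<epsilon> * norm a" if "a \<in> A" for a
    using c[OF that] by (simp add: \<xi>_def)
  have "cmod (\<xi> a) \<le> \<epsilon> * norm a" if a: "a \<in> A" for a
  proof -
    obtain z where z: "cmod z = 1" "z * \<xi> a = of_real (cmod (\<xi> a))" using unimodular_rotation by blast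
    have "\<xi> (scale_op z a) = z * \<xi> a"
      using \<Psi>(2) a dual_space_memD(3)[OF \<phi> a]
      by (auto simp: \<xi>_def right_diff_distrib sum_distrib_left mult.left_commute dual_space_memD(3) intro!: sum.cong)
    then have "cmod (\<xi> a) = Re (\<xi> (scale_op z a))" using z(2) by simp
    also have "\<dots> \<le> \<epsilon> * norm (scale_op z a)" using a by (intro re op_csubspaceD(4)[OF A])
    finally show ?thesis by (simp add: norm_scale_op z(1))
  qed
  then show thesis using that unfolding \<xi>_def by blast
qed

section \<open>Weak compactness of the unit ball\<close>

text \<open>This is for the unit ball \<open>B\<close> and the map \<open>h\<close> to a space of functions that defines one of the topologies on \<open>B\<close>.
  The refinement is generated by the preimages of the neighbourhoods of a cluster point.\<close>

lemma compact_image_cluster: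
  fixes h :: "'b \<Rightarrow> 'c :: topological_space"
  assumes "compact (h ` B)" and F: "F \<noteq> bot" "F \<le> principal B"
  obtains D F' where "D \<in> B" "F' \<le> F" "F' \<noteq> bot" "(h \<longlongrightarrow> h D) F'"
proof -
  have "filtermap h F \<noteq> bot" using F(1) by (simp add: filtermap_bot_iff)
  moreover have "\<forall>\<^sub>F y in filtermap h F. y \<in> h ` B"
    using F(2) by (auto simp: eventually_filtermap le_principal elim: eventually_mono)
  ultimately obtain D where D: "D \<in> B" "inf (nhds (h D)) (filtermap h F) \<noteq> bot"
    using assms(1) unfolding compact_filter by blast
  let ?F' = "inf F (filtercomap h (nhds (h D)))"
  have "?F' \<noteq> bot"
  proof
    assume "?F' = bot"
    then have "eventually (\<lambda>_. False) ?F'" by simp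
    then obtain P Q where P: "eventually P F" and Q: "eventually Q (filtercomap h (nhds (h D)))"
      and PQ: "\<And>a. P a \<Longrightarrow> Q a \<Longrightarrow> False"
      unfolding eventually_inf by blast
    from Q obtain R where R: "eventually R (nhds (h D))" "\<And>a. R (h a) \<Longrightarrow> Q a"
      unfolding eventually_filtercomap by blast
    have "\<forall>\<^sub>F a in F. \<not> R (h a)" using P by (rule eventually_mono) (use PQ R(2) in blast)
    then have "\<forall>\<^sub>F y in filtermap h F. \<not> R y" by (simp add: eventually_filtermap)
    then have "eventually (\<lambda>_. False) (inf (nhds (h D)) (filtermap h F))"
      unfolding eventually_inf using R(1) by blast
    then show False using D(2) by (simp add: trivial_limit_def)
  qed
  moreover have "(h \<longlongrightarrow> h D) ?F'"
    unfolding filterlim_def by (rule order_trans[OF filtermap_mono[OF inf_le2] filtermap_filtercomap])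
  ultimately show thesis using D(1) by (intro that[of D ?F']) auto
qed

lemma compact_PiE_UNIV:
  fixes C :: "'i \<Rightarrow> 'b :: topological_space set"
  assumes "\<And>i. compact (C i)"
  shows "compact (PiE UNIV C)"
proof -
  have "compactin (product_topology (\<lambda>_. euclidean) UNIV) (PiE UNIV C)"
    unfolding compactin_PiE using assms by simp
  then show ?thesis by (simp add: euclidean_product_topology)
qed

lemma tendsto_coordinate:
  fixes h :: "'b \<Rightarrow> 'i \<Rightarrow> 'c :: topological_space"
  assumes "(h \<longlongrightarrow> l) F"
  shows "((\<lambda>a. h a i) \<longlongrightarrow> l i) F"
proof -
  have "((\<lambda>a. (\<lambda>f. f i) (h a)) \<longlongrightarrow> (\<lambda>f. f i) l) F"
    by (rule continuous_on_tendsto_compose[OF continuous_on_product_coordinates assms]) simp_all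
  then show ?thesis by simp
qed

definition unit_ball :: "('a :: complex_hilbert_space \<Rightarrow>\<^sub>L 'a) set \<Rightarrow> ('a \<Rightarrow>\<^sub>L 'a) set" where
  "unit_ball A = {a \<in> A. norm a \<le> 1}"

definition weak_limit :: "('a :: complex_hilbert_space \<Rightarrow>\<^sub>L 'a) filter \<Rightarrow> ('a \<Rightarrow>\<^sub>L 'a) \<Rightarrow> bool" where
  "weak_limit F C \<longleftrightarrow> (\<forall>x y. ((\<lambda>a. cinner (blinfun_apply a x) y) \<longlongrightarrow> cinner (C x) y) F)"

lemma weak_limit_mono: "weak_limit F C \<Longrightarrow> F' \<le> F \<Longrightarrow> weak_limit F' C"
  unfolding weak_limit_def by (meson tendsto_mono)

text \<open>The matrix entries of the contractions form a closed set of functions on the pairs of vectors, namely all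
  sesquilinear forms of norm at most one, in a product of compact discs.\<close>

lemma bounded_ops_cluster:
  assumes "F \<noteq> bot" "F \<le> principal (unit_ball bounded_ops)"
  obtains D F' where "D \<in> unit_ball bounded_ops" "F' \<le> F" "F' \<noteq> bot" "weak_limit F' D"
proof -
  let ?h = "\<lambda>(a :: 'a \<Rightarrow>\<^sub>L 'a) (p :: 'a \<times> 'a). cinner (blinfun_apply a (fst p)) (snd p)"
  let ?Z = "PiE UNIV (\<lambda>p. cball 0 (norm (fst p) * norm (snd p)))
    \<inter> (\<Inter>x. \<Inter>x'. \<Inter>y. {\<beta>. \<beta> (x + x', y) = \<beta> (x, y) + \<beta> (x', y)})
    \<inter> (\<Inter>x. \<Inter>y. \<Inter>y'. {\<beta>. \<beta> (x, y + y') = \<beta> (x, y) + \<beta> (x, y')})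
    \<inter> (\<Inter>c. \<Inter>x. \<Inter>y. {\<beta>. \<beta> (c *\<^sub>C x, y) = c * \<beta> (x, y)})
    \<inter> (\<Inter>c. \<Inter>x. \<Inter>y. {\<beta>. \<beta> (x, c *\<^sub>C y) = cnj c * \<beta> (x, y)}) :: ('a \<times> 'a \<Rightarrow> complex) set"
  have "compact ?Z"
    by (intro compact_Int_closed compact_PiE_UNIV compact_cball closed_INT ballI closed_Collect_eq
        continuous_on_add continuous_on_mult continuous_on_const continuous_on_product_coordinates)
  moreover have "?h ` unit_ball bounded_ops = ?Z"
  proof (intro equalityI subsetI)
    fix \<beta> assume "\<beta> \<in> ?h ` unit_ball bounded_ops"
    then obtain a :: "'a \<Rightarrow>\<^sub>L 'a" where a: "a \<in> bounded_ops" "norm a \<le> 1" "\<beta> = ?h a" by (auto simp: unit_ball_def)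
    have "cmod (cinner (blinfun_apply a x) y) \<le> norm x * norm y" for x y
      using cmod_cinner_blinfun_le[of a x y] mult_right_mono[OF a(2), of "norm x * norm y"] by (simp add: mult.assoc)
    then show "\<beta> \<in> ?Z"
      by (simp add: a(3) cinner_add_left cinner_add_right cinner_scaleC_left cinner_scaleC_right
          blinfun.add_right bounded_ops_scaleC[OF a(1)] PiE_def)
  next
    fix \<beta> assume Z: "\<beta> \<in> ?Z"
    obtain T where T: "T \<in> bounded_ops" "\<And>x y. cinner (T x) y = \<beta> (x, y)" "norm T \<le> 1"
    proof (rule bounded_ops_of_form[of "\<lambda>x y. \<beta> (x, y)" 1])
      show "cmod (\<beta> (x, y)) \<le> 1 * norm x * norm y" for x y
      proof -
        have "\<beta> (x, y) \<in> cball 0 (norm (fst (x, y)) * norm (snd (x, y)))"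
          using Z by (intro PiE_mem[of \<beta> UNIV]) auto
        then show ?thesis by simp
      qed
    qed (use Z that in auto)
    then show "\<beta> \<in> ?h ` unit_ball bounded_ops"
      by (intro image_eqI[of _ _ T]) (auto simp: unit_ball_def fun_eq_iff)
  qed
  ultimately have "compact (?h ` unit_ball bounded_ops)" by simp
  then obtain D F' where D: "D \<in> unit_ball bounded_ops" "F' \<le> F" "F' \<noteq> bot" "(?h \<longlongrightarrow> ?h D) F'"
    by (rule compact_image_cluster[OF _ assms])
  have "weak_limit F' D"
    unfolding weak_limit_def using tendsto_coordinate[OF D(4), of "(x, y)" for x y] by simp
  with D show thesis by (intro that) auto
qed

text \<open>On the unit ball the trace functional is a uniform limit of sums of vector functionals.\<close>

lemma weak_limit_op_trace:
  assumes F: "F \<le> principal (unit_ball bounded_ops)" and D: "D \<in> unit_ball bounded_ops"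
    and lim: "weak_limit F D" and T: "T \<in> trace_class"
  shows "((\<lambda>a. op_trace (a o\<^sub>L T)) \<longlongrightarrow> op_trace (D o\<^sub>L T)) F"
proof (rule tendstoI)
  fix \<epsilon> :: real assume eps: "0 < \<epsilon>"
  obtain G where G: "finite G" "\<And>a. a \<in> bounded_ops \<Longrightarrow>
      cmod (op_trace (a o\<^sub>L T) - (\<Sum>e\<in>G. cinner (blinfun_apply a (T e)) e)) \<le> \<epsilon> / 4 * norm a"
    by (rule trace_class_uniform_tail[OF T, of "\<epsilon> / 4"]) (use eps in simp, rule that)
  let ?s = "\<lambda>a. \<Sum>e\<in>G. cinner (blinfun_apply a (T e)) e"
  have near: "cmod (op_trace (a o\<^sub>L T) - ?s a) \<le> \<epsilon> / 4" if "a \<in> unit_ball bounded_ops" for a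
  proof -
    have "\<epsilon> / 4 * norm a \<le> \<epsilon> / 4 * 1" using that eps by (intro mult_left_mono) (auto simp: unit_ball_def)
    then show ?thesis using G(2)[of a] that by (simp add: unit_ball_def)
  qed
  have "(?s \<longlongrightarrow> ?s D) F" using lim unfolding weak_limit_def by (intro tendsto_sum) blast
  then have "\<forall>\<^sub>F a in F. dist (?s a) (?s D) < \<epsilon> / 4" by (rule tendstoD) (use eps in simp)
  moreover have "\<forall>\<^sub>F a in F. a \<in> unit_ball bounded_ops" using F by (simp add: le_principal)
  ultimately show "\<forall>\<^sub>F a in F. dist (op_trace (a o\<^sub>L T)) (op_trace (D o\<^sub>L T)) < \<epsilon>"
  proof eventually_elim
    case (elim a)
    have "op_trace (a o\<^sub>L T) - op_trace (D o\<^sub>L T)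
        = (op_trace (a o\<^sub>L T) - ?s a) + (?s a - ?s D) - (op_trace (D o\<^sub>L T) - ?s D)" by simp
    then have "cmod (op_trace (a o\<^sub>L T) - op_trace (D o\<^sub>L T))
        \<le> cmod (op_trace (a o\<^sub>L T) - ?s a) + cmod (?s a - ?s D) + cmod (op_trace (D o\<^sub>L T) - ?s D)"
      by (rule ssubst) (intro order_trans[OF norm_triangle_ineq4] add_right_mono norm_triangle_ineq)
    then show ?case using near[OF elim(2)] near[OF D] elim(1) eps by (simp add: dist_norm)
  qed
qed

lemma weak_star_closed_imp_bounded_weakly_closed:
  assumes A: "closedin weak_star A" and F: "F \<noteq> bot" "F \<le> principal (unit_ball A)"
    and D: "D \<in> unit_ball bounded_ops" and lim: "weak_limit F D"
  shows "D \<in> A"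
proof (rule limitin_closedin)
  have "A \<subseteq> bounded_ops" using closedin_subset[OF A] by (simp add: topspace_weak_star)
  then have Fb: "F \<le> principal (unit_ball bounded_ops)"
    using F(2) by (auto simp: unit_ball_def intro: order_trans)
  let ?f = "\<lambda>a. \<lambda>T\<in>trace_class. op_trace (a o\<^sub>L T)"
  have lf: "limitin (product_topology (\<lambda>_. euclidean) trace_class) ?f (?f D) F"
    unfolding limitin_componentwise by (auto intro!: weak_limit_op_trace[OF Fb D lim])
  show "limitin weak_star (\<lambda>a. a) D F"
    unfolding limitin_def
  proof (intro conjI allI impI)
    show "D \<in> topspace weak_star" using D by (simp add: topspace_weak_star unit_ball_def)
    fix U :: "('a \<Rightarrow>\<^sub>L 'a) set" assume "openin weak_star U \<and> D \<in> U"
    then obtain V where V: "openin (product_topology (\<lambda>_. euclidean) trace_class) V" "U = ?f -` V \<inter> bounded_ops" "?f D \<in> V"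
      unfolding weak_star_def openin_pullback_topology by blast
    have "\<forall>\<^sub>F a in F. ?f a \<in> V" by (rule limitinD[OF lf V(1,3)])
    moreover have "\<forall>\<^sub>F a in F. a \<in> unit_ball bounded_ops" using Fb by (simp add: le_principal)
    ultimately show "\<forall>\<^sub>F a in F. a \<in> U"
      by eventually_elim (simp add: V(2) unit_ball_def)
  qed
  show "\<forall>\<^sub>F a in F. a \<in> A"
    using F(2) by (auto simp: le_principal unit_ball_def elim: eventually_mono)
qed (use A F in auto)

lemma weak_star_closed_cluster:
  assumes A: "closedin weak_star A" and F: "F \<noteq> bot" "F \<le> principal (unit_ball A)"
  obtains D F' where "D \<in> unit_ball A" "F' \<le> F" "F' \<noteq> bot" "weak_limit F' D"
proof -
  have "A \<subseteq> bounded_ops" using closedin_subset[OF A] by (simp add: topspace_weak_star)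
  then have Fb: "F \<le> principal (unit_ball bounded_ops)"
    using F(2) by (auto simp: unit_ball_def intro: order_trans)
  obtain D F' where D: "D \<in> unit_ball bounded_ops" "F' \<le> F" "F' \<noteq> bot" "weak_limit F' D"
    by (rule bounded_ops_cluster[OF F(1) Fb])
  have "D \<in> A"
    by (rule weak_star_closed_imp_bounded_weakly_closed[OF A D(3) order_trans[OF D(2) F(2)] D(1,4)])
  then show thesis using D by (intro that) (auto simp: unit_ball_def)
qed

section \<open>The canonical predual\<close>

text \<open>The filter condition is continuity on the unit ball for the weak operator topology.\<close>

definition weak_predual :: "('a :: complex_hilbert_space \<Rightarrow>\<^sub>L 'a) set \<Rightarrow> (('a \<Rightarrow>\<^sub>L 'a) \<Rightarrow> complex) set" where
  "weak_predual A = {\<phi> \<in> dual_space scale_op norm A.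
     \<forall>C\<in>unit_ball A. \<forall>F. F \<le> principal (unit_ball A) \<longrightarrow> weak_limit F C \<longrightarrow> (\<phi> \<longlongrightarrow> \<phi> C) F}"

lemma dual_space_boundE:
  assumes "\<phi> \<in> dual_space scl nrm X"
  obtains K where "\<And>x. x \<in> X \<Longrightarrow> cmod (\<phi> x) \<le> K * nrm x"
  using assms unfolding dual_space_def by blast

lemma dual_space_add:
  assumes "\<phi> \<in> dual_space scl nrm X" "\<psi> \<in> dual_space scl nrm X"
    and "\<And>x y. x \<in> X \<Longrightarrow> y \<in> X \<Longrightarrow> x + y \<in> X" "\<And>c x. x \<in> X \<Longrightarrow> scl c x \<in> X"
  shows "\<phi> + \<psi> \<in> dual_space scl nrm X"
proof -
  obtain K where K: "\<And>x. x \<in> X \<Longrightarrow> cmod (\<phi> x) \<le> K * nrm x" by (rule dual_space_boundE[OF assms(1)], rule that)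
  obtain L where L: "\<And>x. x \<in> X \<Longrightarrow> cmod (\<psi> x) \<le> L * nrm x" by (rule dual_space_boundE[OF assms(2)], rule that)
  have "cmod ((\<phi> + \<psi>) x) \<le> (K + L) * nrm x" if "x \<in> X" for x
    using norm_triangle_ineq[of "\<phi> x" "\<psi> x"] K[OF that] L[OF that] by (simp add: distrib_right)
  then have "\<exists>K. \<forall>x\<in>X. cmod ((\<phi> + \<psi>) x) \<le> K * nrm x" by blast
  then show ?thesis
    using assms unfolding dual_space_def by (simp add: algebra_simps)
qed

lemma dual_space_scale:
  assumes "\<phi> \<in> dual_space scl nrm X"
  shows "dual_scale c \<phi> \<in> dual_space scl nrm X"
proof -
  obtain K where K: "\<And>x. x \<in> X \<Longrightarrow> cmod (\<phi> x) \<le> K * nrm x" by (rule dual_space_boundE[OF assms], rule that)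
  have "cmod (dual_scale c \<phi> x) \<le> (cmod c * K) * nrm x" if "x \<in> X" for x
    using mult_left_mono[OF K[OF that] norm_ge_zero[of c]] by (simp add: dual_scale_def norm_mult mult.assoc)
  then have "\<exists>K. \<forall>x\<in>X. cmod (dual_scale c \<phi> x) \<le> K * nrm x" by blast
  then show ?thesis
    using assms unfolding dual_space_def dual_scale_def by (simp add: algebra_simps)
qed

lemma dual_space_zero: "0 \<in> dual_space scl nrm X"
  unfolding dual_space_def by (auto intro!: exI[of _ 0])

lemma dual_space_diff:
  assumes "\<phi> \<in> dual_space scl nrm X" "\<psi> \<in> dual_space scl nrm X"
    and "\<And>x y. x \<in> X \<Longrightarrow> y \<in> X \<Longrightarrow> x + y \<in> X" "\<And>c x. x \<in> X \<Longrightarrow> scl c x \<in> X"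
  shows "\<phi> - \<psi> \<in> dual_space scl nrm X"
proof -
  have eq: "\<phi> - \<psi> = \<phi> + dual_scale (- 1) \<psi>" by (simp add: fun_eq_iff dual_scale_def)
  show ?thesis unfolding eq by (rule dual_space_add[OF assms(1) dual_space_scale[OF assms(2)] assms(3,4)])
qed

lemma closed_subspace_weak_predual:
  assumes A: "op_csubspace A"
  shows "closed_subspace_of_dual scale_op norm A (weak_predual A)"
proof -
  have A': "x + y \<in> A" "scale_op c x \<in> A" if "x \<in> A" "y \<in> A" for x y c
    using op_csubspaceD[OF A] that by auto
  have add: "\<phi> + \<psi> \<in> weak_predual A" if "\<phi> \<in> weak_predual A" "\<psi> \<in> weak_predual A" for \<phi> \<psi>
    using that dual_space_add[of \<phi> scale_op norm A \<psi>] A'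
    by (auto simp: weak_predual_def plus_fun_def intro!: tendsto_add)
  have scale: "dual_scale c \<phi> \<in> weak_predual A" if "\<phi> \<in> weak_predual A" for \<phi> c
    using that dual_space_scale[of \<phi> scale_op norm A c]
    by (auto simp: weak_predual_def dual_scale_def intro!: tendsto_mult tendsto_const)
  have zero: "0 \<in> weak_predual A"
    using dual_space_zero[of scale_op norm A] by (auto simp: weak_predual_def zero_fun_def)
  have closed: "\<phi> \<in> weak_predual A" if \<phi>: "\<phi> \<in> dual_space scale_op norm A"
    and approx: "\<And>\<epsilon>. 0 < \<epsilon> \<Longrightarrow> \<exists>\<psi>\<in>weak_predual A. dual_norm norm A (\<phi> - \<psi>) < \<epsilon>" for \<phi>
    unfolding weak_predual_def
  proof (intro CollectI conjI ballI allI impI \<phi> tendstoI)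
    fix C F \<epsilon> assume C: "C \<in> unit_ball A" and F: "F \<le> principal (unit_ball A)" and lim: "weak_limit F C"
      and eps: "0 < (\<epsilon> :: real)"
    obtain \<psi> where \<psi>: "\<psi> \<in> weak_predual A" "dual_norm norm A (\<phi> - \<psi>) < \<epsilon> / 3"
      using approx[of "\<epsilon> / 3"] eps by auto
    have "\<phi> - \<psi> \<in> dual_space scale_op norm A"
      using \<phi> \<psi>(1) A' by (intro dual_space_diff) (auto simp: weak_predual_def)
    then have near: "cmod (\<phi> a - \<psi> a) < \<epsilon> / 3" if "a \<in> unit_ball A" for a
      using dual_norm_upper[of "\<phi> - \<psi>" scale_op norm A a] that \<psi>(2) by (simp add: unit_ball_def)
    have "(\<psi> \<longlongrightarrow> \<psi> C) F" using \<psi>(1) C F lim unfolding weak_predual_def by blast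
    then have "\<forall>\<^sub>F a in F. dist (\<psi> a) (\<psi> C) < \<epsilon> / 3" by (rule tendstoD) (use eps in simp)
    moreover have "\<forall>\<^sub>F a in F. a \<in> unit_ball A" using F by (simp add: le_principal)
    ultimately show "\<forall>\<^sub>F a in F. dist (\<phi> a) (\<phi> C) < \<epsilon>"
    proof eventually_elim
      case (elim a)
      have "\<phi> a - \<phi> C = (\<phi> a - \<psi> a) + (\<psi> a - \<psi> C) - (\<phi> C - \<psi> C)" by simp
      then have "cmod (\<phi> a - \<phi> C) \<le> cmod (\<phi> a - \<psi> a) + cmod (\<psi> a - \<psi> C) + cmod (\<phi> C - \<psi> C)"
        by (rule ssubst) (intro order_trans[OF norm_triangle_ineq4] add_right_mono norm_triangle_ineq)
      then show ?case using near[OF elim(2)] near[OF C] elim(1) by (simp add: dist_norm)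
    qed
  qed
  show ?thesis
    unfolding closed_subspace_of_dual_def
    using add scale zero closed by (auto simp: weak_predual_def)
qed

definition vector_functional ::
    "('a :: complex_hilbert_space \<Rightarrow>\<^sub>L 'a) set \<Rightarrow> 'a \<Rightarrow> 'a \<Rightarrow> ('a \<Rightarrow>\<^sub>L 'a) \<Rightarrow> complex" where
  "vector_functional A x y = (\<lambda>a. if a \<in> A then cinner (blinfun_apply a x) y else 0)"

lemma vector_functional_weak_predual:
  assumes A: "op_csubspace A"
  shows "vector_functional A x y \<in> weak_predual A"
  unfolding weak_predual_def
proof (intro CollectI conjI ballI allI impI)
  have "\<exists>K. \<forall>a\<in>A. cmod (vector_functional A x y a) \<le> K * norm a"
    using cmod_cinner_blinfun_le[of _ x y]
    by (intro exI[of _ "norm x * norm y"]) (auto simp: vector_functional_def mult_ac)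
  then show "vector_functional A x y \<in> dual_space scale_op norm A"
    by (simp add: dual_space_def vector_functional_def op_csubspaceD[OF A] blinfun.add_left cinner_add_left
        scale_op_apply cinner_scaleC_left)
  fix C F assume C: "C \<in> unit_ball A" and F: "F \<le> principal (unit_ball A)" and lim: "weak_limit F C"
  have "\<forall>\<^sub>F a in F. cinner (blinfun_apply a x) y = vector_functional A x y a"
    using F by (auto simp: le_principal vector_functional_def unit_ball_def elim: eventually_mono)
  moreover have "((\<lambda>a. cinner (blinfun_apply a x) y) \<longlongrightarrow> vector_functional A x y C) F"
    using lim C by (simp add: weak_limit_def vector_functional_def unit_ball_def)
  ultimately show "(vector_functional A x y \<longlongrightarrow> vector_functional A x y C) F"
    by (rule Lim_transform_eventually[rotated])
qed

lemma dual_norm_vector_functional_le: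
  assumes A: "op_csubspace A" and xy: "norm x \<le> 1" "norm y \<le> 1"
  shows "dual_norm norm A (vector_functional A x y) \<le> 1"
proof (rule op_dual_norm_le[OF A])
  fix a assume a: "a \<in> A" "norm a \<le> 1"
  have "norm a * norm x * norm y \<le> 1 * 1 * 1" by (intro mult_mono a xy) auto
  then show "cmod (vector_functional A x y a) \<le> 1"
    using cmod_cinner_blinfun_le[of a x y] a by (simp add: vector_functional_def)
qed

text \<open>The vector functionals of unit vectors already give the norm.\<close>

lemma canonical_map_isometric:
  assumes A: "op_csubspace A" and a: "a \<in> A"
  shows "dual_norm (dual_norm norm A) (weak_predual A) (canonical_map (weak_predual A) a) = norm a"
proof (rule antisym)
  let ?E = "weak_predual A" and ?dn = "dual_norm norm A"
  have E: "closed_subspace_of_dual scale_op norm A ?E" by (rule closed_subspace_weak_predual[OF A])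
  have ED: "\<phi> \<in> dual_space scale_op norm A" if "\<phi> \<in> ?E" for \<phi> using that by (simp add: weak_predual_def)
  have zero: "0 \<in> ?E" using E by (simp add: closed_subspace_of_dual_def)
  have zero': "?dn 0 \<le> 1" by (rule op_dual_norm_le[OF A]) simp
  have bound: "cmod (canonical_map ?E a \<phi>) \<le> ?dn \<phi> * norm a" if "\<phi> \<in> ?E" for \<phi>
    using op_dual_norm_bound[OF A ED[OF that] a] that by (simp add: canonical_map_def)
  show "dual_norm ?dn ?E (canonical_map ?E a) \<le> norm a"
  proof (rule dual_norm_le[where nrm = ?dn, OF zero zero'])
    fix \<phi> assume "\<phi> \<in> ?E" "?dn \<phi> \<le> 1"
    then show "cmod (canonical_map ?E a \<phi>) \<le> norm a"
      using bound[of \<phi>] mult_right_mono[of "?dn \<phi>" 1 "norm a"] by simp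
  qed
  have mem: "canonical_map ?E a \<in> dual_space dual_scale ?dn ?E"
  proof -
    have "\<exists>K. \<forall>\<phi>\<in>?E. cmod (canonical_map ?E a \<phi>) \<le> K * ?dn \<phi>"
      using bound by (intro exI[of _ "norm a"]) (simp add: mult.commute)
    then show ?thesis
      using E unfolding dual_space_def closed_subspace_of_dual_def by (simp add: canonical_map_def dual_scale_def)
  qed
  have upper: "cmod (canonical_map ?E a \<phi>) \<le> dual_norm ?dn ?E (canonical_map ?E a)"
    if "\<phi> \<in> ?E" "?dn \<phi> \<le> 1" for \<phi>
    by (rule dual_norm_upper[where nrm = ?dn, OF mem _ that]) (simp add: op_dual_norm_nonneg[OF A ED])
  show "norm a \<le> dual_norm ?dn ?E (canonical_map ?E a)"
  proof (rule ccontr)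
    assume "\<not> ?thesis"
    moreover have "0 \<le> dual_norm ?dn ?E (canonical_map ?E a)"
      by (rule order_trans[OF norm_ge_zero upper[OF zero zero']])
    ultimately obtain x y where xy: "norm x \<le> 1" "norm y \<le> 1"
      "dual_norm ?dn ?E (canonical_map ?E a) < cmod (cinner (blinfun_apply a x) y)"
      using almost_norming_vectors[of "dual_norm ?dn ?E (canonical_map ?E a)" a] by (auto simp: not_le)
    have "cmod (cinner (blinfun_apply a x) y) \<le> dual_norm ?dn ?E (canonical_map ?E a)"
      using upper[OF vector_functional_weak_predual[OF A, of x y] dual_norm_vector_functional_le[OF A xy(1,2)]]
      by (simp add: canonical_map_def vector_functional_weak_predual[OF A])
        (simp add: vector_functional_def a)
    then show False using xy(3) by simp
  qed
qed

lemma weak_predualD: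
  assumes "\<phi> \<in> weak_predual A"
  shows weak_predual_dual_space: "\<phi> \<in> dual_space scale_op norm A"
    and weak_predual_tendsto: "C \<in> unit_ball A \<Longrightarrow> F \<le> principal (unit_ball A) \<Longrightarrow> weak_limit F C \<Longrightarrow> (\<phi> \<longlongrightarrow> \<phi> C) F"
  using assms unfolding weak_predual_def by blast+

lemma nonneg_if_quadratic_nonneg:
  fixes b q :: real
  assumes "\<And>t. 0 < t \<Longrightarrow> t < 1 \<Longrightarrow> 0 \<le> t * b + t\<^sup>2 * q"
  shows "0 \<le> b"
proof -
  have "0 \<le> b + t * q" if "0 < t" "t < 1" for t
  proof -
    have "t * b + t\<^sup>2 * q = t * (b + t * q)" by (simp add: power2_eq_square algebra_simps)
    then show ?thesis using assms[OF that] that by (simp add: zero_le_mult_iff)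
  qed
  then have ev: "\<forall>\<^sub>F t in at_right 0. 0 \<le> b + t * q"
    unfolding eventually_at_right_field by (intro exI[of _ 1]) auto
  have "((\<lambda>t. b + t * q) \<longlongrightarrow> b + 0 * q) (at_right 0)" by (intro tendsto_intros)
  then have "0 \<le> b + 0 * q" using ev by (rule tendsto_lowerbound) simp
  then show ?thesis by simp
qed

lemma cmod_sq_add_scaled:
  "(cmod (u + of_real t * w))\<^sup>2 = (cmod u)\<^sup>2 + t * (2 * Re (cnj u * w)) + t\<^sup>2 * (cmod w)\<^sup>2"
  by (simp only: cmod_power2) (simp add: power2_eq_square algebra_simps)

text \<open>By compactness, some \<open>C\<close> in the ball minimizes the squared distance of the two families of values. The
  first order condition at \<open>C\<close> says that a certain element \<open>\<xi>\<close> of the predual has norm \<open>Re (\<xi> C)\<close>, and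
  comparing with the norm bound for \<open>\<Phi> \<xi>\<close> gives distance zero.\<close>

lemma finite_interpolation:
  assumes A: "op_csubspace A" and cl: "closedin weak_star A"
    and \<Phi>: "\<Phi> \<in> dual_space dual_scale (dual_norm norm A) (weak_predual A)"
    and bd: "\<And>\<phi>. \<phi> \<in> weak_predual A \<Longrightarrow> cmod (\<Phi> \<phi>) \<le> dual_norm norm A \<phi>"
    and \<Psi>: "finite \<Psi>" "\<Psi> \<subseteq> weak_predual A"
  shows "\<exists>a\<in>unit_ball A. \<forall>\<psi>\<in>\<Psi>. \<psi> a = \<Phi> \<psi>"
proof -
  let ?E = "weak_predual A" and ?B = "unit_ball A"
  have E: "closed_subspace_of_dual scale_op norm A ?E" by (rule closed_subspace_weak_predual[OF A])
  define g where "g a = (\<Sum>\<psi>\<in>\<Psi>. (cmod (\<psi> a - \<Phi> \<psi>))\<^sup>2)" for a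
  define m where "m = Inf (g ` ?B)"
  have zB: "0 \<in> ?B" by (simp add: unit_ball_def op_csubspaceD[OF A])
  have bdd: "bdd_below (g ` ?B)" by (intro bdd_belowI[of _ 0]) (auto simp: g_def intro: sum_nonneg)
  have m: "m \<le> g a" if "a \<in> ?B" for a
    unfolding m_def using bdd that by (auto intro: cInf_lower)
  have "\<exists>a\<in>?B. g a < m + 1 / real (Suc n)" for n
    using cInf_lessD[of "g ` ?B" "m + 1 / real (Suc n)"] zB unfolding m_def by auto
  then obtain s where s: "\<And>n. s n \<in> ?B" "\<And>n. g (s n) < m + 1 / real (Suc n)" by metis
  define F where "F = filtermap s sequentially"
  have "F \<noteq> bot" by (simp add: F_def filtermap_bot_iff)
  moreover have FB: "F \<le> principal ?B" using s(1) by (simp add: F_def le_principal eventually_filtermap)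
  ultimately obtain C F' where C: "C \<in> ?B" "F' \<le> F" "F' \<noteq> bot" "weak_limit F' C"
    by (rule weak_star_closed_cluster[OF cl])
  have gC: "(g \<longlongrightarrow> g C) F'"
    unfolding g_def
  proof (intro tendsto_sum tendsto_power tendsto_norm tendsto_diff tendsto_const)
    fix \<psi> assume "\<psi> \<in> \<Psi>"
    then show "(\<psi> \<longlongrightarrow> \<psi> C) F'" using \<Psi>(2) C FB by (intro weak_predual_tendsto[of \<psi> A]) auto
  qed
  have gm: "(g \<longlongrightarrow> m) F"
    unfolding F_def filterlim_filtermap
  proof (rule tendsto_sandwich[of "\<lambda>_. m"])
    show "(\<lambda>n. m + 1 / real (Suc n)) \<longlonglongrightarrow> m"
      using tendsto_add[OF tendsto_const LIMSEQ_Suc[OF lim_1_over_n]] by fastforce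
    show "\<forall>\<^sub>F n in sequentially. m \<le> g (s n)" using m s(1) by simp
    show "\<forall>\<^sub>F n in sequentially. g (s n) \<le> m + 1 / real (Suc n)"
      using s(2) by (intro always_eventually allI less_imp_le)
  qed simp
  have "g C = m" by (rule tendsto_unique[OF C(3) gC tendsto_mono[OF C(2) gm]])
  then have min: "g C \<le> g a" if "a \<in> ?B" for a using m that by simp
  have CA: "C \<in> A" "norm C \<le> 1" using C(1) by (auto simp: unit_ball_def)
  define c where "c \<psi> = cnj (\<Phi> \<psi> - \<psi> C)" for \<psi>
  define \<xi> where "\<xi> = (\<lambda>a. \<Sum>\<psi>\<in>\<Psi>. c \<psi> * \<psi> a)"
  have \<xi>E: "\<xi> \<in> ?E" unfolding \<xi>_def by (rule closed_subspace_of_dual_sum[OF E \<Psi>])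
  have \<xi>D: "\<xi> \<in> dual_space scale_op norm A" by (rule weak_predual_dual_space[OF \<xi>E])
  have var: "Re (\<xi> a) \<le> Re (\<xi> C)" if a: "a \<in> ?B" for a
  proof -
    have aA: "a \<in> A" "norm a \<le> 1" using a by (auto simp: unit_ball_def)
    have "0 \<le> - 2 * (Re (\<xi> a) - Re (\<xi> C))"
    proof (rule nonneg_if_quadratic_nonneg)
      fix t :: real assume t: "0 < t" "t < 1"
      define b where "b = C + t *\<^sub>R (a - C)"
      have b': "b = (1 - t) *\<^sub>R C + t *\<^sub>R a" by (simp add: b_def algebra_simps)
      have "norm b \<le> (1 - t) * norm C + t * norm a"
        unfolding b' using norm_triangle_ineq[of "(1 - t) *\<^sub>R C" "t *\<^sub>R a"] t by simp
      also have "\<dots> \<le> (1 - t) * 1 + t * 1" using CA aA t by (intro add_mono mult_left_mono) auto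
      finally have "norm b \<le> 1" by simp
      moreover have "b \<in> A" unfolding b_def by (intro op_csubspaceD[OF A] CA aA)
      ultimately have "g C \<le> g b" by (intro min) (simp add: unit_ball_def)
      also have "g b = (\<Sum>\<psi>\<in>\<Psi>. (cmod (\<psi> C - \<Phi> \<psi>))\<^sup>2 + t * (2 * Re (cnj (\<psi> C - \<Phi> \<psi>) * (\<psi> a - \<psi> C))) + t\<^sup>2 * (cmod (\<psi> a - \<psi> C))\<^sup>2)"
        unfolding g_def
      proof (rule sum.cong[OF refl])
        fix \<psi> assume "\<psi> \<in> \<Psi>"
        then have \<psi>: "\<psi> \<in> dual_space scale_op norm A" using \<Psi>(2) weak_predual_dual_space by blast
        have "\<psi> (a - C) = \<psi> a - \<psi> C"
          using dual_space_memD(2)[OF \<psi>, of "a - C" C] aA CA by (simp add: op_csubspaceD[OF A])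
        then have "\<psi> b = \<psi> C + of_real t * (\<psi> a - \<psi> C)"
          using dual_space_memD(2)[OF \<psi>, of C "t *\<^sub>R (a - C)"] dual_space_memD(3)[OF \<psi>, of "a - C" "of_real t"] aA CA
          by (simp add: b_def op_csubspaceD[OF A] scale_op_simps)
        then have "\<psi> b - \<Phi> \<psi> = (\<psi> C - \<Phi> \<psi>) + of_real t * (\<psi> a - \<psi> C)" by simp
        then show "(cmod (\<psi> b - \<Phi> \<psi>))\<^sup>2 = (cmod (\<psi> C - \<Phi> \<psi>))\<^sup>2 + t * (2 * Re (cnj (\<psi> C - \<Phi> \<psi>) * (\<psi> a - \<psi> C))) + t\<^sup>2 * (cmod (\<psi> a - \<psi> C))\<^sup>2"
          by (simp only: cmod_sq_add_scaled)
      qed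
      also have "\<dots> = g C + t * (\<Sum>\<psi>\<in>\<Psi>. 2 * Re (cnj (\<psi> C - \<Phi> \<psi>) * (\<psi> a - \<psi> C))) + t\<^sup>2 * (\<Sum>\<psi>\<in>\<Psi>. (cmod (\<psi> a - \<psi> C))\<^sup>2)"
        by (simp only: g_def sum.distrib sum_distrib_left)
      also have "(\<Sum>\<psi>\<in>\<Psi>. 2 * Re (cnj (\<psi> C - \<Phi> \<psi>) * (\<psi> a - \<psi> C))) = - 2 * (Re (\<xi> a) - Re (\<xi> C))"
        by (simp add: \<xi>_def c_def sum_distrib_left flip: sum_subtractf sum_negf) (rule sum.cong, simp_all add: algebra_simps)
      finally show "0 \<le> t * (- 2 * (Re (\<xi> a) - Re (\<xi> C))) + t\<^sup>2 * (\<Sum>\<psi>\<in>\<Psi>. (cmod (\<psi> a - \<psi> C))\<^sup>2)" by simp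
    qed
    then show ?thesis by simp
  qed
  have "dual_norm norm A \<xi> \<le> Re (\<xi> C)"
  proof (rule op_dual_norm_le[OF A])
    fix a assume a: "a \<in> A" "norm a \<le> 1"
    obtain z where z: "cmod z = 1" "z * \<xi> a = of_real (cmod (\<xi> a))" using unimodular_rotation by blast
    have "cmod (\<xi> a) = Re (\<xi> (scale_op z a))"
      using z(2) dual_space_memD(3)[OF \<xi>D a(1), of z] by simp
    also have "\<dots> \<le> Re (\<xi> C)"
      by (rule var) (use a z(1) op_csubspaceD(4)[OF A] in \<open>auto simp: unit_ball_def norm_scale_op\<close>)
    finally show "cmod (\<xi> a) \<le> Re (\<xi> C)" .
  qed
  then have "Re (\<Phi> \<xi>) \<le> Re (\<xi> C)"
    using bd[OF \<xi>E] complex_Re_le_cmod[of "\<Phi> \<xi>"] by linarith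
  moreover have "\<Phi> \<xi> = (\<Sum>\<psi>\<in>\<Psi>. c \<psi> * \<Phi> \<psi>)"
    unfolding \<xi>_def by (rule dual_space_apply_sum[OF E \<Phi> \<Psi>])
  moreover have "(\<Sum>\<psi>\<in>\<Psi>. c \<psi> * \<Phi> \<psi>) - \<xi> C = of_real (g C)"
  proof -
    have "(\<Sum>\<psi>\<in>\<Psi>. c \<psi> * \<Phi> \<psi>) - \<xi> C = (\<Sum>\<psi>\<in>\<Psi>. cnj (\<Phi> \<psi> - \<psi> C) * (\<Phi> \<psi> - \<psi> C))"
      by (simp add: \<xi>_def c_def right_diff_distrib flip: sum_subtractf)
    also have "\<dots> = (\<Sum>\<psi>\<in>\<Psi>. of_real ((cmod (\<psi> C - \<Phi> \<psi>))\<^sup>2))"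
      by (rule sum.cong[OF refl]) (simp only: norm_minus_commute[of "\<psi> C" for \<psi>] complex_norm_square mult.commute)
    finally show ?thesis by (simp add: g_def)
  qed
  ultimately have "g C \<le> 0" by (metis Re_complex_of_real diff_le_0_iff_le minus_complex.simps(1))
  moreover have "0 \<le> g C" by (simp add: g_def sum_nonneg)
  ultimately have "g C = 0" by simp
  then have "\<forall>\<psi>\<in>\<Psi>. \<psi> C = \<Phi> \<psi>" using \<Psi>(1) by (simp add: g_def sum_nonneg_eq_0_iff)
  then show ?thesis using C(1) by blast
qed

text \<open>The solutions \<open>s \<Psi>\<close> for the finite sets \<open>\<Psi>\<close> of conditions form a net, and a weak cluster point \<open>C\<close> of it solves
  all conditions, since these are weakly continuous on the ball. The property \<open>P\<close> need not pass to \<open>C\<close>, but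
  holds along a net converging to \<open>C\<close>.\<close>

lemma finite_conditions_cluster:
  fixes A :: "('a :: complex_hilbert_space \<Rightarrow>\<^sub>L 'a) set"
  assumes cl: "closedin weak_star A"
    and ex: "\<And>\<Psi>. finite \<Psi> \<Longrightarrow> \<Psi> \<subseteq> E \<Longrightarrow> \<exists>a\<in>unit_ball A. P a \<and> (\<forall>\<psi>\<in>\<Psi>. \<psi> a = r \<psi>)"
    and E: "E \<subseteq> weak_predual A"
  obtains C F where "C \<in> unit_ball A" "F \<noteq> bot" "F \<le> principal (unit_ball A)" "weak_limit F C"
    "eventually P F" "\<And>\<psi>. \<psi> \<in> E \<Longrightarrow> \<psi> C = r \<psi>"
proof -
  obtain s where s: "\<And>\<Psi>. finite \<Psi> \<Longrightarrow> \<Psi> \<subseteq> E \<Longrightarrow> s \<Psi> \<in> unit_ball A \<and> P (s \<Psi>) \<and> (\<forall>\<psi>\<in>\<Psi>. \<psi> (s \<Psi>) = r \<psi>)"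
    using ex by metis
  define F where "F = filtermap s (finite_subsets_at_top E)"
  have ev: "\<forall>\<^sub>F \<Psi> in finite_subsets_at_top E. finite \<Psi> \<and> \<Psi> \<subseteq> E"
    by (rule eventually_finite_subsets_at_top_weakI) auto
  have nb: "F \<noteq> bot" by (simp add: F_def filtermap_bot_iff)
  have FB: "F \<le> principal (unit_ball A)"
    unfolding F_def le_principal eventually_filtermap using ev by (rule eventually_mono) (use s in auto)
  have FP: "eventually P F"
    unfolding F_def eventually_filtermap using ev by (rule eventually_mono) (use s in auto)
  obtain C F' where C: "C \<in> unit_ball A" "F' \<le> F" "F' \<noteq> bot" "weak_limit F' C"
    by (rule weak_star_closed_cluster[OF cl nb FB])
  have "\<psi> C = r \<psi>" if \<psi>: "\<psi> \<in> E" for \<psi>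
  proof (rule tendsto_unique[OF C(3)])
    show "(\<psi> \<longlongrightarrow> \<psi> C) F'"
      using \<psi> E by (intro weak_predual_tendsto[OF _ C(1) order_trans[OF C(2) FB] C(4)]) auto
    have "\<forall>\<^sub>F \<Psi> in finite_subsets_at_top E. \<psi> (s \<Psi>) = r \<psi>"
      unfolding eventually_finite_subsets_at_top
      by (rule exI[of _ "{\<psi>}"]) (use \<psi> s in auto)
    then have "\<forall>\<^sub>F a in F. \<psi> a = r \<psi>" unfolding F_def eventually_filtermap .
    then have "\<forall>\<^sub>F a in F'. \<psi> a = r \<psi>" using C(2) by (rule filter_leD[rotated])
    then show "(\<psi> \<longlongrightarrow> r \<psi>) F'" by (rule tendsto_eventually)
  qed
  moreover have "eventually P F'" by (rule filter_leD[OF C(2) FP])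
  ultimately show thesis using C FB by (intro that[of C F']) auto
qed

lemma is_predual_weak_predual:
  assumes A: "op_csubspace A" and cl: "closedin weak_star A"
  shows "is_predual scale_op norm A (weak_predual A)"
  unfolding is_predual_def
proof (intro conjI ballI)
  let ?E = "weak_predual A" and ?dn = "dual_norm norm A"
  show E: "closed_subspace_of_dual scale_op norm A ?E" by (rule closed_subspace_weak_predual[OF A])
  show "dual_norm ?dn ?E (canonical_map ?E a) = norm a" if "a \<in> A" for a
    by (rule canonical_map_isometric[OF A that])
  show "bij_betw (canonical_map ?E) A (dual_space dual_scale ?dn ?E)"
    unfolding bij_betw_def
  proof (intro conjI inj_onI equalityI subsetI)
    fix a b assume ab: "a \<in> A" "b \<in> A" and eq: "canonical_map ?E a = canonical_map ?E b"
    have "cinner (blinfun_apply a x) y = cinner (blinfun_apply b x) y" for x y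
      using fun_cong[OF eq, of "vector_functional A x y"] vector_functional_weak_predual[OF A, of x y] ab
      by (simp add: canonical_map_def vector_functional_def)
    then show "a = b" by (intro blinfun_eqI eq_if_cinner_eq)
  next
    fix \<Phi> assume "\<Phi> \<in> canonical_map ?E ` A"
    then obtain a where a: "a \<in> A" "\<Phi> = canonical_map ?E a" by blast
    have "cmod (\<Phi> \<phi>) \<le> norm a * ?dn \<phi>" if "\<phi> \<in> ?E" for \<phi>
      using op_dual_norm_bound[OF A weak_predual_dual_space[OF that] a(1)] that
      by (simp add: a(2) canonical_map_def mult.commute)
    then have "\<exists>K. \<forall>\<phi>\<in>?E. cmod (\<Phi> \<phi>) \<le> K * ?dn \<phi>" by blast
    then show "\<Phi> \<in> dual_space dual_scale ?dn ?E"
      using E unfolding dual_space_def closed_subspace_of_dual_def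
      by (simp add: a(2) canonical_map_def dual_scale_def)
  next
    fix \<Phi> assume \<Phi>: "\<Phi> \<in> dual_space dual_scale ?dn ?E"
    obtain K0 where K0: "\<And>\<phi>. \<phi> \<in> ?E \<Longrightarrow> cmod (\<Phi> \<phi>) \<le> K0 * ?dn \<phi>"
      by (rule dual_space_boundE[OF \<Phi>], rule that)
    \<comment> \<open>Strictly positive, so that \<open>\<Phi>\<close> can be scaled to norm at most one\<close>
    define K where "K = max K0 1"
    have K: "0 < K" by (simp add: K_def)
    have bound: "cmod (\<Phi> \<phi>) \<le> K * ?dn \<phi>" if "\<phi> \<in> ?E" for \<phi>
    proof -
      have "K0 * ?dn \<phi> \<le> K * ?dn \<phi>"
        by (intro mult_right_mono op_dual_norm_nonneg[OF A weak_predual_dual_space[OF that]]) (simp add: K_def)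
      then show ?thesis using K0[OF that] by simp
    qed
    let ?\<Phi> = "dual_scale (of_real (1 / K)) \<Phi>"
    have \<Phi>': "?\<Phi> \<in> dual_space dual_scale ?dn ?E" by (rule dual_space_scale[OF \<Phi>])
    have bd': "cmod (?\<Phi> \<phi>) \<le> ?dn \<phi>" if "\<phi> \<in> ?E" for \<phi>
      using bound[OF that] K by (simp add: dual_scale_def norm_divide norm_mult field_simps)
    have ex: "\<exists>a\<in>unit_ball A. True \<and> (\<forall>\<psi>\<in>\<Psi>. \<psi> a = ?\<Phi> \<psi>)" if "finite \<Psi>" "\<Psi> \<subseteq> ?E" for \<Psi>
      using finite_interpolation[OF A cl \<Phi>' bd' that] by simp
    obtain C where C: "C \<in> unit_ball A" "\<And>\<psi>. \<psi> \<in> ?E \<Longrightarrow> \<psi> C = ?\<Phi> \<psi>"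
      by (rule finite_conditions_cluster[where P = "\<lambda>_. True" and r = ?\<Phi>, OF cl ex order_refl], assumption, assumption, rule that)
    have CA: "C \<in> A" using C(1) by (simp add: unit_ball_def)
    have "\<Phi> \<phi> = canonical_map ?E (scale_op (of_real K) C) \<phi>" for \<phi>
    proof (cases "\<phi> \<in> ?E")
      case True
      have "\<phi> (scale_op (of_real K) C) = of_real K * \<phi> C"
        by (rule dual_space_memD(3)[OF weak_predual_dual_space[OF True] CA])
      also have "\<dots> = \<Phi> \<phi>" using C(2)[OF True] K by (simp add: dual_scale_def)
      finally show ?thesis using True by (simp add: canonical_map_def)
    next
      case False
      then show ?thesis using dual_space_memD(1)[OF \<Phi>] by (simp add: canonical_map_def)
    qed
    then have "\<Phi> = canonical_map ?E (scale_op (of_real K) C)" by blast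
    then show "\<Phi> \<in> canonical_map ?E ` A" using op_csubspaceD(4)[OF A CA] by blast
  qed
qed

section \<open>Uniqueness of the predual\<close>

lemma predual_norm_le:
  assumes A: "op_csubspace A" and E: "is_predual scale_op norm A E" and b: "b \<in> A"
    and M: "\<And>\<psi>. \<psi> \<in> E \<Longrightarrow> dual_norm norm A \<psi> \<le> 1 \<Longrightarrow> cmod (\<psi> b) \<le> M"
  shows "norm b \<le> M"
proof -
  have z: "0 \<in> E" using E by (simp add: is_predual_def closed_subspace_of_dual_def)
  have z': "dual_norm norm A 0 \<le> 1" by (rule op_dual_norm_le[OF A]) simp
  have "dual_norm (dual_norm norm A) E (canonical_map E b) \<le> M"
    by (rule dual_norm_le[where nrm = "dual_norm norm A", OF z z']) (simp add: canonical_map_def M)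
  then show ?thesis using E b by (simp add: is_predual_def)
qed

lemma predual_separates:
  assumes A: "op_csubspace A" and E: "is_predual scale_op norm A E" and b: "b \<in> A"
    and zero: "\<And>\<psi>. \<psi> \<in> E \<Longrightarrow> \<psi> b = 0"
  shows "b = 0"
  using predual_norm_le[OF A E b, of 0] zero by simp

text \<open>The Banach--Alaoglu theorem for \<open>E\<close>: the canonical map sends the unit ball onto the unit ball of the dual of
  \<open>E\<close>, a closed set of functions in a product of compact discs.\<close>

lemma predual_cluster:
  fixes A :: "('a :: complex_hilbert_space \<Rightarrow>\<^sub>L 'a) set"
  assumes A: "op_csubspace A" and E: "is_predual scale_op norm A E"
    and F: "F \<noteq> bot" "F \<le> principal (unit_ball A)"
  obtains D F' where "D \<in> unit_ball A" "F' \<le> F" "F' \<noteq> bot" "\<And>\<psi>. \<psi> \<in> E \<Longrightarrow> (\<psi> \<longlongrightarrow> \<psi> D) F'"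
proof -
  let ?dn = "dual_norm norm A"
  have Es: "closed_subspace_of_dual scale_op norm A E" using E by (simp add: is_predual_def)
  have ED: "\<psi> \<in> dual_space scale_op norm A" if "\<psi> \<in> E" for \<psi>
    using Es that unfolding closed_subspace_of_dual_def by blast
  let ?Z = "PiE UNIV (\<lambda>\<psi>. if \<psi> \<in> E then cball 0 (?dn \<psi>) else {0})
    \<inter> (\<Inter>\<psi>\<in>E. \<Inter>\<xi>\<in>E. {\<Phi>. \<Phi> (\<psi> + \<xi>) = \<Phi> \<psi> + \<Phi> \<xi>})
    \<inter> (\<Inter>c. \<Inter>\<psi>\<in>E. {\<Phi>. \<Phi> (dual_scale c \<psi>) = c * \<Phi> \<psi>}) :: ((('a \<Rightarrow>\<^sub>L 'a) \<Rightarrow> complex) \<Rightarrow> complex) set"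
  have "compact ?Z"
    by (intro compact_Int_closed compact_PiE_UNIV closed_INT ballI closed_Collect_eq
        continuous_on_add continuous_on_mult continuous_on_const continuous_on_product_coordinates) simp
  moreover have "canonical_map E ` unit_ball A = ?Z"
  proof (intro equalityI subsetI)
    fix \<Phi> assume "\<Phi> \<in> canonical_map E ` unit_ball A"
    then obtain a where a: "a \<in> A" "norm a \<le> 1" "\<Phi> = canonical_map E a" by (auto simp: unit_ball_def)
    have "cmod (\<psi> a) \<le> ?dn \<psi>" if "\<psi> \<in> E" for \<psi>
      using dual_norm_upper[OF ED[OF that] _ a(1,2)] by simp
    then show "\<Phi> \<in> ?Z"
      using Es unfolding closed_subspace_of_dual_def
      by (simp add: a(3) canonical_map_def dual_scale_def PiE_def Pi_def)
  next
    fix \<Phi> assume Z: "\<Phi> \<in> ?Z"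
    have bd: "\<Phi> \<psi> \<in> (if \<psi> \<in> E then cball 0 (?dn \<psi>) else {0})" for \<psi>
      using Z by (intro PiE_mem[of \<Phi> UNIV]) auto
    have le: "cmod (\<Phi> \<psi>) \<le> ?dn \<psi>" if "\<psi> \<in> E" for \<psi> using bd[of \<psi>] that by simp
    have "\<exists>K. \<forall>\<psi>\<in>E. cmod (\<Phi> \<psi>) \<le> K * ?dn \<psi>" using le by (intro exI[of _ 1]) simp
    moreover have "\<Phi> \<psi> = 0" if "\<psi> \<notin> E" for \<psi> using bd[of \<psi>] that by simp
    ultimately have "\<Phi> \<in> dual_space dual_scale ?dn E" using Z unfolding dual_space_def by simp
    then obtain a where a: "a \<in> A" "\<Phi> = canonical_map E a"
      using E unfolding is_predual_def bij_betw_def by blast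
    have "norm a \<le> 1"
    proof (rule predual_norm_le[OF A E a(1)])
      fix \<psi> assume "\<psi> \<in> E" "?dn \<psi> \<le> 1"
      then show "cmod (\<psi> a) \<le> 1" using le[of \<psi>] by (simp add: a(2) canonical_map_def)
    qed
    then show "\<Phi> \<in> canonical_map E ` unit_ball A" using a by (auto simp: unit_ball_def)
  qed
  ultimately have "compact (canonical_map E ` unit_ball A)" by simp
  then obtain D F' where D: "D \<in> unit_ball A" "F' \<le> F" "F' \<noteq> bot" "(canonical_map E \<longlongrightarrow> canonical_map E D) F'"
    by (rule compact_image_cluster[OF _ F])
  have "(\<psi> \<longlongrightarrow> \<psi> D) F'" if "\<psi> \<in> E" for \<psi>
    using tendsto_coordinate[OF D(4), of \<psi>] that by (simp add: canonical_map_def)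
  with D show thesis by (intro that) auto
qed

text \<open>If \<open>\<phi>\<close> in \<open>E\<close> were not weakly continuous at \<open>C\<close>, then some net in the ball would converge weakly to \<open>C\<close> and, by
  compactness, also in the topology of \<open>E\<close> to some \<open>D\<close>, with \<open>\<phi> a\<close> staying away from \<open>\<phi> C\<close>. As the norm is a supremum
  of functionals in \<open>E\<close>, bounds on the norm pass to limits in the topology of \<open>E\<close>, and so \<open>D = C\<close>.\<close>

lemma predual_subset_weak_predual:
  assumes A: "op_csubspace A" and E: "is_predual scale_op norm A E"
    and S: "op_csubspace S" "S \<subseteq> A" "\<And>K. K \<in> S \<Longrightarrow> compact_op K" "A \<subseteq> weak_star closure_of S"
  shows "E \<subseteq> weak_predual A"
proof
  fix \<phi> assume \<phi>: "\<phi> \<in> E"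
  have ED: "\<psi> \<in> dual_space scale_op norm A" if "\<psi> \<in> E" for \<psi>
    using E that unfolding is_predual_def closed_subspace_of_dual_def by blast
  show "\<phi> \<in> weak_predual A"
    unfolding weak_predual_def
  proof (intro CollectI conjI ballI allI impI ED[OF \<phi>] tendstoI)
    fix C F \<epsilon> assume C: "C \<in> unit_ball A" and F: "F \<le> principal (unit_ball A)" and lim: "weak_limit F C"
      and eps: "0 < (\<epsilon> :: real)"
    show "\<forall>\<^sub>F a in F. dist (\<phi> a) (\<phi> C) < \<epsilon>"
    proof (rule ccontr)
      assume nev: "\<not> ?thesis"
      let ?F = "inf F (principal {a. \<not> dist (\<phi> a) (\<phi> C) < \<epsilon>})"
      have nb: "?F \<noteq> bot"
        using nev by (simp add: trivial_limit_def eventually_inf_principal)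
      have FB: "?F \<le> principal (unit_ball A)" using F by (rule le_infI1)
      obtain D F' where D: "D \<in> unit_ball A" "F' \<le> ?F" "F' \<noteq> bot"
        and lim': "\<And>\<psi>. \<psi> \<in> E \<Longrightarrow> (\<psi> \<longlongrightarrow> \<psi> D) F'"
        by (rule predual_cluster[OF A E nb FB], rule that)
      have F'F: "F' \<le> F" using D(2) by simp
      have F'B: "\<forall>\<^sub>F a in F'. a \<in> unit_ball A" using F F'F by (simp add: le_principal filter_leD)
      have CA: "C \<in> A" "norm C \<le> 1" and DA: "D \<in> A" using C D by (auto simp: unit_ball_def)
      have DC: "D - C \<in> A" by (rule op_csubspaceD(6)[OF A DA CA(1)])
      have "D - C = 0"
      proof (rule weakly_null_limit_eq_0[OF S(1,3)])
        show "D - C \<in> weak_star closure_of S" using DC S(4) by blast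
        let ?G = "filtermap (\<lambda>a. a - C) F'"
        show "\<forall>\<^sub>F R in ?G. R \<in> bounded_ops \<and> norm R \<le> 2"
          unfolding eventually_filtermap using F'B
        proof (rule eventually_mono)
          fix a assume "a \<in> unit_ball A"
          then have a: "a \<in> A" "norm a \<le> 1" by (auto simp: unit_ball_def)
          have "norm (a - C) \<le> 2" using norm_triangle_ineq4[of a C] a(2) CA(2) by linarith
          then show "a - C \<in> bounded_ops \<and> norm (a - C) \<le> 2"
            using op_csubspaceD(1,6)[OF A] a(1) CA(1) by blast
        qed
        show "((\<lambda>R. cinner (blinfun_apply R x) y) \<longlongrightarrow> 0) ?G" for x y
        proof -
          have "((\<lambda>a. cinner (blinfun_apply a x) y - cinner (C x) y) \<longlongrightarrow> 0) F'"
            using weak_limit_mono[OF lim F'F] unfolding weak_limit_def by (intro LIM_zero) blast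
          then show ?thesis
            unfolding filterlim_filtermap by (simp add: blinfun.diff_left cinner_diff_left)
        qed
        fix K s M assume K: "K \<in> S" and ev: "\<forall>\<^sub>F R in ?G. norm (K + s *\<^sub>R R) \<le> M"
        have KA: "K \<in> A" using K S(2) by blast
        show "norm (K + s *\<^sub>R (D - C)) \<le> M"
        proof (rule predual_norm_le[OF A E])
          show "K + s *\<^sub>R (D - C) \<in> A" by (intro op_csubspaceD[OF A] KA DC)
          fix \<psi> assume \<psi>: "\<psi> \<in> E" "dual_norm norm A \<psi> \<le> 1"
          note \<psi>D = ED[OF \<psi>(1)]
          have expand: "\<psi> (K + s *\<^sub>R (a - C)) = \<psi> K + of_real s * (\<psi> a - \<psi> C)" if a: "a \<in> A" for a
          proof -
            have "\<psi> (a - C) = \<psi> a - \<psi> C"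
              using dual_space_memD(2)[OF \<psi>D, of "a - C" C] a CA by (simp add: op_csubspaceD[OF A])
            moreover have "\<psi> (s *\<^sub>R (a - C)) = of_real s * \<psi> (a - C)"
              using dual_space_memD(3)[OF \<psi>D, of "a - C" "of_real s"] a CA
              by (simp add: op_csubspaceD[OF A] scale_op_simps)
            ultimately show ?thesis
              using dual_space_memD(2)[OF \<psi>D KA, of "s *\<^sub>R (a - C)"] a CA by (simp add: op_csubspaceD[OF A])
          qed
          show "cmod (\<psi> (K + s *\<^sub>R (D - C))) \<le> M"
          proof (rule tendsto_upperbound[OF _ _ D(3)])
            show "((\<lambda>a. cmod (\<psi> K + of_real s * (\<psi> a - \<psi> C))) \<longlongrightarrow> cmod (\<psi> (K + s *\<^sub>R (D - C)))) F'"
              unfolding expand[OF DA] by (intro tendsto_intros lim' \<psi>)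
            have "\<forall>\<^sub>F a in F'. norm (K + s *\<^sub>R (a - C)) \<le> M" using ev by (simp add: eventually_filtermap)
            with F'B show "\<forall>\<^sub>F a in F'. cmod (\<psi> K + of_real s * (\<psi> a - \<psi> C)) \<le> M"
            proof eventually_elim
              case (elim a)
              have aA: "a \<in> A" using elim(1) by (simp add: unit_ball_def)
              have mem: "K + s *\<^sub>R (a - C) \<in> A" by (intro op_csubspaceD[OF A] KA aA CA)
              have "cmod (\<psi> (K + s *\<^sub>R (a - C))) \<le> dual_norm norm A \<psi> * norm (K + s *\<^sub>R (a - C))"
                by (rule op_dual_norm_bound[OF A \<psi>D mem])
              also have "\<dots> \<le> 1 * norm (K + s *\<^sub>R (a - C))" by (intro mult_right_mono \<psi>) simp
              finally show ?case using elim(2) by (simp add: expand[OF aA])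
            qed
          qed
        qed
      qed
      then have "(\<phi> \<longlongrightarrow> \<phi> C) F'" using lim'[OF \<phi>] by simp
      then have "\<forall>\<^sub>F a in F'. dist (\<phi> a) (\<phi> C) < \<epsilon>" using eps by (rule tendstoD)
      moreover have "\<forall>\<^sub>F a in F'. \<not> dist (\<phi> a) (\<phi> C) < \<epsilon>"
        using D(2) by (simp add: le_principal)
      ultimately have "\<forall>\<^sub>F a in F'. False" by eventually_elim simp
      then show False using D(3) by (simp add: trivial_limit_def)
    qed
  qed
qed

text \<open>As \<open>E\<close> separates points and \<open>\<phi>\<close> is weakly continuous on the compact ball, \<open>\<phi>\<close> is small on the common kernel of
  finitely many elements of \<open>E\<close>, hence close in norm to their span. As \<open>E\<close> is closed, it contains \<open>\<phi>\<close>.\<close>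

lemma weak_predual_subset_predual:
  assumes A: "op_csubspace A" and cl: "closedin weak_star A" and E: "is_predual scale_op norm A E"
    and sub: "E \<subseteq> weak_predual A"
  shows "weak_predual A \<subseteq> E"
proof
  fix \<phi> assume \<phi>: "\<phi> \<in> weak_predual A"
  have \<phi>D: "\<phi> \<in> dual_space scale_op norm A" by (rule weak_predual_dual_space[OF \<phi>])
  have Es: "closed_subspace_of_dual scale_op norm A E" using E by (simp add: is_predual_def)
  have "\<exists>\<psi>\<in>E. dual_norm norm A (\<phi> - \<psi>) < \<epsilon>" if eps: "0 < \<epsilon>" for \<epsilon>
  proof -
    have "\<exists>\<Psi>. finite \<Psi> \<and> \<Psi> \<subseteq> E \<and> (\<forall>a\<in>unit_ball A. (\<forall>\<psi>\<in>\<Psi>. \<psi> a = 0) \<longrightarrow> cmod (\<phi> a) \<le> \<epsilon> / 2)"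
    proof (rule ccontr)
      assume "\<not> ?thesis"
      then have ex: "\<exists>a\<in>unit_ball A. \<epsilon> / 2 < cmod (\<phi> a) \<and> (\<forall>\<psi>\<in>\<Psi>. \<psi> a = 0)" if "finite \<Psi>" "\<Psi> \<subseteq> E" for \<Psi>
        using that by (metis not_le)
      obtain C F where C: "C \<in> unit_ball A" "F \<noteq> bot" "F \<le> principal (unit_ball A)" "weak_limit F C"
        "\<forall>\<^sub>F a in F. \<epsilon> / 2 < cmod (\<phi> a)" "\<And>\<psi>. \<psi> \<in> E \<Longrightarrow> \<psi> C = 0"
        by (rule finite_conditions_cluster[OF cl ex sub], assumption, assumption, rule that)
      have "C = 0" by (rule predual_separates[OF A E _ C(6)]) (use C(1) in \<open>auto simp: unit_ball_def\<close>)
      have "((\<lambda>a. cmod (\<phi> a)) \<longlongrightarrow> cmod (\<phi> C)) F"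
        by (intro tendsto_norm weak_predual_tendsto[OF \<phi> C(1,3,4)])
      then have "\<epsilon> / 2 \<le> cmod (\<phi> C)"
        by (rule tendsto_lowerbound[OF _ _ C(2)]) (use C(5) in \<open>auto elim: eventually_mono\<close>)
      moreover have "\<phi> C = 0"
        using op_dual_norm_bound[OF A \<phi>D, of C] op_csubspaceD(2)[OF A] by (simp add: \<open>C = 0\<close>)
      ultimately show False using eps by simp
    qed
    then obtain \<Psi> where \<Psi>: "finite \<Psi>" "\<Psi> \<subseteq> E"
      and small: "\<And>a. a \<in> A \<Longrightarrow> norm a \<le> 1 \<Longrightarrow> (\<And>\<psi>. \<psi> \<in> \<Psi> \<Longrightarrow> \<psi> a = 0) \<Longrightarrow> cmod (\<phi> a) \<le> \<epsilon> / 2"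
      by (auto simp: unit_ball_def)
    have \<Psi>D: "\<Psi> \<subseteq> dual_space scale_op norm A"
      using \<Psi>(2) Es unfolding closed_subspace_of_dual_def by blast
    have e2: "0 \<le> \<epsilon> / 2" using eps by simp
    obtain c where c: "\<And>a. a \<in> A \<Longrightarrow> cmod (\<phi> a - (\<Sum>\<psi>\<in>\<Psi>. c \<psi> * \<psi> a)) \<le> \<epsilon> / 2 * norm a"
      by (rule finite_correction_complex[OF A \<phi>D \<Psi>(1) \<Psi>D e2 small], assumption, assumption, blast, rule that)
    have "dual_norm norm A (\<phi> - (\<lambda>a. \<Sum>\<psi>\<in>\<Psi>. c \<psi> * \<psi> a)) \<le> \<epsilon> / 2"
    proof (rule op_dual_norm_le[OF A])
      fix a assume a: "a \<in> A" "norm a \<le> 1"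
      show "cmod ((\<phi> - (\<lambda>a. \<Sum>\<psi>\<in>\<Psi>. c \<psi> * \<psi> a)) a) \<le> \<epsilon> / 2"
        using c[OF a(1)] mult_left_mono[OF a(2) e2] by simp
    qed
    then show ?thesis
      using closed_subspace_of_dual_sum[OF Es \<Psi>, of c] eps by (intro bexI) auto
  qed
  then show "\<phi> \<in> E" using Es \<phi>D unfolding closed_subspace_of_dual_def by blast
qed

theorem theorem4p2:
  fixes \<AA> :: "('a :: complex_hilbert_space \<Rightarrow>\<^sub>L 'a) set"
  assumes "op_subalgebra \<AA>"
    and "id_blinfun \<in> \<AA>"
    and "closedin weak_star \<AA>"
    and "\<exists>\<KK>. op_subalgebra \<KK> \<and> \<KK> \<subseteq> \<AA> \<and> (\<forall>T\<in>\<KK>. compact_op T) \<and>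
           \<AA> \<subseteq> weak_star closure_of \<KK>"
  shows "strongly_unique_predual scale_op norm \<AA>"
proof -
  have A: "op_csubspace \<AA>" by (rule op_subalgebra_imp_op_csubspace[OF assms(1)])
  obtain \<KK> where K: "op_csubspace \<KK>" "\<KK> \<subseteq> \<AA>" "\<And>T. T \<in> \<KK> \<Longrightarrow> compact_op T"
    "\<AA> \<subseteq> weak_star closure_of \<KK>"
    using assms(4) op_subalgebra_imp_op_csubspace by blast
  show ?thesis
    unfolding strongly_unique_predual_def
  proof (rule ex1I)
    show "is_predual scale_op norm \<AA> (weak_predual \<AA>)"
      by (rule is_predual_weak_predual[OF A assms(3)])
    fix E assume E: "is_predual scale_op norm \<AA> E"
    have "E \<subseteq> weak_predual \<AA>" by (rule predual_subset_weak_predual[OF A E K])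
    moreover from this have "weak_predual \<AA> \<subseteq> E" by (rule weak_predual_subset_predual[OF A assms(3) E])
    ultimately show "E = weak_predual \<AA>" by (rule equalityI)
  qed
qed

end
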